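(* Let $A, B > 1$ and $t > 1$ be fixed constants, and let $\gamma_{A,B} = \mathrm{Cap}(\mathbb{D}_1 \cup \mathbb{D}_2)$ be the logarithmic capacity of the union of the two disks $$\mathbb{D}_1 = \mathbb{D}\left(\frac{1}{A^2-1}, \frac{A}{A^2-1}\right), \qquad \mathbb{D}_2 = \mathbb{D}\left(\frac{B^2}{1-B^2}, \frac{B}{B^2-1}\right).$$ Then, as $d \to \infty$, $$\log \mathrm{Vol}\left(\mathcal{C}_{A,B}^2(d;t)\right) = -\tfrac12 \log \gamma_{A,B}\cdot d^2 - \tfrac12 d\log d + O(d\log t),$$ and $$\log \mathrm{Vol}\left(\mathcal{C}_{A,B}^\infty(d;t)\right) = -\tfrac12 \log \gamma_{A,B}\cdot d^2 + O(d\log t).$$ Moreover, when $\gamma_{A,B} \in (0,1)$, as $d\to\infty$, $$\log \#\left\{\mathcal{C}_{A,B}^2(d;t) \cap \mathbb{Z}^{d+1}\right\} = \log \mathrm{Vol}\left(\mathcal{C}_{A,B}^2(d;t)\right) + O(d\log t).$$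
   Context: Notation: $\mathbb{N} = \{0,1,2,\dots\}$, $\mathbb{N}^+ = \{1,2,3,\dots\}$. $\mathbb{D}(a,r)$ is the disk in $\mathbb{C}$ with center $a$ and radius $r$. For $\mathbf{c} = (c_0,\dots,c_d) \in \mathbb{R}^{d+1}$ put $P_{\mathbf{c}}(x) = \sum_{k=0}^d c_k \binom{x}{k}$, where $\binom{x}{k} = \frac{x(x-1)\cdots(x-k+1)}{k!}$ for every real $x$ (with $\binom{x}{0}=1$). Define the convex bodies $$\mathcal{C}_{A,B}^\infty(d;t) = \left\{\mathbf{c}\in\mathbb{R}^{d+1} : \sup_{n\in\mathbb{N}} |P_{\mathbf{c}}(n)A^{-n}| \le t,\ \sup_{n\in\mathbb{N}^+} |P_{\mathbf{c}}(-n)B^{-n}| \le t\right\},$$ $$\mathcal{C}_{A,B}^2(d;t) = \left\{\mathbf{c}\in\mathbb{R}^{d+1} : \sum_{n\in\mathbb{N}} |P_{\mathbf{c}}(n)|^2A^{-2n} \le t^2,\ \sum_{n\in\mathbb{N}^+} |P_{\mathbf{c}}(-n)|^2B^{-2n} \le t^2\right\}.$$ $\mathrm{Vol}$ is Lebesgue measure on $\mathbb{R}^{d+1}$. The logarithmic capacity of a compact set $E\subset\mathbb{C}$ is $$\mathrm{Cap}(E) = \exp\left(-\inf_\nu \int_{E\times E} \log\frac{1}{|z-w|}\, d\nu(z)\, d\nu(w)\right),$$ the infimum being over probability measures $\nu$ supported on $E$; the disks $\mathbb{D}_1,\mathbb{D}_2$ are taken closed when computing the capacity. Since $A,B,t$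 are fixed, $O(d\log t)$ denotes a quantity bounded in absolute value by $C\, d\log t$ for all large $d$, where $C$ may depend on $A,B,t$ but not on $d$. *)

theory Defs
  imports "HOL-Probability.Probability" "HOL-Library.Landau_Symbols"
begin

text \<open>
  A vector \<open>(c\<^sub>0, \<dots>, c\<^sub>d)\<close> of \<open>\<real>\<^sup>d\<^sup>+\<^sup>1\<close> is a function in \<open>{..d} \<rightarrow>\<^sub>E UNIV\<close>
  (\<open>undefined\<close> outside \<open>{..d}\<close>), the space of the product measure used for \<open>Vol\<close>.
\<close>

definition P_poly :: "nat \<Rightarrow> (nat \<Rightarrow> real) \<Rightarrow> real \<Rightarrow> real" where
  "P_poly d c x = (\<Sum>k\<le>d. c k * (x gchoose k))"

text \<open>
  Suprema and series are taken in \<open>[0, \<infinity>]\<close>, so that unbounded families and divergent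
  series violate the bounds. Sums over \<open>n \<ge> 1\<close> are written with \<open>Suc n\<close>.
\<close>

definition C_sup :: "real \<Rightarrow> real \<Rightarrow> nat \<Rightarrow> real \<Rightarrow> (nat \<Rightarrow> real) set" where
  "C_sup A B d t = {c \<in> {..d} \<rightarrow>\<^sub>E UNIV.
     (SUP n::nat. ennreal \<bar>P_poly d c (real n) * A powi (- int n)\<bar>) \<le> ennreal t \<and>
     (SUP n\<in>{1::nat..}. ennreal \<bar>P_poly d c (- real n) * B powi (- int n)\<bar>) \<le> ennreal t}"

definition C_two :: "real \<Rightarrow> real \<Rightarrow> nat \<Rightarrow> real \<Rightarrow> (nat \<Rightarrow> real) set" where
  "C_two A B d t = {c \<in> {..d} \<rightarrow>\<^sub>E UNIV.
     (\<Sum>n::nat. ennreal (\<bar>P_poly d c (real n)\<bar>\<^sup>2 * A powi (- 2 * int n))) \<le> ennreal (t\<^sup>2) \<and>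
     (\<Sum>n::nat. ennreal (\<bar>P_poly d c (- real (Suc n))\<bar>\<^sup>2 * B powi (- 2 * int (Suc n))))
        \<le> ennreal (t\<^sup>2)}"

definition Vol :: "nat \<Rightarrow> (nat \<Rightarrow> real) set \<Rightarrow> real" where
  "Vol d S = measure (\<Pi>\<^sub>M i\<in>{..d}. lborel) S"

definition integer_points :: "nat \<Rightarrow> (nat \<Rightarrow> real) set" where
  "integer_points d = {..d} \<rightarrow>\<^sub>E (\<int> :: real set)"

text \<open>
  The kernel \<open>log (1 / |z - w|)\<close> takes the value \<open>\<infinity>\<close> on the diagonal; the real-valued
  expression would give \<open>ln (1 / 0) = 0\<close> there.
\<close>

definition log_kernel :: "complex \<Rightarrow> complex \<Rightarrow> ereal" where
  "log_kernel z w = (if z = w then \<infinity> else ereal (ln (1 / cmod (z - w))))"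

text \<open>
  The extended Lebesgue integral of the kernel, as integral of the positive part minus integral
  of the negative part (\<open>e2ennreal\<close> sends negative values to \<open>0\<close>). For a probability measure on a
  bounded set the negative part has a finite integral.
\<close>

definition log_energy :: "complex measure \<Rightarrow> ereal" where
  "log_energy \<nu> =
     enn2ereal (\<integral>\<^sup>+ p. e2ennreal (log_kernel (fst p) (snd p)) \<partial>(\<nu> \<Otimes>\<^sub>M \<nu>)) -
     enn2ereal (\<integral>\<^sup>+ p. e2ennreal (- log_kernel (fst p) (snd p)) \<partial>(\<nu> \<Otimes>\<^sub>M \<nu>))"

definition prob_measures_on :: "complex set \<Rightarrow> complex measure set" where
  "prob_measures_on E = {\<nu>. sets \<nu> = sets borel \<and> prob_space \<nu> \<and> (AE z in \<nu>. z \<in> E)}"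

definition min_energy :: "complex set \<Rightarrow> ereal" where
  "min_energy E = (INF \<nu>\<in>prob_measures_on E. log_energy \<nu>)"

text \<open>For compact \<open>E\<close>, with the convention \<open>exp (-\<infinity>) = 0\<close>.\<close>

definition log_capacity :: "complex set \<Rightarrow> real" where
  "log_capacity E = (if min_energy E = \<infinity> then 0 else exp (- real_of_ereal (min_energy E)))"

definition disk1 :: "real \<Rightarrow> complex set" where
  "disk1 A = cball (complex_of_real (1 / (A\<^sup>2 - 1))) (A / (A\<^sup>2 - 1))"

definition disk2 :: "real \<Rightarrow> complex set" where
  "disk2 B = cball (complex_of_real (B\<^sup>2 / (1 - B\<^sup>2))) (B / (B\<^sup>2 - 1))"

definition gamma_cap :: "real \<Rightarrow> real \<Rightarrow> real" where
  "gamma_cap A B = log_capacity (disk1 A \<union> disk2 B)"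

end

theory Submission imports Defs "HOL-Complex_Analysis.Complex_Analysis" "HOL-Real_Asymp.Real_Asymp" begin

text \<open>
  Let \<open>h\<^sub>k\<close> be the least value of the quadratic form
  \<open>Q(P) = (\<Sum>n\<ge>0. P(n)\<^sup>2 A\<^bsup>-2n\<^esup>) + (\<Sum>n\<ge>1. P(-n)\<^sup>2 B\<^bsup>-2n\<^esup>)\<close> over the polynomials of degree \<open>k\<close> with leading
  Newton coefficient \<open>1\<close>. By Gram-Schmidt, \<open>Q\<close> becomes diagonal with entries \<open>h\<^sub>k\<close> in unitriangular
  coordinates, so everything reduces to \<open>h\<^sub>k\<close> being \<open>\<gamma>\<^bsup>2k\<^esup>\<close> up to a constant factor.

  The generating function \<open>\<Sum>n. P(n) z\<^sup>n = (\<Sum>j. c\<^sub>j z\<^sup>j / (1 - z)\<^bsup>j+1\<^esup>)\<close> expands at infinity with the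
  coefficients \<open>- P(-n)\<close>, so \<open>Q\<close> is a sum of squared \<open>L\<^sup>2\<close> norms on the circles \<open>|z| = 1/A\<close> and \<open>|z| = B\<close>.
  Let \<open>G\<close> be the regular part of the Green function of the annulus with pole at \<open>1\<close>. Pairing with
  \<open>exp(-kG) z\<^bsup>-s\<^esup>\<close> bounds the leading coefficient from above, and truncating the principal part of
  \<open>exp(kG) z\<^sup>s / (1 - z)\<^bsup>k+1\<^esup>\<close> at \<open>1\<close> attains the bound; the integer \<open>s\<close> balances the two circles.

  The map \<open>u = z/(1 - z)\<close> takes the two circles to the boundaries of the two disks, so the same pairing
  bounds monic polynomials on the disks from below and yields Leja points, whose smeared counting
  measures bound the energy from above; the near-extremal polynomials bound Vandermonde products, and
  with them all energies, in the other direction. Smearing enlarges the disks slightly, which is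
  absorbed by the continuity of \<open>\<gamma>\<close> in \<open>A\<close> and \<open>B\<close>.

  The volume of \<open>Q \<le> s\<close> follows from inscribed boxes and a Gaussian majorant. For the sup norm,
  exponential decay leaves only \<open>O(d)\<close> relevant functionals, and cutting \<open>Q \<le> t\<^sup>2(d + 1)\<close> into the cells
  given by their integer parts produces only \<open>exp(O(d))\<close> cells. If \<open>\<gamma> < 1\<close> then \<open>\<Sum>k. h\<^sub>k\<close> converges, so
  unit boxes in the triangular coordinates have bounded \<open>Q\<close>-diameter: packing them bounds the number
  of lattice points from above, and Blichfeldt's argument bounds it from below.
\<close>

section \<open>Ellipsoids in triangular coordinates\<close>

text \<open>An error \<open>O(d)\<close> in the logarithm of a product of \<open>d + 1\<close>
  factors is affordable only if each \<open>h k\<close> is known up to a factor independent of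
  \<open>k\<close>; limits of \<open>k\<close>-th roots, the natural language of capacity, would be
  too coarse. Hence the explicit Green function. The modulus of \<open>Hk k z\<close>, which is
  \<open>exp(kG)\<close> times a power of \<open>z\<close>, equals on each circle a constant times
  \<open>|1 - z| ^ k\<close>, with both constants within a bounded factor of \<open>kap ^ k\<close>,
  while \<open>Hk k 1\<close> is \<open>exp(-k tau)\<close>. Inverted as a test function and
  directly as a numerator, it yields the same number \<open>gam = kap * exp tau\<close> from below
  and from above.

  That \<open>gam\<close> is the capacity is a separate question. No equilibrium measure is
  constructed: the infimum of the energies is squeezed between values of \<open>gam\<close> at
  neighbouring parameters.

  The term \<open>d log d\<close> is a matter of scale. Up to \<open>exp(O(n))\<close>, the volume
  of \<open>Q \<le> s\<close> in dimension \<open>n\<close> is that of a box with sides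
  \<open>sqrt (s / (n * h j))\<close>; the factor \<open>1 / n\<close> survives for fixed
  \<open>s\<close> and cancels when \<open>s\<close> grows like \<open>d\<close>, as it does for the
  sup norm.\<close>

abbreviation lebn :: "nat \<Rightarrow> (nat \<Rightarrow> real) measure" where
  "lebn n \<equiv> \<Pi>\<^sub>M i\<in>{..<n}. lborel"

lemma product_sigma_finite_lborel: "product_sigma_finite (\<lambda>_::nat. lborel :: real measure)"
  by standard

text \<open>With \<open>T = gs_T g\<close> these are the coordinates of \<open>c\<close> in the
  Gram-Schmidt basis \<open>gs g j\<close>. Only the entries \<open>T k j\<close> with
  \<open>j < k\<close> are read.\<close>

definition tri :: "(nat \<Rightarrow> nat \<Rightarrow> real) \<Rightarrow> nat \<Rightarrow> (nat \<Rightarrow> real) \<Rightarrow> nat \<Rightarrow> real" where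
  "tri T n c j = c j + (\<Sum>k\<in>{j<..<n}. c k * T k j)"

lemma tri_add: "tri T n (\<lambda>j. x j + y j) j = tri T n x j + tri T n y j"
  by (simp add: tri_def sum.distrib algebra_simps)

lemma tri_diff: "tri T n (\<lambda>j. x j - y j) j = tri T n x j - tri T n y j"
  by (simp add: tri_def sum_subtractf algebra_simps)

lemma tri_mult: "tri T n (\<lambda>j. a * x j) j = a * tri T n x j"
  by (simp add: tri_def sum_distrib_left algebra_simps)

lemma tri_cong: "(\<And>k. k < n \<Longrightarrow> x k = y k) \<Longrightarrow> j < n \<Longrightarrow> tri T n x j = tri T n y j"
  by (auto simp: tri_def intro!: sum.cong)

lemma tri_Suc:
  assumes "j < n"
  shows "tri T (Suc n) (x(n := u)) j = tri T n x j + u * T n j"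
proof -
  have "{j<..<Suc n} = insert n {j<..<n}" using assms by auto
  moreover have "(\<Sum>k\<in>{j<..<n}. (x(n := u)) k * T k j) = (\<Sum>k\<in>{j<..<n}. x k * T k j)"
    by (rule sum.cong) auto
  ultimately show ?thesis using assms by (simp add: tri_def)
qed

lemma measurable_tri_component[measurable]:
  "j < n \<Longrightarrow> (\<lambda>c. tri T n c j) \<in> borel_measurable (lebn n)"
  unfolding tri_def by measurable

lemma measurable_tri[measurable]:
  "(\<lambda>c. \<lambda>j\<in>{..<n}. tri T n c j + a j) \<in> measurable (lebn n) (lebn n)"
  by (rule measurable_restrict) simp

text \<open>Fubini replaces a determinant. The last coordinate \<open>u\<close> is integrated
  outermost; for fixed \<open>u\<close> the remaining map is triangular of size \<open>n\<close>
  with the additional shift \<open>u * T n j\<close>. This is why the induction carries an arbitrary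
  shift \<open>a\<close>.\<close>

lemma nn_integral_tri:
  assumes "f \<in> borel_measurable (lebn n)"
  shows "(\<integral>\<^sup>+ c. f (\<lambda>j\<in>{..<n}. tri T n c j + a j) \<partial>lebn n) = (\<integral>\<^sup>+ c. f c \<partial>lebn n)"
  using assms
proof (induction n arbitrary: f a)
  case 0
  interpret product_sigma_finite "\<lambda>_::nat. lborel :: real measure" by (rule product_sigma_finite_lborel)
  have "(\<integral>\<^sup>+ c. f (\<lambda>k. undefined) \<partial>PiM {} (\<lambda>_::nat. lborel :: real measure)) = f (\<lambda>k. undefined)"
    by (rule nn_integral_empty) simp
  then show ?case by (simp add: nn_integral_empty[of f] restrict_def del: nn_integral_const)
next
  case (Suc n)
  interpret product_sigma_finite "\<lambda>_::nat. lborel :: real measure" by (rule product_sigma_finite_lborel)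
  note Suc.prems[measurable]
  have ins: "insert n {..<n} = {..<Suc n}" by auto
  have f_ins: "f \<in> borel_measurable (PiM (insert n {..<n}) (\<lambda>_. lborel))" using Suc.prems by (simp add: ins)
  have upd: "(\<lambda>x. x(n := u)) \<in> measurable (lebn n) (lebn (Suc n))" for u :: real
    unfolding ins[symmetric] by (rule measurable_fun_upd[where J="{..<n}"]) auto
  have step: "(\<lambda>j\<in>{..<Suc n}. tri T (Suc n) (x(n := u)) j + a j)
      = (\<lambda>j\<in>{..<n}. tri T n x j + (u * T n j + a j))(n := u + a n)" for x u
  proof
    fix j
    have [simp]: "{n<..<Suc n} = {}" by auto
    show "(\<lambda>j\<in>{..<Suc n}. tri T (Suc n) (x(n := u)) j + a j) j
      = ((\<lambda>j\<in>{..<n}. tri T n x j + (u * T n j + a j))(n := u + a n)) j"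
      by (cases "j < n"; cases "j = n") (auto simp: tri_Suc, auto simp: tri_def)
  qed
  define g where "g = (\<lambda>c. f (\<lambda>j\<in>{..<Suc n}. tri T (Suc n) c j + a j))"
  have g: "g \<in> borel_measurable (PiM (insert n {..<n}) (\<lambda>_. lborel))"
    unfolding ins g_def by (rule measurable_compose[OF measurable_tri Suc.prems])
  have F: "(\<lambda>u. \<integral>\<^sup>+ x. f (x(n := u)) \<partial>lebn n) \<in> borel_measurable lborel"
  proof -
    interpret sigma_finite_measure "lebn n" by (rule sigma_finite) simp
    have *: "(\<lambda>(u,x). f (x(n := u))) \<in> borel_measurable (lborel \<Otimes>\<^sub>M lebn n)"
      using f_ins by measurable
    show ?thesis using borel_measurable_nn_integral[OF *] by simp
  qed
  have "(\<integral>\<^sup>+ c. g c \<partial>lebn (Suc n)) = (\<integral>\<^sup>+ u. (\<integral>\<^sup>+ x. g (x(n := u)) \<partial>lebn n) \<partial>lborel)"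
    using product_nn_integral_insert_rev[OF _ _ g] by (simp add: ins)
  also have "\<dots> = (\<integral>\<^sup>+ u. (\<integral>\<^sup>+ x. f ((\<lambda>j\<in>{..<n}. tri T n x j + (u * T n j + a j))(n := u + a n)) \<partial>lebn n) \<partial>lborel)"
    by (simp only: g_def step)
  also have "\<dots> = (\<integral>\<^sup>+ u. (\<integral>\<^sup>+ x. f (x(n := u + a n)) \<partial>lebn n) \<partial>lborel)"
    by (intro nn_integral_cong Suc.IH[where f="\<lambda>y. f (y(n := _ + a n))"] measurable_compose[OF upd Suc.prems])
  also have "\<dots> = (\<integral>\<^sup>+ u. (\<integral>\<^sup>+ x. f (x(n := u)) \<partial>lebn n) \<partial>lborel)"
    using nn_integral_real_affine[of "\<lambda>u. \<integral>\<^sup>+ x. f (x(n := u)) \<partial>lebn n" 1 "a n"] F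
    by (simp add: add.commute)
  also have "\<dots> = (\<integral>\<^sup>+ c. f c \<partial>lebn (Suc n))"
    using product_nn_integral_insert_rev[OF _ _ f_ins] by (simp add: ins)
  finally show ?case unfolding g_def .
qed

lemma emeasure_tri:
  assumes "S \<in> sets (lebn n)"
  shows "emeasure (lebn n) {c \<in> space (lebn n). (\<lambda>j\<in>{..<n}. tri T n c j + a j) \<in> S} = emeasure (lebn n) S"
proof -
  have m: "{c \<in> space (lebn n). (\<lambda>j\<in>{..<n}. tri T n c j + a j) \<in> S} \<in> sets (lebn n)"
    using measurable_sets[OF measurable_tri assms, of T a] by (simp add: vimage_def Int_def conj_commute)
  have "emeasure (lebn n) {c \<in> space (lebn n). (\<lambda>j\<in>{..<n}. tri T n c j + a j) \<in> S}
     = (\<integral>\<^sup>+ c. indicator S (\<lambda>j\<in>{..<n}. tri T n c j + a j) \<partial>lebn n)"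
    by (subst nn_integral_indicator[OF m, symmetric], rule nn_integral_cong) (auto simp: indicator_def)
  also have "\<dots> = emeasure (lebn n) S"
    using assms by (subst nn_integral_tri) auto
  finally show ?thesis .
qed

lemma emeasure_translate:
  assumes "S \<in> sets (lebn n)"
  shows "emeasure (lebn n) {c \<in> space (lebn n). (\<lambda>j\<in>{..<n}. c j + a j) \<in> S} = emeasure (lebn n) S"
  using emeasure_tri[OF assms, of "\<lambda>_ _. 0" a] by (simp add: tri_def)

lemma sets_PiE_lebn: "(\<And>j. j < n \<Longrightarrow> X j \<in> sets borel) \<Longrightarrow> PiE {..<n} X \<in> sets (lebn n)"
  by (rule sets_PiM_I_finite) auto

lemma emeasure_box:
  assumes "\<And>j. j < n \<Longrightarrow> l j \<le> (u j :: real)"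
  shows "emeasure (lebn n) (PiE {..<n} (\<lambda>j. {l j..u j})) = ennreal (\<Prod>j<n. u j - l j)"
proof -
  interpret product_sigma_finite "\<lambda>_::nat. lborel :: real measure" by (rule product_sigma_finite_lborel)
  have "emeasure (lebn n) (PiE {..<n} (\<lambda>j. {l j..u j})) = (\<Prod>j<n. ennreal (u j - l j))"
    using assms by (subst emeasure_PiM) auto
  also have "\<dots> = ennreal (\<Prod>j<n. u j - l j)"
    using assms by (intro prod_ennreal) auto
  finally show ?thesis .
qed

lemma nn_integral_gauss:
  assumes "a > 0"
  shows "(\<integral>\<^sup>+ x. ennreal (exp (- a * x\<^sup>2)) \<partial>lborel) = ennreal (sqrt (pi / a))"
proof -
  have 1: "(\<integral>\<^sup>+ x. ennreal (exp (- x\<^sup>2)) \<partial>lborel) = ennreal (sqrt pi)"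
  proof -
    have hp: "has_bochner_integral lborel (\<lambda>x::real. exp (- x\<^sup>2)) (sqrt pi)"
      using has_bochner_integral_even_function[OF gaussian_moment_0] by (simp add: power2_eq_square)
    show ?thesis
      using hp by (subst nn_integral_eq_integral) (auto simp: has_bochner_integral_iff)
  qed
  have "(\<integral>\<^sup>+ x. ennreal (exp (- x\<^sup>2)) \<partial>lborel) = ennreal (sqrt a) * (\<integral>\<^sup>+ x. ennreal (exp (- (0 + sqrt a * x)\<^sup>2)) \<partial>lborel)"
    using assms by (subst nn_integral_real_affine[where c="sqrt a" and t=0]) auto
  also have "\<dots> = ennreal (sqrt a) * (\<integral>\<^sup>+ x. ennreal (exp (- a * x\<^sup>2)) \<partial>lborel)"
    using assms by (simp add: power_mult_distrib)
  finally have e: "ennreal (sqrt pi) = ennreal (sqrt a) * (\<integral>\<^sup>+ x. ennreal (exp (- a * x\<^sup>2)) \<partial>lborel)"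
    using 1 by simp
  have "ennreal (sqrt (pi / a)) = ennreal (1 / sqrt a) * ennreal (sqrt pi)"
    by (subst ennreal_mult[symmetric]) (use assms in \<open>auto simp: real_sqrt_divide\<close>)
  also have "\<dots> = (ennreal (1 / sqrt a) * ennreal (sqrt a)) * (\<integral>\<^sup>+ x. ennreal (exp (- a * x\<^sup>2)) \<partial>lborel)"
    unfolding e by (simp add: mult.assoc)
  also have "ennreal (1 / sqrt a) * ennreal (sqrt a) = 1"
    by (subst ennreal_mult[symmetric]) (use assms in auto)
  finally show ?thesis by simp
qed

definition ellq :: "(nat \<Rightarrow> real) \<Rightarrow> (nat \<Rightarrow> nat \<Rightarrow> real) \<Rightarrow> nat \<Rightarrow> (nat \<Rightarrow> real) \<Rightarrow> real" where
  "ellq h T n c = (\<Sum>j<n. h j * (tri T n c j)\<^sup>2)"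

definition ell :: "(nat \<Rightarrow> real) \<Rightarrow> (nat \<Rightarrow> nat \<Rightarrow> real) \<Rightarrow> nat \<Rightarrow> real \<Rightarrow> (nat \<Rightarrow> real) set" where
  "ell h T n s = {c \<in> space (lebn n). ellq h T n c \<le> s}"

lemma sets_ell[measurable]: "ell h T n s \<in> sets (lebn n)"
  unfolding ell_def ellq_def by measurable

text \<open>The two bounds differ by the factor \<open>sqrt (pi * exp 1 / 2) ^ n\<close>, hence by
  \<open>O(n)\<close> in the logarithm. In the inscribed box every coordinate contributes at most
  \<open>s / n\<close> to the form.\<close>

lemma emeasure_ell_bounds:
  assumes n: "n > 0" and s: "s > 0" and h: "\<And>j. j < n \<Longrightarrow> h j > 0"
  shows "ennreal (\<Prod>j<n. 2 * sqrt (s / (n * h j))) \<le> emeasure (lebn n) (ell h T n s)" (is ?lower)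
    and "emeasure (lebn n) (ell h T n s) \<le> ennreal (\<Prod>j<n. sqrt (2 * pi * exp 1 * s / (n * h j)))" (is ?upper)
proof -
  interpret product_sigma_finite "\<lambda>_::nat. lborel :: real measure" by (rule product_sigma_finite_lborel)
  define S where "S = {y \<in> space (lebn n). (\<Sum>j<n. h j * (y j)\<^sup>2) \<le> s}"
  have S[measurable]: "S \<in> sets (lebn n)" unfolding S_def by measurable
  have "{c \<in> space (lebn n). (\<lambda>j\<in>{..<n}. tri T n c j + 0) \<in> S} = ell h T n s"
    by (auto simp: S_def ell_def ellq_def space_PiM)
  with emeasure_tri[OF S, of T "\<lambda>_. 0"] have eq: "emeasure (lebn n) (ell h T n s) = emeasure (lebn n) S"
    by simp
  define r where "r j = sqrt (s / (n * h j))" for j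
  have r0: "0 \<le> r j" if "j < n" for j using h[OF that] s n by (simp add: r_def)
  have "PiE {..<n} (\<lambda>j. {- r j..r j}) \<subseteq> S"
  proof
    fix y assume y: "y \<in> PiE {..<n} (\<lambda>j. {- r j..r j})"
    have "(\<Sum>j<n. h j * (y j)\<^sup>2) \<le> (\<Sum>j<n. s / n)"
    proof (rule sum_mono)
      fix j assume j: "j \<in> {..<n}"
      have "\<bar>y j\<bar> \<le> r j" using y j by (force simp: PiE_def Pi_def abs_le_iff)
      from power_mono[OF this abs_ge_zero, of 2] have "(y j)\<^sup>2 \<le> (r j)\<^sup>2" by simp
      also have "(r j)\<^sup>2 = s / (n * h j)" using h[of j] j s n by (simp add: r_def)
      finally have "h j * (y j)\<^sup>2 \<le> h j * (s / (n * h j))"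
        by (rule mult_left_mono) (use h[of j] j in simp)
      also have "\<dots> = s / n" using h[of j] j by simp
      finally show "h j * (y j)\<^sup>2 \<le> s / n" .
    qed
    also have "\<dots> = s" using n by simp
    finally show "y \<in> S" using y by (auto simp: S_def space_PiM PiE_def extensional_def)
  qed
  then have "emeasure (lebn n) (PiE {..<n} (\<lambda>j. {- r j..r j})) \<le> emeasure (lebn n) S"
    by (intro emeasure_mono) auto
  also have "emeasure (lebn n) (PiE {..<n} (\<lambda>j. {- r j..r j})) = ennreal (\<Prod>j<n. 2 * r j)"
    using r0 by (subst emeasure_box) (auto simp: intro!: arg_cong[where f=ennreal] prod.cong)
  finally show ?lower by (simp add: eq r_def)
  \<comment> \<open>On the ellipsoid the exponents \<open>a j * (y j)\<^sup>2\<close> add up to at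
    most \<open>n / 2\<close>, so a factor \<open>exp (1/2)\<close> per coordinate makes the
    Gaussian product at least \<open>1\<close> there. Among rates proportional to \<open>h j\<close>
    this one minimizes the resulting bound.\<close>
  define a where "a j = n * h j / (2 * s)" for j
  have a0: "a j > 0" if "j < n" for j using h[OF that] s n by (simp add: a_def)
  have "emeasure (lebn n) S = (\<integral>\<^sup>+ y. indicator S y \<partial>lebn n)" by simp
  also have "\<dots> \<le> (\<integral>\<^sup>+ y. (\<Prod>j<n. ennreal (exp (1/2)) * ennreal (exp (- a j * (y j)\<^sup>2))) \<partial>lebn n)"
  proof (rule nn_integral_mono)
    fix y :: "nat \<Rightarrow> real"
    have e: "(\<Prod>j<n. ennreal (exp (1/2)) * ennreal (exp (- a j * (y j)\<^sup>2))) = ennreal (exp (\<Sum>j<n. (1/2 - a j * (y j)\<^sup>2)))"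
      by (simp add: exp_sum prod_ennreal ennreal_mult[symmetric] exp_add[symmetric])
    show "indicator S y \<le> (\<Prod>j<n. ennreal (exp (1/2)) * ennreal (exp (- a j * (y j)\<^sup>2)))"
    proof (cases "y \<in> S")
      case True
      have "(\<Sum>j<n. a j * (y j)\<^sup>2) = (n / (2 * s)) * (\<Sum>j<n. h j * (y j)\<^sup>2)"
        by (simp add: a_def sum_distrib_left algebra_simps)
      also have "\<dots> \<le> (n / (2 * s)) * s"
        using True s by (intro mult_left_mono) (auto simp: S_def)
      also have "\<dots> = n / 2" using s by simp
      finally have "0 \<le> (\<Sum>j<n. (1/2 - a j * (y j)\<^sup>2))" by (simp add: sum_subtractf)
      then show ?thesis unfolding e using True by simp
    qed simp
  qed
  also have "\<dots> = (\<Prod>j<n. \<integral>\<^sup>+ x. ennreal (exp (1/2)) * ennreal (exp (- a j * x\<^sup>2)) \<partial>lborel)"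
    by (rule product_nn_integral_prod) auto
  also have "\<dots> = (\<Prod>j<n. ennreal (sqrt (2 * pi * exp 1 * s / (n * h j))))"
  proof (rule prod.cong)
    fix j assume "j \<in> {..<n}"
    then have j: "j < n" by simp
    have "(\<integral>\<^sup>+ x. ennreal (exp (1/2)) * ennreal (exp (- a j * x\<^sup>2)) \<partial>lborel) = ennreal (exp (1/2)) * ennreal (sqrt (pi / a j))"
      using nn_integral_gauss[OF a0[OF j]] by (simp add: nn_integral_cmult)
    also have "\<dots> = ennreal (sqrt (exp 1) * sqrt (pi / a j))"
    proof -
      have "sqrt (exp 1) = exp (1/2::real)" by (rule real_sqrt_unique) (simp_all add: exp_double[symmetric])
      then show ?thesis using a0[OF j] by (simp add: ennreal_mult)
    qed
    also have "sqrt (exp 1) * sqrt (pi / a j) = sqrt (2 * pi * exp 1 * s / (n * h j))"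
      using h[OF j] s n by (simp add: a_def real_sqrt_mult[symmetric] field_simps)
    finally show "(\<integral>\<^sup>+ x. ennreal (exp (1/2)) * ennreal (exp (- a j * x\<^sup>2)) \<partial>lborel) = ennreal (sqrt (2 * pi * exp 1 * s / (n * h j)))" .
  qed simp
  also have "\<dots> = ennreal (\<Prod>j<n. sqrt (2 * pi * exp 1 * s / (n * h j)))"
    using h s by (intro prod_ennreal) (auto intro!: divide_nonneg_nonneg mult_nonneg_nonneg simp: less_imp_le)
  finally show ?upper by (simp add: eq)
qed

section \<open>Lattice points in ellipsoids\<close>

lemma ellq_triangle:
  assumes "\<And>j. j < n \<Longrightarrow> h j \<ge> 0"
  shows "sqrt (ellq h T n (\<lambda>j. x j + y j)) \<le> sqrt (ellq h T n x) + sqrt (ellq h T n y)"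
proof -
  have e: "sqrt (ellq h T n z) = L2_set (\<lambda>j. sqrt (h j) * tri T n z j) {..<n}" for z
    using assms by (simp add: ellq_def L2_set_def power_mult_distrib)
  show ?thesis
    unfolding e tri_add distrib_left by (rule L2_set_triangle_ineq)
qed

lemma ellq_scale: "ellq h T n (\<lambda>j. a * x j) = a\<^sup>2 * ellq h T n x"
  by (simp add: ellq_def tri_mult power_mult_distrib sum_distrib_left algebra_simps)

lemma ellq_cong: "(\<And>k. k < n \<Longrightarrow> x k = y k) \<Longrightarrow> ellq h T n x = ellq h T n y"
  unfolding ellq_def by (intro sum.cong refl) (simp add: tri_cong[of n x y])

text \<open>At the largest index where \<open>v\<close> and \<open>w\<close> differ, all correction
  terms of \<open>tri\<close> cancel, and the difference is that of two distinct integers.\<close>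

lemma tri_box_unique:
  assumes v: "v \<in> PiE {..<n} (\<lambda>_. \<int>)" and w: "w \<in> PiE {..<n} (\<lambda>_. \<int>)"
    and close: "\<And>j. j < n \<Longrightarrow> \<bar>tri T n v j - tri T n w j\<bar> < 1"
  shows "v = w"
proof (rule ccontr)
  assume "v \<noteq> w"
  then obtain i where "i < n" "v i \<noteq> w i" using PiE_ext[OF v w] by auto
  then have ne: "{i. i < n \<and> v i \<noteq> w i} \<noteq> {}" by auto
  define m where "m = Max {i. i < n \<and> v i \<noteq> w i}"
  have m: "m < n" "v m \<noteq> w m" using Max_in[OF _ ne] by (auto simp: m_def)
  have above: "v k = w k" if "m < k" "k < n" for k
  proof (rule ccontr)
    assume "v k \<noteq> w k"
    then have "k \<le> m" unfolding m_def using that by (intro Max_ge) auto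
    then show False using that by simp
  qed
  have "tri T n v m - tri T n w m = v m - w m"
    using above by (simp add: tri_def)
  moreover obtain a b where "v m = of_int a" "w m = of_int b"
    using v w m(1) by (metis Ints_cases PiE_mem lessThan_iff)
  ultimately have "\<bar>real_of_int (a - b)\<bar> < 1" "a \<noteq> b" using close[OF m(1)] m(2) by auto
  then show False by linarith
qed

text \<open>
  The half-open unit boxes around lattice points are taken in the triangular coordinates, so that
  their diameter is controlled by \<open>\<Sum>j. h j\<close> and not by the size of the standard cube.
\<close>

lemma card_lattice_le_emeasure_ell:
  assumes V: "finite V" "V \<subseteq> PiE {..<n} (\<lambda>_. \<int>)" "\<And>v. v \<in> V \<Longrightarrow> ellq h T n v \<le> s"
    and s: "s \<ge> 0" and h: "\<And>j. j < n \<Longrightarrow> h j \<ge> 0" and K: "(\<Sum>j<n. h j) \<le> K"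
  shows "of_nat (card V) \<le> emeasure (lebn n) (ell h T n ((sqrt s + sqrt K)\<^sup>2))"
proof -
  define U where "U v = {c \<in> space (lebn n). (\<lambda>j\<in>{..<n}. tri T n c j + - tri T n v j) \<in> PiE {..<n} (\<lambda>_. {0..<1})}" for v
  have cube: "PiE {..<n} (\<lambda>_. {0..<1::real}) \<in> sets (lebn n)" by (rule sets_PiE_lebn) simp
  have U_sets: "U v \<in> sets (lebn n)" for v
    using measurable_sets[OF measurable_tri cube, of T "\<lambda>j. - tri T n v j"] by (simp add: U_def vimage_def Int_def conj_commute)
  have U_meas: "emeasure (lebn n) (U v) = 1" for v
  proof -
    interpret product_sigma_finite "\<lambda>_::nat. lborel :: real measure" by (rule product_sigma_finite_lborel)
    have "emeasure (lebn n) (PiE {..<n} (\<lambda>_. {0..<1::real})) = 1"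
      by (subst emeasure_PiM) auto
    then show ?thesis using emeasure_tri[OF cube, of T "\<lambda>j. - tri T n v j"] by (simp add: U_def)
  qed
  have U_D: "0 \<le> tri T n c j - tri T n v j \<and> tri T n c j - tri T n v j < 1" if "c \<in> U v" "j < n" for c v j
    using that by (force simp: U_def PiE_def Pi_def)
  have disj: "disjoint_family_on U V"
  proof (unfold disjoint_family_on_def, intro ballI impI)
    fix v w assume vw: "v \<in> V" "w \<in> V" "v \<noteq> w"
    { fix c assume c: "c \<in> U v" "c \<in> U w"
      have "v = w"
      proof (rule tri_box_unique)
        show "\<bar>tri T n v j - tri T n w j\<bar> < 1" if "j < n" for j
          using U_D[OF c(1) that] U_D[OF c(2) that] by linarith
      qed (use V vw in auto) }
    then show "U v \<inter> U w = {}" using vw by blast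
  qed
  have sub: "U v \<subseteq> ell h T n ((sqrt s + sqrt K)\<^sup>2)" if v: "v \<in> V" for v
  proof
    fix c assume c: "c \<in> U v"
    have "ellq h T n (\<lambda>j. c j - v j) \<le> (\<Sum>j<n. h j * 1)"
      unfolding ellq_def
    proof (intro sum_mono mult_left_mono)
      fix j assume "j \<in> {..<n}"
      then show "(tri T n (\<lambda>j. c j - v j) j)\<^sup>2 \<le> 1" "0 \<le> h j"
        using U_D[OF c, of j] h by (auto simp: tri_diff intro!: power_le_one)
    qed
    then have 1: "sqrt (ellq h T n (\<lambda>j. c j - v j)) \<le> sqrt K" using K by simp
    have "sqrt (ellq h T n (\<lambda>j. v j + (c j - v j))) \<le> sqrt (ellq h T n v) + sqrt (ellq h T n (\<lambda>j. c j - v j))"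
      by (rule ellq_triangle[OF h])
    also have "\<dots> \<le> sqrt s + sqrt K" using 1 V(3)[OF v] by (simp add: add_mono)
    finally have "sqrt (ellq h T n c) \<le> sqrt s + sqrt K" by simp
    then have "ellq h T n c \<le> (sqrt s + sqrt K)\<^sup>2" by (rule sqrt_le_D)
    then show "c \<in> ell h T n ((sqrt s + sqrt K)\<^sup>2)" using c by (auto simp: ell_def U_def)
  qed
  have "(of_nat (card V) :: ennreal) = (\<Sum>v\<in>V. emeasure (lebn n) (U v))" using U_meas by simp
  also have "\<dots> = emeasure (lebn n) (\<Union>v\<in>V. U v)"
    using U_sets disj V(1) by (intro sum_emeasure) auto
  also have "\<dots> \<le> emeasure (lebn n) (ell h T n ((sqrt s + sqrt K)\<^sup>2))"
    using sub by (intro emeasure_mono) auto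
  finally show ?thesis .
qed

text \<open>The number of lattice vectors \<open>v\<close> with \<open>x + v \<in> S\<close>,
  integrated over \<open>x\<close> in the unit cube, gives the measure of \<open>S\<close>. If it
  were at most \<open>m\<close> for every \<open>x\<close>, so would be the measure.\<close>

lemma Blichfeldt:
  assumes S: "S \<in> sets (lebn n)" and m: "of_nat m < emeasure (lebn n) S"
  obtains x V where "finite V" "card V = Suc m" "V \<subseteq> PiE {..<n} (\<lambda>_. \<int>)"
    "\<And>v. v \<in> V \<Longrightarrow> (\<lambda>j\<in>{..<n}. x j + v j) \<in> S"
proof -
  define Z where "Z = PiE {..<n} (\<lambda>_. \<int> :: real set)"
  define cube where "cube = PiE {..<n} (\<lambda>_. {0..<1::real})"
  have cube: "cube \<in> sets (lebn n)" unfolding cube_def by (rule sets_PiE_lebn) simp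
  have cube1: "emeasure (lebn n) cube = 1"
  proof -
    interpret product_sigma_finite "\<lambda>_::nat. lborel :: real measure" by (rule product_sigma_finite_lborel)
    show ?thesis unfolding cube_def by (subst emeasure_PiM) auto
  qed
  have cZ: "countable Z" unfolding Z_def by (rule countable_PiE) (auto simp: Ints_def)
  define sh where "sh v x = (\<lambda>j\<in>{..<n}. x j + v j)" for v x :: "nat \<Rightarrow> real"
  have sh_meas: "sh v \<in> measurable (lebn n) (lebn n)" for v
    unfolding sh_def by (rule measurable_restrict) simp
  have ind[measurable]: "(\<lambda>x. indicator S (sh v x) :: ennreal) \<in> borel_measurable (lebn n)" for v
    by (rule measurable_compose[OF sh_meas borel_measurable_indicator[OF S]])
  have indc[measurable]: "(\<lambda>x. indicator cube (sh v x) :: ennreal) \<in> borel_measurable (lebn n)" for v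
    by (rule measurable_compose[OF sh_meas borel_measurable_indicator[OF cube]])
  have [measurable]: "(\<lambda>x. indicator S x :: ennreal) \<in> borel_measurable (lebn n)"
    "(\<lambda>x. indicator cube x :: ennreal) \<in> borel_measurable (lebn n)" using S cube by auto
  define mult where "mult x = (\<integral>\<^sup>+ v. indicator S (sh v x) \<partial>count_space Z)" for x :: "nat \<Rightarrow> real"
  \<comment> \<open>The lattice translates of the half-open cube partition the space: the only one
    containing \<open>x\<close> belongs to the vector of floors. Inserting this sum of indicators
    under the integral over \<open>S\<close> starts the computation.\<close>
  have one: "(\<integral>\<^sup>+ v. indicator cube (sh (\<lambda>j. - v j) x) \<partial>count_space Z) = 1" if x: "x \<in> space (lebn n)" for x
  proof -
    define v0 where "v0 = (\<lambda>j\<in>{..<n}. real_of_int \<lfloor>x j\<rfloor>)"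
    have v0: "v0 \<in> Z" by (auto simp: v0_def Z_def)
    have "indicator cube (sh (\<lambda>j. - v j) x) = (indicator {v0} v :: ennreal)" if v: "v \<in> Z" for v
    proof (cases "v = v0")
      case True
      then show ?thesis
        by (auto simp: indicator_def sh_def cube_def v0_def PiE_def Pi_def) (linarith)+
    next
      case False
      have "sh (\<lambda>j. - v j) x \<notin> cube"
      proof
        assume c: "sh (\<lambda>j. - v j) x \<in> cube"
        have "v = v0"
        proof (rule PiE_ext[OF v[unfolded Z_def] v0[unfolded Z_def]])
          fix j assume j: "j \<in> {..<n}"
          then have "0 \<le> x j - v j" "x j - v j < 1" using c by (force simp: sh_def cube_def PiE_def Pi_def)+
          moreover obtain a where "v j = of_int a" using v j by (metis Ints_cases PiE_mem Z_def)
          ultimately have "\<lfloor>x j\<rfloor> = a" by (intro floor_unique) auto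
          then show "v j = v0 j" using j \<open>v j = of_int a\<close> by (simp add: v0_def)
        qed
        then show False using False by simp
      qed
      then show ?thesis using False by simp
    qed
    then have "(\<integral>\<^sup>+ v. indicator cube (sh (\<lambda>j. - v j) x) \<partial>count_space Z) = (\<integral>\<^sup>+ v. indicator {v0} v \<partial>count_space Z)"
      by (intro nn_integral_cong) simp
    also have "\<dots> = 1" using v0 by (subst nn_integral_indicator) auto
    finally show ?thesis .
  qed
  \<comment> \<open>Translation invariance, as the case \<open>T = 0\<close> of the triangular
    substitution, moves each piece of \<open>S\<close> back into the unit cube.\<close>
  have shift: "(\<integral>\<^sup>+ x. indicator S x * indicator cube (sh (\<lambda>j. - v j) x) \<partial>lebn n)
      = (\<integral>\<^sup>+ x. indicator S (sh v x) * indicator cube x \<partial>lebn n)" for v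
  proof -
    define f where "f = (\<lambda>x. indicator S x * indicator cube (sh (\<lambda>j. - v j) x) :: ennreal)"
    have f: "f \<in> borel_measurable (lebn n)" unfolding f_def by measurable
    have "(\<integral>\<^sup>+ x. f x \<partial>lebn n) = (\<integral>\<^sup>+ x. f (sh v x) \<partial>lebn n)"
      using nn_integral_tri[OF f, of "\<lambda>_ _. 0" v] by (simp add: tri_def sh_def)
    also have "\<dots> = (\<integral>\<^sup>+ x. indicator S (sh v x) * indicator cube x \<partial>lebn n)"
    proof (rule nn_integral_cong)
      fix x assume x: "x \<in> space (lebn n)"
      have "sh (\<lambda>j. - v j) (sh v x) = x"
        using x by (auto simp: sh_def space_PiM PiE_def extensional_def)
      then show "f (sh v x) = indicator S (sh v x) * indicator cube x" by (simp add: f_def)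
    qed
    finally show ?thesis by (simp add: f_def)
  qed
  have "emeasure (lebn n) S = (\<integral>\<^sup>+ x. indicator S x \<partial>lebn n)" using S by simp
  also have "\<dots> = (\<integral>\<^sup>+ x. (\<integral>\<^sup>+ v. indicator S x * indicator cube (sh (\<lambda>j. - v j) x) \<partial>count_space Z) \<partial>lebn n)"
    using one by (intro nn_integral_cong) (simp add: nn_integral_cmult)
  also have "\<dots> = (\<integral>\<^sup>+ v. (\<integral>\<^sup>+ x. indicator S x * indicator cube (sh (\<lambda>j. - v j) x) \<partial>lebn n) \<partial>count_space Z)"
    by (rule nn_integral_count_space_nn_integral[OF cZ]) (intro borel_measurable_times_ennreal ind indc borel_measurable_indicator S cube)
  also have "\<dots> = (\<integral>\<^sup>+ v. (\<integral>\<^sup>+ x. indicator S (sh v x) * indicator cube x \<partial>lebn n) \<partial>count_space Z)"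
    by (simp only: shift)
  also have "\<dots> = (\<integral>\<^sup>+ x. (\<integral>\<^sup>+ v. indicator S (sh v x) * indicator cube x \<partial>count_space Z) \<partial>lebn n)"
    by (rule nn_integral_count_space_nn_integral[OF cZ, symmetric]) (intro borel_measurable_times_ennreal ind indc borel_measurable_indicator S cube)
  also have "\<dots> = (\<integral>\<^sup>+ x. mult x * indicator cube x \<partial>lebn n)"
    unfolding mult_def by (intro nn_integral_cong) (simp add: nn_integral_multc)
  finally have total: "emeasure (lebn n) S = (\<integral>\<^sup>+ x. mult x * indicator cube x \<partial>lebn n)" .
  have "\<exists>x. of_nat m < mult x"
  proof (rule ccontr)
    assume "\<nexists>x. of_nat m < mult x"
    then have "mult x \<le> of_nat m" for x by (auto simp: not_less)
    then have "emeasure (lebn n) S \<le> (\<integral>\<^sup>+ x. of_nat m * indicator cube x \<partial>lebn n)"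
      unfolding total by (intro nn_integral_mono mult_right_mono) auto
    also have "\<dots> = of_nat m" using cube cube1 by (simp add: nn_integral_cmult)
    finally show False using m by simp
  qed
  then obtain x where x: "of_nat m < mult x" by blast
  define W where "W = {v \<in> Z. sh v x \<in> S}"
  have multW: "mult x = emeasure (count_space Z) W"
  proof -
    have "mult x = (\<integral>\<^sup>+ v. indicator W v \<partial>count_space Z)"
      unfolding mult_def by (intro nn_integral_cong) (auto simp: W_def indicator_def)
    also have "\<dots> = emeasure (count_space Z) W" by (rule nn_integral_indicator) (auto simp: W_def)
    finally show ?thesis .
  qed
  have "\<exists>V. V \<subseteq> W \<and> finite V \<and> card V = Suc m"
  proof (cases "finite W")
    case True
    then have "mult x = of_nat (card W)" unfolding multW by (subst emeasure_count_space) (auto simp: W_def)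
    then have "Suc m \<le> card W" using x by simp
    then show ?thesis using obtain_subset_with_card_n True by (metis finite_subset)
  next
    case False
    from infinite_arbitrarily_large[OF this, of "Suc m"] show ?thesis by auto
  qed
  then obtain V where "V \<subseteq> W" "finite V" "card V = Suc m" by blast
  then show ?thesis by (intro that[of V x]) (auto simp: W_def Z_def sh_def)
qed

text \<open>Were the volume larger, Blichfeldt would give one more vector than the count, all with
  \<open>x + v\<close> in the ellipsoid of level \<open>s / 4\<close>. Subtracting one of them keeps
  them distinct and integral, and the triangle inequality for \<open>sqrt (ellq ...)\<close> puts
  the differences at level \<open>s\<close>, which accounts for the \<open>4\<close>.\<close>

lemma emeasure_ell_le_card_lattice:
  assumes fin: "finite {v \<in> PiE {..<n} (\<lambda>_. \<int>). ellq h T n v \<le> s}"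
    and h: "\<And>j. j < n \<Longrightarrow> h j \<ge> 0" and s: "s \<ge> 0"
  shows "emeasure (lebn n) (ell h T n (s / 4)) \<le> of_nat (card {v \<in> PiE {..<n} (\<lambda>_. \<int>). ellq h T n v \<le> s})"
proof (rule ccontr)
  let ?L = "{v \<in> PiE {..<n} (\<lambda>_. \<int>). ellq h T n v \<le> s}"
  assume "\<not> ?thesis"
  then have less: "of_nat (card ?L) < emeasure (lebn n) (ell h T n (s / 4))" by (simp add: not_le)
  obtain x V where V: "finite V" "card V = Suc (card ?L)" "V \<subseteq> PiE {..<n} (\<lambda>_. \<int>)"
    "\<And>v. v \<in> V \<Longrightarrow> (\<lambda>j\<in>{..<n}. x j + v j) \<in> ell h T n (s / 4)"
    by (rule Blichfeldt[OF sets_ell less]) blast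
  have "V \<noteq> {}" using V(2) by auto
  then obtain v0 where v0: "v0 \<in> V" by blast
  define f where "f v = (\<lambda>j\<in>{..<n}. v j - v0 j)" for v
  have inj: "inj_on f V"
  proof (rule inj_onI)
    fix v w assume vw: "v \<in> V" "w \<in> V" "f v = f w"
    show "v = w"
    proof (rule PiE_ext[of v "{..<n}" "\<lambda>_. \<int>" w])
      fix j assume "j \<in> {..<n}"
      then show "v j = w j" using fun_cong[OF vw(3), of j] by (simp add: f_def)
    qed (use V vw in auto)
  qed
  have "f ` V \<subseteq> ?L"
  proof
    fix u assume "u \<in> f ` V"
    then obtain v where v: "v \<in> V" "u = f v" by auto
    have half: "sqrt (ellq h T n (\<lambda>j. x j + w j)) \<le> sqrt s / 2" if "w \<in> V" for w
    proof -
      have "ellq h T n (\<lambda>j\<in>{..<n}. x j + w j) = ellq h T n (\<lambda>j. x j + w j)" by (rule ellq_cong) simp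
      then have "ellq h T n (\<lambda>j. x j + w j) \<le> s / 4" using V(4)[OF that] by (simp add: ell_def)
      then have "sqrt (ellq h T n (\<lambda>j. x j + w j)) \<le> sqrt (s / 4)" by simp
      then show ?thesis by (simp add: real_sqrt_divide)
    qed
    have neg: "ellq h T n (\<lambda>j. - z j) = ellq h T n z" for z
      using ellq_scale[of h T n "-1" z] by simp
    have "ellq h T n u = ellq h T n (\<lambda>j. (x j + v j) + - (x j + v0 j))"
      unfolding v(2) f_def by (rule ellq_cong) simp
    then have "sqrt (ellq h T n u) \<le> sqrt (ellq h T n (\<lambda>j. x j + v j)) + sqrt (ellq h T n (\<lambda>j. x j + v0 j))"
      using ellq_triangle[where h=h and n=n, OF h, of T "\<lambda>j. x j + v j" "\<lambda>j. - (x j + v0 j)"]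
      unfolding neg by simp
    also have "\<dots> \<le> sqrt s" using half[OF v(1)] half[OF v0] by simp
    finally have "ellq h T n u \<le> s" by simp
    moreover have "u \<in> PiE {..<n} (\<lambda>_. \<int>)"
      using v v0 V(3) by (auto simp: f_def intro!: Ints_diff)
    ultimately show "u \<in> ?L" by simp
  qed
  then have "card V \<le> card ?L" using card_inj_on_le[OF inj _ fin] by simp
  then show False using V(2) by simp
qed

section \<open>Laurent coefficients on two concentric circles\<close>

definition ee :: "int \<Rightarrow> real \<Rightarrow> complex" where
  "ee n t = exp (2 * of_real pi * \<i> * of_int n * of_real t)"

lemma continuous_on_ee[continuous_intros]: "continuous_on S (ee n)"
  unfolding ee_def by (intro continuous_intros)

lemma ee_add: "ee (n + m) t = ee n t * ee m t"
  by (simp add: ee_def exp_add[symmetric] algebra_simps)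

lemma ee_0[simp]: "ee 0 t = 1" by (simp add: ee_def)

lemma ee_minus: "ee (- n) t = cnj (ee n t)"
  by (simp add: ee_def exp_cnj)

lemma norm_ee[simp]: "norm (ee n t) = 1"
  by (simp add: ee_def norm_exp_eq_Re)

lemma integral_ee: "integral {0..1} (ee n) = (if n = 0 then 1 else 0)"
proof (cases "n = 0")
  case False
  define w where "w = 2 * of_real pi * \<i> * complex_of_int n"
  have w: "w \<noteq> 0" using False by (simp add: w_def)
  have "(ee n has_integral (exp (w * of_real 1) / w - exp (w * of_real 0) / w)) {0..1}"
  proof (rule fundamental_theorem_of_calculus)
    fix t :: real assume "t \<in> {0..1}"
    have "((\<lambda>t. exp (w * of_real t) / w) has_vector_derivative ee n t) (at t within {0..1})"
      unfolding ee_def w_def[symmetric]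
      by (rule derivative_eq_intros has_vector_derivative_real_field | use w in \<open>simp add: has_vector_derivative_def algebra_simps\<close>)+
    then show "((\<lambda>t. exp (w * of_real t) / w) has_vector_derivative ee n t) (at t within {0..1})" .
  qed simp
  moreover have "exp w = 1"
    unfolding w_def using exp_integer_2pi[of "of_int n"] by (simp add: algebra_simps)
  ultimately show ?thesis using False by (simp add: integral_unique)
qed (simp add: ee_def[abs_def])

text \<open>The mean square of \<open>g\<close> minus the Fourier sum \<open>h\<close> over
  \<open>S\<close> is nonnegative, and the three integrals involving \<open>h\<close> all equal the
  sum of squared coefficients.\<close>

lemma Bessel_ee:
  assumes g: "continuous_on {0..1} g" and M: "\<And>t. t \<in> {0..1} \<Longrightarrow> norm (g t) \<le> M"
    and S: "finite S"
  shows "(\<Sum>n\<in>S. (norm (integral {0..1} (\<lambda>t. g t * ee (- n) t)))\<^sup>2) \<le> M\<^sup>2"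
proof -
  define a where "a n = integral {0..1} (\<lambda>t. g t * ee (- n) t)" for n
  define h where "h t = (\<Sum>n\<in>S. a n * ee n t)" for t
  have h: "continuous_on {0..1} h" unfolding h_def by (intro continuous_intros)
  have int: "f integrable_on {0..1}" if "continuous_on {0..1} f" for f :: "real \<Rightarrow> complex"
    using that integrable_continuous_real by blast
  have 1: "integral {0..1} (\<lambda>t. g t * cnj (h t)) = (\<Sum>n\<in>S. of_real ((norm (a n))\<^sup>2))"
  proof -
    have "integral {0..1} (\<lambda>t. g t * cnj (h t)) = integral {0..1} (\<lambda>t. \<Sum>n\<in>S. cnj (a n) * (g t * ee (- n) t))"
      by (intro integral_cong) (simp add: h_def sum_distrib_left ee_minus algebra_simps)
    also have "\<dots> = (\<Sum>n\<in>S. integral {0..1} (\<lambda>t. cnj (a n) * (g t * ee (- n) t)))"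
      by (intro integral_sum S int continuous_intros g)
    also have "\<dots> = (\<Sum>n\<in>S. cnj (a n) * a n)"
      by (simp add: a_def)
    finally show ?thesis by (simp add: complex_norm_square[symmetric] mult.commute)
  qed
  have "integral {0..1} (\<lambda>t. h t * cnj (g t)) = cnj (integral {0..1} (\<lambda>t. g t * cnj (h t)))"
    by (subst integral_cnj) (simp add: mult.commute)
  then have 2: "integral {0..1} (\<lambda>t. h t * cnj (g t)) = (\<Sum>n\<in>S. of_real ((norm (a n))\<^sup>2))"
    unfolding 1 by simp
  have 3: "integral {0..1} (\<lambda>t. h t * cnj (h t)) = (\<Sum>n\<in>S. of_real ((norm (a n))\<^sup>2))"
  proof -
    have "integral {0..1} (\<lambda>t. h t * cnj (h t)) = integral {0..1} (\<lambda>t. \<Sum>n\<in>S. \<Sum>m\<in>S. (a n * cnj (a m)) * ee (n - m) t)"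
      by (intro integral_cong) (simp add: h_def sum_product ee_add[of _ "- _", simplified] ee_minus algebra_simps)
    also have "\<dots> = (\<Sum>n\<in>S. integral {0..1} (\<lambda>t. \<Sum>m\<in>S. (a n * cnj (a m)) * ee (n - m) t))"
      by (intro integral_sum S int continuous_intros)
    also have "\<dots> = (\<Sum>n\<in>S. \<Sum>m\<in>S. integral {0..1} (\<lambda>t. (a n * cnj (a m)) * ee (n - m) t))"
      by (intro sum.cong refl integral_sum S int continuous_intros)
    also have "\<dots> = (\<Sum>n\<in>S. \<Sum>m\<in>S. if n = m then a n * cnj (a m) else 0)"
      by (intro sum.cong refl) (simp add: integral_ee)
    also have "\<dots> = (\<Sum>n\<in>S. a n * cnj (a n))" using S by simp
    finally show ?thesis by (simp add: complex_norm_square[symmetric])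
  qed
  have sq: "of_real ((norm z)\<^sup>2) = z * cnj z" for z by (rule complex_norm_square)
  have "integral {0..1} (\<lambda>t. (g t - h t) * cnj (g t - h t))
     = integral {0..1} (\<lambda>t. (g t * cnj (g t) - g t * cnj (h t)) - (h t * cnj (g t) - h t * cnj (h t)))"
    by (intro integral_cong) (simp add: algebra_simps)
  also have "\<dots> = (integral {0..1} (\<lambda>t. g t * cnj (g t)) - integral {0..1} (\<lambda>t. g t * cnj (h t)))
      - (integral {0..1} (\<lambda>t. h t * cnj (g t)) - integral {0..1} (\<lambda>t. h t * cnj (h t)))"
    by (subst integral_diff; (subst integral_diff)?; (subst integral_diff)?)
       (auto intro!: int continuous_intros g h integrable_diff)
  also have "\<dots> = integral {0..1} (\<lambda>t. g t * cnj (g t)) - (\<Sum>n\<in>S. of_real ((norm (a n))\<^sup>2))"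
    unfolding 1 2 3 by simp
  finally have e: "integral {0..1} (\<lambda>t. complex_of_real ((norm (g t - h t))\<^sup>2))
     = integral {0..1} (\<lambda>t. complex_of_real ((norm (g t))\<^sup>2)) - (\<Sum>n\<in>S. of_real ((norm (a n))\<^sup>2))"
    unfolding sq .
  have ir: "integral {0..1} (\<lambda>t. complex_of_real (f t)) = of_real (integral {0..1} f)" if "continuous_on {0..1} f" for f :: "real \<Rightarrow> real"
    using integral_linear[OF integrable_continuous_real[OF that] bounded_linear_of_real] by (simp add: o_def)
  from e have "complex_of_real (integral {0..1} (\<lambda>t. (norm (g t - h t))\<^sup>2))
     = of_real (integral {0..1} (\<lambda>t. (norm (g t))\<^sup>2) - (\<Sum>n\<in>S. (norm (a n))\<^sup>2))"
    by (subst (asm) ir, (intro continuous_intros g h)[], subst (asm) ir, (intro continuous_intros g h)[]) simp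
  then have e2: "integral {0..1} (\<lambda>t. (norm (g t - h t))\<^sup>2) = integral {0..1} (\<lambda>t. (norm (g t))\<^sup>2) - (\<Sum>n\<in>S. (norm (a n))\<^sup>2)"
    by (simp only: of_real_eq_iff)
  have "0 \<le> integral {0..1} (\<lambda>t. (norm (g t - h t))\<^sup>2)" by (intro integral_nonneg integrable_continuous_real continuous_intros g h) auto
  moreover have "integral {0..1} (\<lambda>t. (norm (g t))\<^sup>2) \<le> integral {0..1} (\<lambda>t::real. M\<^sup>2)"
    by (intro integral_le integrable_continuous_real continuous_intros g power_mono M) auto
  ultimately show ?thesis using e2 by (simp add: a_def)
qed

text \<open>The \<open>n\<close>-th Laurent coefficient read off on the circle of radius
  \<open>r\<close>. The integral over \<open>{0..1}\<close> suits Bessel's inequality;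
  \<open>fc_contour\<close> links it to Cauchy's theorem.\<close>

definition fc :: "(complex \<Rightarrow> complex) \<Rightarrow> real \<Rightarrow> int \<Rightarrow> complex" where
  "fc f r n = integral {0..1} (\<lambda>t. f (circlepath 0 r t) * circlepath 0 r t powi (- n))"

lemma circlepath_ee: "circlepath 0 r t = of_real r * ee 1 t"
  by (simp add: circlepath ee_def)

lemma ee_powi: "ee 1 t powi n = ee n t"
proof -
  have "ee 1 t \<noteq> 0" by (simp add: ee_def)
  have p: "ee 1 t ^ k = ee (int k) t" for k
    by (simp add: ee_def exp_of_nat_mult[symmetric] algebra_simps)
  show ?thesis
  proof (cases "n \<ge> 0")
    case True then show ?thesis by (simp add: power_int_def p)
  next
    case False
    then have "ee 1 t powi n = inverse (ee (- n) t)" by (simp add: power_int_def p power_inverse)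
    also have "\<dots> = ee n t"
      using ee_add[of n "- n" t] by (metis add.right_inverse ee_0 inverse_unique mult.commute)
    finally show ?thesis .
  qed
qed

lemma circlepath_powi: "r > 0 \<Longrightarrow> circlepath 0 r t powi n = of_real (r powi n) * ee n t"
  by (simp add: circlepath_ee power_int_mult_distrib ee_powi)

lemma circlepath_in_sphere: "r > 0 \<Longrightarrow> circlepath 0 r t \<in> sphere 0 r"
  by (simp add: circlepath_ee norm_mult)

lemma continuous_on_circlepath_comp:
  "continuous_on (sphere 0 r) f \<Longrightarrow> r > 0 \<Longrightarrow> continuous_on {0..1} (\<lambda>t. f (circlepath 0 r t))"
  by (rule continuous_on_compose2[of "sphere 0 r" f])
     (auto simp: circlepath_in_sphere circlepath_ee norm_mult intro!: continuous_intros)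

lemma continuous_on_circlepath_powi:
  "r > 0 \<Longrightarrow> continuous_on {0..1} (\<lambda>t. circlepath 0 r t powi n)"
  by (simp add: circlepath_powi) (intro continuous_intros)

lemma fc_cong: "(\<And>z. z \<in> sphere 0 r \<Longrightarrow> f z = g z) \<Longrightarrow> r > 0 \<Longrightarrow> fc f r n = fc g r n"
  unfolding fc_def by (intro integral_cong) (simp add: circlepath_ee norm_mult)

lemma fc_shift: "r > 0 \<Longrightarrow> fc (\<lambda>z. z powi m * f z) r n = fc f r (n - m)"
  unfolding fc_def
proof (intro integral_cong)
  fix t assume r: "r > 0"
  have "circlepath 0 r t \<noteq> 0" using circlepath_in_sphere[OF r, of t] r by auto
  then show "circlepath 0 r t powi m * f (circlepath 0 r t) * circlepath 0 r t powi - n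
    = f (circlepath 0 r t) * circlepath 0 r t powi - (n - m)"
    by (simp add: power_int_add power_int_diff power_int_minus field_simps)
qed

lemma fc_integrable:
  assumes "continuous_on (sphere 0 r) f" "r > 0"
  shows "(\<lambda>t. f (circlepath 0 r t) * circlepath 0 r t powi n) integrable_on {0..1}"
  by (intro integrable_continuous_real continuous_intros continuous_on_circlepath_comp continuous_on_circlepath_powi assms)

lemma fc_diff:
  assumes "continuous_on (sphere 0 r) f" "continuous_on (sphere 0 r) g" "r > 0"
  shows "fc (\<lambda>z. f z - g z) r n = fc f r n - fc g r n"
  unfolding fc_def left_diff_distrib by (intro integral_diff fc_integrable assms)

lemma fc_cmult: "fc (\<lambda>z. c * f z) r n = c * fc f r n"
  unfolding fc_def by (simp add: mult.assoc)

lemma fc_sum: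
  assumes "\<And>i. i \<in> I \<Longrightarrow> continuous_on (sphere 0 r) (f i)" "r > 0" "finite I"
  shows "fc (\<lambda>z. \<Sum>i\<in>I. f i z) r n = (\<Sum>i\<in>I. fc (f i) r n)"
  unfolding fc_def sum_distrib_right by (intro integral_sum fc_integrable assms)

lemma Bessel_fc:
  assumes f: "continuous_on (sphere 0 r) f" and r: "r > 0"
    and M: "\<And>z. z \<in> sphere 0 r \<Longrightarrow> norm (f z) \<le> M" and S: "finite S"
  shows "(\<Sum>n\<in>S. (norm (fc f r n) * r powi n)\<^sup>2) \<le> M\<^sup>2"
proof -
  have "norm (fc f r n) * r powi n = norm (integral {0..1} (\<lambda>t. f (circlepath 0 r t) * ee (- n) t))" for n
  proof -
    have "fc f r n = integral {0..1} (\<lambda>t. of_real (r powi - n) * (f (circlepath 0 r t) * ee (- n) t))"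
      unfolding fc_def by (intro integral_cong) (simp only: circlepath_powi[OF r] mult.left_commute)
    also have "\<dots> = of_real (r powi - n) * integral {0..1} (\<lambda>t. f (circlepath 0 r t) * ee (- n) t)"
      by (rule integral_mult_right)
    finally show ?thesis using r by (simp add: norm_mult power_int_minus norm_power_int norm_inverse)
  qed
  then show ?thesis
    using Bessel_ee[OF continuous_on_circlepath_comp[OF f r] _ S] M circlepath_in_sphere[OF r] by simp
qed

lemma norm_fc_le:
  assumes f: "continuous_on (sphere 0 r) f" and r: "r > 0"
    and M: "\<And>z. z \<in> sphere 0 r \<Longrightarrow> norm (f z) \<le> M" and M0: "0 \<le> M"
  shows "norm (fc f r 0) \<le> M"
  using Bessel_fc[OF f r M, of "{0}"] M0 by (simp add: power2_le_iff_abs_le)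

lemma fc_contour:
  assumes "r > 0"
  shows "contour_integral (circlepath 0 r) (\<lambda>z. f z * z powi (- n - 1)) = 2 * of_real pi * \<i> * fc f r n"
proof -
  have "contour_integral (circlepath 0 r) (\<lambda>z. f z * z powi (- n - 1))
     = integral {0..1} (\<lambda>t. 2 * of_real pi * \<i> * (f (circlepath 0 r t) * circlepath 0 r t powi (- n)))"
    unfolding contour_integral_integral
  proof (intro integral_cong)
    fix t assume t: "t \<in> {0..1::real}"
    have nz: "circlepath 0 r t \<noteq> 0" using circlepath_in_sphere[OF assms, of t] assms by auto
    have "vector_derivative (circlepath 0 r) (at t) = 2 * of_real pi * \<i> * circlepath 0 r t"
      unfolding vector_derivative_circlepath by (simp add: circlepath)
    then show "f (circlepath 0 r t) * circlepath 0 r t powi (- n - 1) * vector_derivative (circlepath 0 r) (at t)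
       = 2 * of_real pi * \<i> * (f (circlepath 0 r t) * circlepath 0 r t powi (- n))"
      using nz by (simp add: power_int_diff)
  qed
  then show ?thesis by (simp add: fc_def)
qed

section \<open>Laurent coefficients across a pole at \<open>1\<close>\<close>

definition annulus :: "real \<Rightarrow> real \<Rightarrow> complex set" where
  "annulus l u = {z. l < norm z \<and> norm z < u}"

lemma open_annulus: "open (annulus l u)"
proof -
  have "annulus l u = {z. l < norm z} \<inter> {z. norm z < u}" by (auto simp: annulus_def)
  then show ?thesis by (auto intro!: open_Int open_Collect_less continuous_intros)
qed

lemma sphere_subset_annulus: "l < r \<Longrightarrow> r < u \<Longrightarrow> sphere 0 r \<subseteq> annulus l u"
  by (auto simp: annulus_def)

lemma fc_annulus:
  assumes f: "f holomorphic_on annulus l u" and "0 \<le> l" "l < r" "r \<le> s" "s < u"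
  shows "fc f r n = fc f s n"
proof -
  have r: "r > 0" "s > 0" using assms by auto
  have "contour_integral (circlepath 0 r) (\<lambda>z. f z * z powi (- n - 1)) = contour_integral (circlepath 0 s) (\<lambda>z. f z * z powi (- n - 1))"
  proof (rule Cauchy_theorem_homotopic_loops[OF _ open_annulus])
    show "homotopic_loops (annulus l u) (circlepath 0 r) (circlepath 0 s)"
    proof (rule homotopic_loops_linear)
      fix t :: real
      show "closed_segment (circlepath 0 r t) (circlepath 0 s t) \<subseteq> annulus l u"
      proof
        fix z assume "z \<in> closed_segment (circlepath 0 r t) (circlepath 0 s t)"
        then obtain v where v: "0 \<le> v" "v \<le> 1" "z = (1 - v) *\<^sub>R circlepath 0 r t + v *\<^sub>R circlepath 0 s t"
          by (auto simp: in_segment)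
        have z: "z = of_real ((1 - v) * r + v * s) * ee 1 t"
          unfolding v(3) by (simp add: circlepath_ee scaleR_conv_of_real algebra_simps)
        have "(1 - v) * r + v * s = r + v * (s - r)" by (simp add: algebra_simps)
        moreover have "0 \<le> v * (s - r)" "v * (s - r) \<le> 1 * (s - r)"
          using v assms mult_right_mono[of v 1 "s - r"] by auto
        ultimately have *: "r \<le> (1 - v) * r + v * s" "(1 - v) * r + v * s \<le> s" by auto
        then have "norm z = (1 - v) * r + v * s" unfolding z norm_mult norm_of_real norm_ee using r by simp
        then show "z \<in> annulus l u" using * assms by (simp add: annulus_def)
      qed
    qed auto
    show "(\<lambda>z. f z * z powi (- n - 1)) holomorphic_on annulus l u"
      using assms(2) by (intro holomorphic_intros f) (auto simp: annulus_def)
  qed auto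
  then show ?thesis using fc_contour[OF r(1)] fc_contour[OF r(2)] by simp
qed

lemma continuous_on_sphere_annulus:
  "f holomorphic_on annulus l u \<Longrightarrow> l < r \<Longrightarrow> r < u \<Longrightarrow> continuous_on (sphere 0 r) f"
  using holomorphic_on_imp_continuous_on continuous_on_subset sphere_subset_annulus by metis

text \<open>
  The jump of the Laurent coefficients across the unit circle: it vanishes for functions
  holomorphic in the annulus and picks up the singular part at \<open>1\<close> otherwise.
\<close>

definition jump :: "real \<Rightarrow> real \<Rightarrow> (complex \<Rightarrow> complex) \<Rightarrow> int \<Rightarrow> complex" where
  "jump r s f n = fc f r n - fc f s n"

context
  fixes r s :: real
  assumes rs: "0 < r" "r < 1" "1 < s"
begin

lemma jump_cong: "(\<And>z. norm z = r \<or> norm z = s \<Longrightarrow> f z = g z) \<Longrightarrow> jump r s f n = jump r s g n"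
  unfolding jump_def using rs by (intro arg_cong2[of _ _ _ _ minus] fc_cong) auto

lemma jump_shift: "jump r s (\<lambda>z. z powi m * f z) n = jump r s f (n - m)"
  using rs by (simp add: jump_def fc_shift)

lemma jump_diff:
  assumes "continuous_on (sphere 0 r) f" "continuous_on (sphere 0 r) g"
    "continuous_on (sphere 0 s) f" "continuous_on (sphere 0 s) g"
  shows "jump r s (\<lambda>z. f z - g z) n = jump r s f n - jump r s g n"
  using rs by (simp add: jump_def fc_diff[OF assms(1,2)] fc_diff[OF assms(3,4)])

lemma jump_cmult: "jump r s (\<lambda>z. c * f z) n = c * jump r s f n"
  by (simp add: jump_def fc_cmult algebra_simps)

lemma jump_holomorphic:
  "f holomorphic_on annulus l u \<Longrightarrow> 0 \<le> l \<Longrightarrow> l < r \<Longrightarrow> s < u \<Longrightarrow> jump r s f n = 0"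
  using fc_annulus[of f l u r s n] rs by (simp add: jump_def)

lemma continuous_on_sphere_pole:
  fixes f :: "complex \<Rightarrow> complex"
  assumes "t = r \<or> t = s" and f: "continuous_on (sphere 0 t) f"
  shows "continuous_on (sphere 0 t) (\<lambda>z. f z / (1 - z) ^ k)"
  by (intro continuous_intros f) (use assms rs in auto)

lemma continuous_on_sphere_pole_1:
  assumes "t = r \<or> t = s"
  shows "continuous_on (sphere 0 t) (\<lambda>z. 1 / (1 - z :: complex))"
  by (intro continuous_intros) (use assms rs in auto)

text \<open>Multiplying \<open>1 / (1 - z)\<close> by \<open>1 - z\<close> gives a function without
  jump, so the jump is the same for all \<open>n\<close> and one value decides.\<close>

lemma jump_pole_1: "jump r s (\<lambda>z. 1 / (1 - z)) n = 1"
proof -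
  let ?g = "\<lambda>z::complex. 1 / (1 - z)"
  have cg: "continuous_on (sphere 0 t) ?g" if "t = r \<or> t = s" for t
    by (rule continuous_on_sphere_pole_1[OF that])
  have step: "jump r s ?g n = jump r s ?g (n - 1)" for n
  proof -
    have "jump r s ?g n - jump r s (\<lambda>z. z powi 1 * ?g z) n = jump r s (\<lambda>z. ?g z - z powi 1 * ?g z) n"
      using rs by (subst jump_diff) (auto intro!: cg continuous_intros)
    also have "\<dots> = jump r s (\<lambda>_. 1) n"
    proof (rule jump_cong)
      fix z :: complex assume "norm z = r \<or> norm z = s"
      then have "z \<noteq> 1" using rs by auto
      then show "?g z - z powi 1 * ?g z = 1" by (simp add: field_simps)
    qed
    also have "\<dots> = 0" using rs by (intro jump_holomorphic[of _ 0 "s + 1"]) auto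
    finally show ?thesis by (simp only: jump_shift) simp
  qed
  \<comment> \<open>For \<open>n = -1\<close> no power of \<open>z\<close> remains in the contour
    integral: the outer circle gives the residue \<open>-1\<close> at \<open>1\<close>, and the
    inner one gives \<open>0\<close>.\<close>
  have base: "jump r s ?g (-1) = 1"
  proof -
    have "((\<lambda>u. 1 / (u - 1)) has_contour_integral (2 * of_real pi * \<i> * 1)) (circlepath 0 s)"
      using rs by (intro Cauchy_integral_circlepath_simple) auto
    then have "contour_integral (circlepath 0 s) (\<lambda>u. - (1 / (u - 1))) = - (2 * of_real pi * \<i>)"
      using has_contour_integral_neg contour_integral_unique by fastforce
    moreover have "(\<lambda>u::complex. - (1 / (u - 1))) = (\<lambda>z. ?g z * z powi (- (-1) - 1))"
      by (auto simp: fun_eq_iff minus_divide_right)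
    ultimately have "2 * of_real pi * \<i> * fc ?g s (-1) = 2 * of_real pi * \<i> * (-1)"
      using fc_contour[of s ?g "-1"] rs by simp
    then have 1: "fc ?g s (-1) = -1" by (subst (asm) mult_left_cancel) auto
    have "(?g has_contour_integral 0) (circlepath 0 r)"
      by (rule Cauchy_theorem_disc_simple[of _ 0 1]) (use rs in \<open>auto intro!: holomorphic_intros\<close>)
    then have "2 * of_real pi * \<i> * fc ?g r (-1) = 0"
      using fc_contour[of r ?g "-1"] rs contour_integral_unique by simp
    then show ?thesis using 1 by (simp add: jump_def)
  qed
  show ?thesis
  proof (cases "n \<ge> -1")
    case True then show ?thesis
      by (induction rule: int_ge_induct) (use base step in \<open>auto simp: step[of "_ + 1"]\<close>)
  next
    case False
    then have "n \<le> -1" by simp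
    then show ?thesis
    proof (induction rule: int_le_induct)
      case (step i) then show ?case using \<open>\<And>n. jump r s ?g n = jump r s ?g (n - 1)\<close>[of i] by simp
    qed (rule base)
  qed
qed

text \<open>Subtracting \<open>H 1 / (1 - z)\<close> leaves a difference quotient, which extends
  holomorphically over \<open>1\<close> and has no jump.\<close>

lemma jump_simple_pole:
  assumes H: "H holomorphic_on annulus l u" and lu: "0 \<le> l" "l < r" "s < u"
  shows "jump r s (\<lambda>z. H z / (1 - z)) n = H 1"
proof -
  define K where "K = (\<lambda>z. if z = 1 then deriv H 1 else (H z - H 1) / (z - 1))"
  have K: "K holomorphic_on annulus l u"
    unfolding K_def by (rule pole_lemma_open[OF H open_annulus])
  have cK: "continuous_on (sphere 0 t) K" if "t = r \<or> t = s" for t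
    using that rs lu by (intro continuous_on_sphere_annulus[OF K]) auto
  have cg: "continuous_on (sphere 0 t) (\<lambda>z. 1 / (1 - z :: complex))" if "t = r \<or> t = s" for t
    by (rule continuous_on_sphere_pole_1[OF that])
  have "jump r s (\<lambda>z. H z / (1 - z)) n = jump r s (\<lambda>z. H 1 * (1 / (1 - z)) - K z) n"
  proof (rule jump_cong)
    fix z :: complex assume "norm z = r \<or> norm z = s"
    then have "z \<noteq> 1" using rs by auto
    then show "H z / (1 - z) = H 1 * (1 / (1 - z)) - K z" by (simp add: K_def field_simps)
  qed
  also have "\<dots> = H 1 * jump r s (\<lambda>z. 1 / (1 - z)) n - jump r s K n"
    by (subst jump_diff) (auto intro!: cg cK continuous_intros simp only: jump_cmult)
  also have "\<dots> = H 1" using jump_pole_1 jump_holomorphic[OF K] lu by simp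
  finally show ?thesis .
qed

text \<open>Shifting the index by one multiplies the function by \<open>1 / z\<close>, so the
  forward difference in \<open>n\<close> corresponds to the factor \<open>(1 - z) / z\<close>. It
  lowers the pole order and replaces \<open>H\<close> by \<open>H z / z\<close>, which has the same
  value at \<open>1\<close>. Summing up in the Newton basis shifts the coefficients by one place and
  preserves the leading one. This carries out the truncation of the principal part.\<close>

lemma jump_pole_polynomial:
  assumes H: "H holomorphic_on annulus l u" and lu: "0 \<le> l" "l < r" "s < u"
  shows "\<exists>c. c k = H 1 \<and> (\<forall>n. jump r s (\<lambda>z. H z / (1 - z) ^ Suc k) n = (\<Sum>j\<le>k. c j * (of_int n gchoose j)))"
  using H
proof (induction k arbitrary: H)
  case 0
  then show ?case using jump_simple_pole[OF 0 lu] by (intro exI[of _ "\<lambda>_. H 1"]) simp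
next
  case (Suc k)
  have "(\<lambda>z. H z / z) holomorphic_on annulus l u"
    using lu by (intro holomorphic_intros Suc.prems) (auto simp: annulus_def)
  from Suc.IH[OF this] obtain c where c: "c k = H 1"
    "\<And>n. jump r s (\<lambda>z. H z / z / (1 - z) ^ Suc k) n = (\<Sum>j\<le>k. c j * (of_int n gchoose j))" by auto
  define D where "D n = jump r s (\<lambda>z. H z / (1 - z) ^ Suc (Suc k)) n" for n
  \<comment> \<open>The constant of summation is the value at \<open>n = 0\<close>; two sequences
    with equal differences and equal value at \<open>0\<close> agree on all integers.\<close>
  define c' where "c' j = (case j of 0 \<Rightarrow> D 0 | Suc j \<Rightarrow> c j)" for j
  define E where "E n = (\<Sum>j\<le>Suc k. c' j * (complex_of_int n gchoose j))" for n
  have cH: "continuous_on (sphere 0 t) H" if "t = r \<or> t = s" for t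
    by (rule continuous_on_sphere_annulus[OF Suc.prems]) (use that rs lu in auto)
  have cf: "continuous_on (sphere 0 t) (\<lambda>z. H z / (1 - z) ^ Suc (Suc k))" if "t = r \<or> t = s" for t
    by (rule continuous_on_sphere_pole[OF that cH[OF that]])
  have stepD: "D (n + 1) - D n = (\<Sum>j\<le>k. c j * (of_int n gchoose j))" for n
  proof -
    have "D (n + 1) - D n = jump r s (\<lambda>z. z powi (-1) * (H z / (1 - z) ^ Suc (Suc k))) n - D n"
      unfolding D_def jump_shift by simp
    also have "\<dots> = jump r s (\<lambda>z. z powi (-1) * (H z / (1 - z) ^ Suc (Suc k)) - H z / (1 - z) ^ Suc (Suc k)) n"
      unfolding D_def by (subst jump_diff) (use rs in \<open>auto intro!: continuous_intros cf cH\<close>)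
    also have "\<dots> = jump r s (\<lambda>z. H z / z / (1 - z) ^ Suc k) n"
    proof (rule jump_cong)
      fix z :: complex assume "norm z = r \<or> norm z = s"
      then have "z \<noteq> 1" "z \<noteq> 0" using rs by auto
      then show "z powi (-1) * (H z / (1 - z) ^ Suc (Suc k)) - H z / (1 - z) ^ Suc (Suc k) = H z / z / (1 - z) ^ Suc k"
        by (simp add: power_int_minus divide_simps) (simp add: algebra_simps)
    qed
    finally show ?thesis using c(2) by simp
  qed
  have stepE: "E (n + 1) - E n = (\<Sum>j\<le>k. c j * (of_int n gchoose j))" for n
    unfolding E_def sum.atMost_Suc_shift
    by (simp add: c'_def gbinomial_Suc_Suc[of "of_int n", simplified add.commute] sum_subtractf[symmetric] gbinomial_Suc_Suc algebra_simps)
  have DE0: "D 0 = E 0"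
    unfolding E_def sum.atMost_Suc_shift by (simp add: c'_def gbinomial_0)
  have "D n = E n" for n
  proof (induction n rule: int_induct[of _ 0])
    case (step1 i) then show ?case using stepD[of i] stepE[of i] by (simp add: algebra_simps)
  next
    case (step2 i) then show ?case using stepD[of "i - 1"] stepE[of "i - 1"] by (simp add: algebra_simps)
  qed (rule DE0)
  then show ?case by (intro exI[of _ c']) (simp add: c'_def c(1) D_def E_def)
qed

end

section \<open>Extremal polynomials in the Newton basis\<close>

definition Pc :: "nat \<Rightarrow> (nat \<Rightarrow> complex) \<Rightarrow> complex \<Rightarrow> complex" where
  "Pc k c x = (\<Sum>j\<le>k. c j * (x gchoose j))"

definition gfun :: "nat \<Rightarrow> (nat \<Rightarrow> complex) \<Rightarrow> complex \<Rightarrow> complex" where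
  "gfun k c z = (\<Sum>j\<le>k. c j * (z ^ j / (1 - z) ^ Suc j))"

lemma sums_choose_add:
  fixes z :: complex
  assumes "norm z < 1"
  shows "(\<lambda>n. of_nat ((n + j) choose j) * z ^ n) sums (1 / (1 - z) ^ Suc j)"
proof -
  have "1 - z \<noteq> 0" using assms by auto
  have "(\<lambda>n. ((- of_nat (Suc j)) gchoose n) * (- z) ^ n) sums (1 + (- z)) powr (- of_nat (Suc j))"
    by (rule gen_binomial_complex) (use assms in simp)
  also have "(1 + (- z)) powr (- of_nat (Suc j)) = 1 / (1 - z) ^ Suc j"
    using \<open>1 - z \<noteq> 0\<close> powr_nat'[of "1 - z" "Suc j"]
    by (simp only: powr_minus diff_conv_add_uminus[symmetric] inverse_eq_divide) (simp del: power_Suc of_nat_Suc)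
  also have "(\<lambda>n. ((- of_nat (Suc j) :: complex) gchoose n) * (- z) ^ n) = (\<lambda>n. of_nat ((n + j) choose j) * z ^ n)"
  proof
    fix n
    have "(- of_nat (Suc j) :: complex) gchoose n = (-1) ^ n * (of_nat (n + j) gchoose n)"
      by (subst gbinomial_minus) (simp add: add.commute)
    also have "(of_nat (n + j) gchoose n :: complex) = of_nat ((n + j) choose j)"
    proof -
      have "(n + j) choose n = (n + j) choose j" using binomial_symmetric[of j "n + j"] by simp
      then show ?thesis by (simp only: binomial_gbinomial[symmetric])
    qed
    finally have X: "(- of_nat (Suc j) :: complex) gchoose n = (-1) ^ n * of_nat ((n + j) choose j)" .
    have "(-1) ^ n * (- z) ^ n = z ^ n" by (simp only: power_mult_distrib[symmetric]) simp
    then show "((- of_nat (Suc j) :: complex) gchoose n) * (- z) ^ n = of_nat ((n + j) choose j) * z ^ n"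
      unfolding X by (metis mult.assoc mult.left_commute)
  qed
  finally show ?thesis .
qed

lemma gbinomial_sums:
  fixes z :: complex
  assumes "norm z < 1"
  shows "(\<lambda>n. (of_nat n gchoose j) * z ^ n) sums (z ^ j / (1 - z) ^ Suc j)"
proof -
  have "(\<lambda>n. z ^ j * (of_nat ((n + j) choose j) * z ^ n)) sums (z ^ j * (1 / (1 - z) ^ Suc j))"
    by (intro sums_mult sums_choose_add assms)
  then have "(\<lambda>n. (of_nat (n + j) gchoose j) * z ^ (n + j)) sums (z ^ j / (1 - z) ^ Suc j)"
    by (simp add: binomial_gbinomial power_add algebra_simps del: power_Suc)
  then have "(\<lambda>n. (of_nat n gchoose j) * z ^ n) sums (z ^ j / (1 - z) ^ Suc j + (\<Sum>i<j. (of_nat i gchoose j) * z ^ i))"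
    by (simp only: sums_iff_shift[where f="\<lambda>n. (of_nat n gchoose j) * z ^ n"])
  moreover have "(\<Sum>i<j. (of_nat i gchoose j) * z ^ i) = 0"
    by (intro sum.neutral) (simp add: binomial_gbinomial[symmetric])
  ultimately show ?thesis by simp
qed

lemma gbinomial_neg: "((- of_nat n - 1 :: 'a :: field_char_0) gchoose j) = (-1) ^ j * of_nat ((n + j) choose j)"
proof -
  have "(- of_nat n - 1 :: 'a) = - (of_nat (Suc n))" by simp
  then show ?thesis by (subst \<open>_ = _\<close>, subst gbinomial_minus) (simp add: binomial_gbinomial add.commute)
qed

lemma Pc_sums: "norm z < 1 \<Longrightarrow> (\<lambda>n. Pc k c (of_nat n) * z ^ n) sums gfun k c z"
  unfolding Pc_def gfun_def sum_distrib_right mult.assoc by (intro sums_sum sums_mult gbinomial_sums)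

lemma Pc_neg_sums:
  assumes "norm y < 1"
  shows "(\<lambda>n. Pc k c (- of_nat n - 1) * y ^ n) sums (\<Sum>j\<le>k. c j * ((-1) ^ j / (1 - y) ^ Suc j))"
proof -
  have "(\<lambda>n. (- of_nat n - 1 gchoose j) * y ^ n) sums ((-1) ^ j / (1 - y) ^ Suc j)" for j
    using sums_mult[OF sums_choose_add[OF assms], of "(-1) ^ j" j] by (simp add: gbinomial_neg mult.assoc)
  then show ?thesis
    unfolding Pc_def sum_distrib_right mult.assoc by (intro sums_sum sums_mult)
qed

lemma gfun_inverse:
  assumes "y \<noteq> 0" "y \<noteq> 1"
  shows "gfun k c (inverse y) = - y * (\<Sum>j\<le>k. c j * ((-1) ^ j / (1 - y) ^ Suc j))"
  unfolding gfun_def sum_distrib_left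
proof (intro sum.cong refl)
  fix j
  have "1 - inverse y = - (1 - y) / y" using assms by (simp add: field_simps)
  then have "inverse y ^ j / (1 - inverse y) ^ Suc j = inverse y ^ j * y ^ Suc j / (- (1 - y)) ^ Suc j"
    by (simp only: power_divide) simp
  also have "inverse y ^ j * y ^ Suc j = y"
    using assms by (simp add: power_inverse field_simps)
  also have "(- (1 - y)) ^ Suc j = (-1) ^ Suc j * (1 - y) ^ Suc j" by (rule power_minus)
  finally have e: "inverse y ^ j / (1 - inverse y) ^ Suc j = y / ((-1) ^ Suc j * (1 - y) ^ Suc j)" .
  have "((-1) ^ j * (-1) ^ j :: complex) = 1" by (simp add: power_add[symmetric])
  moreover have "(1 - y) ^ Suc j \<noteq> 0" using assms by simp
  ultimately have "y / ((-1) ^ Suc j * (1 - y) ^ Suc j) = - y * ((-1) ^ j / (1 - y) ^ Suc j)"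
    by (simp add: divide_simps del: power_Suc) (simp add: algebra_simps)
  then show "c j * (inverse y ^ j / (1 - inverse y) ^ Suc j) = - y * (c j * ((-1) ^ j / (1 - y) ^ Suc j))"
    unfolding e by simp
qed

lemma summable_norm_power_series:
  fixes p :: "nat \<Rightarrow> complex"
  assumes "\<And>z. norm z < 1 \<Longrightarrow> summable (\<lambda>n. p n * z ^ n)" "0 \<le> r" "r < 1"
  shows "summable (\<lambda>n. norm (p n) * r ^ n)"
proof -
  have "summable (\<lambda>n. norm (p n * complex_of_real r ^ n))"
    by (rule powser_insidea[of p "complex_of_real ((1 + r) / 2)"])
       (use assms in \<open>auto intro!: assms(1) simp del: of_real_add of_real_divide simp: norm_of_real\<close>)
  then show ?thesis using assms(2) by (simp add: norm_mult norm_power)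
qed

text \<open>The pairing of a Laurent series with \<open>W\<close> is bounded by Cauchy-Schwarz: the
  coefficients of the series against those of \<open>W\<close>, whose weighted squares are
  controlled by Bessel. Partial sums converge uniformly on the circle by \<open>sm\<close>. The
  exponents \<open>e\<close> are an arbitrary injective sequence so that expansions at
  \<open>0\<close> and at infinity are both covered.\<close>

lemma norm_fc_series_le:
  fixes p :: "nat \<Rightarrow> complex" and e :: "nat \<Rightarrow> int"
  assumes r: "r > 0" and e: "inj e"
    and sm: "summable (\<lambda>n. norm (p n) * r powi e n)"
    and F: "\<And>z. norm z = r \<Longrightarrow> (\<lambda>n. p n * z powi e n) sums F z"
    and W: "continuous_on (sphere 0 r) W" and M: "\<And>z. norm z = r \<Longrightarrow> norm (W z) \<le> M" and M0: "0 \<le> M"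
    and q: "\<And>N. (\<Sum>n<N. (norm (p n) * r powi e n)\<^sup>2) \<le> q"
  shows "norm (fc (\<lambda>z. F z * W z) r 0) \<le> sqrt q * M"
proof -
  define S where "S N z = (\<Sum>n<N. p n * z powi e n)" for N z
  have cS: "continuous_on (sphere 0 r) (S N)" for N
    unfolding S_def by (intro continuous_intros) (use r in auto)
  have ul: "uniform_limit (sphere 0 r) S F sequentially"
  proof -
    have "uniform_limit (sphere 0 r) (\<lambda>N z. \<Sum>n<N. p n * z powi e n) (\<lambda>z. \<Sum>n. p n * z powi e n) sequentially"
      by (rule Weierstrass_m_test[OF _ sm]) (use r in \<open>auto simp: norm_mult norm_power_int\<close>)
    moreover have "(\<Sum>n. p n * z powi e n) = F z" if "z \<in> sphere 0 r" for z
      using F[of z] that by (simp add: sums_iff)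
    ultimately show ?thesis unfolding S_def by (metis (no_types, lifting) uniform_limit_cong')
  qed
  have cF: "continuous_on (sphere 0 r) F"
    by (rule uniform_limit_theorem[OF _ ul]) (use cS in auto)
  have SW: "norm (fc (\<lambda>z. S N z * W z) r 0) \<le> sqrt q * M" for N
  proof -
    have "fc (\<lambda>z. S N z * W z) r 0 = fc (\<lambda>z. \<Sum>n<N. p n * (z powi e n * W z)) r 0"
      by (simp add: S_def sum_distrib_right mult.assoc)
    also have "\<dots> = (\<Sum>n<N. p n * fc W r (- e n))"
      by (subst fc_sum) (auto simp: fc_cmult fc_shift[OF r] intro!: continuous_intros W r, use r in auto)
    finally have "norm (fc (\<lambda>z. S N z * W z) r 0) \<le> (\<Sum>n<N. norm (p n * fc W r (- e n)))"
      using norm_sum by simp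
    also have "\<dots> = (\<Sum>n<N. (norm (p n) * r powi e n) * (norm (fc W r (- e n)) * r powi (- e n)))"
      using r by (intro sum.cong refl) (simp add: norm_mult power_int_minus field_simps)
    also have "\<dots> \<le> sqrt ((\<Sum>n<N. (norm (p n) * r powi e n)\<^sup>2) * (\<Sum>n<N. (norm (fc W r (- e n)) * r powi (- e n))\<^sup>2))"
      by (intro real_le_rsqrt Cauchy_Schwarz_ineq_sum)
    also have "\<dots> \<le> sqrt (q * M\<^sup>2)"
    proof (intro real_sqrt_le_mono mult_mono q)
      have "(\<Sum>n<N. (norm (fc W r (- e n)) * r powi (- e n))\<^sup>2) = (\<Sum>m\<in>(\<lambda>n. - e n) ` {..<N}. (norm (fc W r m) * r powi m)\<^sup>2)"
        by (subst sum.reindex) (use e in \<open>auto simp: inj_def intro!: inj_onI\<close>)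
      also have "\<dots> \<le> M\<^sup>2" by (rule Bessel_fc[OF W r]) (use M in auto)
      finally show "(\<Sum>n<N. (norm (fc W r (- e n)) * r powi (- e n))\<^sup>2) \<le> M\<^sup>2" .
      show "0 \<le> q" using q[of 0] by simp
    qed (auto intro!: sum_nonneg)
    also have "\<dots> = sqrt q * M" using M0 by (simp add: real_sqrt_mult)
    finally show ?thesis .
  qed
  show ?thesis
  proof (rule field_le_epsilon)
    fix d :: real assume d: "d > 0"
    define \<epsilon> where "\<epsilon> = d / (M + 1)"
    have \<epsilon>: "\<epsilon> > 0" "\<epsilon> * M \<le> d" using d M0 by (auto simp: \<epsilon>_def field_simps)
    from uniform_limitD[OF ul \<epsilon>(1)] obtain N where N: "\<And>z. z \<in> sphere 0 r \<Longrightarrow> dist (S N z) (F z) < \<epsilon>"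
      unfolding eventually_sequentially by (meson order_refl)
    have "fc (\<lambda>z. F z * W z) r 0 - fc (\<lambda>z. S N z * W z) r 0 = fc (\<lambda>z. F z * W z - S N z * W z) r 0"
      by (rule fc_diff[symmetric]) (intro continuous_intros cF cS W r)+
    also have "norm \<dots> \<le> \<epsilon> * M"
    proof (rule norm_fc_le[OF _ r])
      fix z :: complex assume z: "z \<in> sphere 0 r"
      have "norm (F z * W z - S N z * W z) = norm (F z - S N z) * norm (W z)"
        by (simp add: norm_mult[symmetric] algebra_simps)
      also have "\<dots> \<le> \<epsilon> * M" using N[OF z] M[of z] z \<epsilon>(1) by (intro mult_mono) (auto simp: dist_norm norm_minus_commute)
      finally show "norm (F z * W z - S N z * W z) \<le> \<epsilon> * M" .
    qed (use \<epsilon> M0 in \<open>auto intro!: continuous_intros cF cS W\<close>)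
    finally have "norm (fc (\<lambda>z. F z * W z) r 0 - fc (\<lambda>z. S N z * W z) r 0) \<le> d" using \<epsilon>(2) by simp
    then show "norm (fc (\<lambda>z. F z * W z) r 0) \<le> sqrt q * M + d"
      using SW[of N] norm_triangle_ineq[of "fc (\<lambda>z. F z * W z) r 0 - fc (\<lambda>z. S N z * W z) r 0" "fc (\<lambda>z. S N z * W z) r 0"]
      by simp
  qed
qed

context
  fixes r s l u :: real
  assumes rs: "0 < r" "r < 1" "1 < s" and lu: "0 \<le> l" "l < r" "s < u"
begin

text \<open>The factor \<open>(1 - z) ^ k\<close> reduces the pole of \<open>gfun\<close> at
  \<open>1\<close> to a simple one, and the jump then returns exactly
  \<open>c k * V 1\<close>.\<close>

lemma norm_leading_coeff_le:
  assumes V: "V holomorphic_on annulus l u"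
  shows "norm (c k * V 1) \<le> norm (fc (\<lambda>z. gfun k c z * ((1 - z) ^ k * V z)) r 0) + norm (fc (\<lambda>z. gfun k c z * ((1 - z) ^ k * V z)) s 0)"
proof -
  \<comment> \<open>The numerator over the common denominator \<open>(1 - z) ^ Suc k\<close> of
    \<open>gfun\<close>; at \<open>1\<close> only the term \<open>j = k\<close> survives.\<close>
  define N where "N z = (\<Sum>j\<le>k. c j * z ^ j * (1 - z) ^ (k - j))" for z
  have N1: "N 1 = c k"
  proof -
    have "N 1 = (\<Sum>j\<le>k. if j = k then c j else 0)"
      unfolding N_def by (intro sum.cong refl) auto
    then show ?thesis by simp
  qed
  have "jump r s (\<lambda>z. gfun k c z * ((1 - z) ^ k * V z)) 0 = jump r s (\<lambda>z. N z * V z / (1 - z)) 0"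
  proof (rule jump_cong[OF rs])
    fix z :: complex assume "norm z = r \<or> norm z = s"
    then have z: "1 - z \<noteq> 0" using rs by auto
    have "gfun k c z * (1 - z) ^ k = N z / (1 - z)"
      unfolding gfun_def N_def sum_distrib_right sum_divide_distrib
    proof (intro sum.cong refl)
      fix j assume "j \<in> {..k}"
      then have "(1 - z) ^ k = (1 - z) ^ j * (1 - z) ^ (k - j)" by (simp add: power_add[symmetric])
      then show "c j * (z ^ j / (1 - z) ^ Suc j) * (1 - z) ^ k = c j * z ^ j * (1 - z) ^ (k - j) / (1 - z)"
        using z by (simp add: field_simps)
    qed
    then show "gfun k c z * ((1 - z) ^ k * V z) = N z * V z / (1 - z)"
      by (simp add: mult.assoc[symmetric])
  qed
  also have "\<dots> = N 1 * V 1"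
    by (rule jump_simple_pole[OF rs _ lu]) (auto simp: N_def intro!: holomorphic_intros V)
  finally have "c k * V 1 = fc (\<lambda>z. gfun k c z * ((1 - z) ^ k * V z)) r 0 - fc (\<lambda>z. gfun k c z * ((1 - z) ^ k * V z)) s 0"
    by (simp add: N1 jump_def)
  then show ?thesis by (simp add: norm_triangle_ineq4)
qed

lemma continuous_on_sphere_weight:
  assumes V: "V holomorphic_on annulus l u" and t: "t = r \<or> t = s"
  shows "continuous_on (sphere 0 t) (\<lambda>z. (1 - z) ^ k * V z)"
  by (intro continuous_intros continuous_on_sphere_annulus[OF V]) (use t rs lu in auto)

lemma norm_leading_coeff_le_L2:
  assumes V: "V holomorphic_on annulus l u"
    and M1: "\<And>z. norm z = r \<Longrightarrow> norm ((1 - z) ^ k * V z) \<le> M1" and M10: "0 \<le> M1"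
    and M2: "\<And>z. norm z = s \<Longrightarrow> norm ((1 - z) ^ k * V z) \<le> M2" and M20: "0 \<le> M2"
    and q1: "\<And>N. (\<Sum>n<N. (norm (Pc k c (of_nat n)) * r ^ n)\<^sup>2) \<le> q"
    and q2: "\<And>N. (\<Sum>n<N. (norm (Pc k c (- of_nat n - 1)) * inverse s ^ Suc n)\<^sup>2) \<le> q"
  shows "norm (c k * V 1) \<le> sqrt q * (M1 + M2)"
proof -
  have 1: "norm (fc (\<lambda>z. gfun k c z * ((1 - z) ^ k * V z)) r 0) \<le> sqrt q * M1"
  proof (rule norm_fc_series_le[where e=int and p="\<lambda>n. Pc k c (of_nat n)"])
    show "summable (\<lambda>n. norm (Pc k c (of_nat n)) * r powi int n)"
      unfolding power_int_of_nat
      by (rule summable_norm_power_series) (use rs in \<open>auto intro: sums_summable[OF Pc_sums]\<close>)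
    show "(\<lambda>n. Pc k c (of_nat n) * z powi int n) sums gfun k c z" if "norm z = r" for z
      using Pc_sums[of z k c] that rs by simp
  qed (use rs M1 M10 q1 continuous_on_sphere_weight[OF V] in auto)
  \<comment> \<open>On the outer circle \<open>gfun\<close> is expanded in \<open>1 / z\<close>,
    with coefficients \<open>- Pc k c (- n - 1)\<close> at the exponents
    \<open>- (n + 1)\<close>.\<close>
  have 2: "norm (fc (\<lambda>z. gfun k c z * ((1 - z) ^ k * V z)) s 0) \<le> sqrt q * M2"
  proof (rule norm_fc_series_le[where e="\<lambda>n. - int (Suc n)" and p="\<lambda>n. - Pc k c (- of_nat n - 1)"])
    have pw: "z powi - int (Suc n) = inverse z ^ Suc n" for z :: "'a :: field" and n
      by (simp only: power_int_minus power_int_of_nat power_inverse)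
    have "summable (\<lambda>n. norm (Pc k c (- of_nat n - 1)) * inverse s ^ n)"
      by (rule summable_norm_power_series) (use rs in \<open>auto simp: inverse_less_1_iff intro: sums_summable[OF Pc_neg_sums]\<close>)
    from summable_mult[OF this, of "inverse s"]
    show "summable (\<lambda>n. norm (- Pc k c (- of_nat n - 1)) * s powi - int (Suc n))"
      by (simp only: pw norm_minus_cancel power_Suc mult.left_commute)
    show "(\<lambda>n. - Pc k c (- of_nat n - 1) * z powi - int (Suc n)) sums gfun k c z" if z: "norm z = s" for z
    proof -
      define y where "y = inverse z"
      have y: "norm y < 1" "y \<noteq> 0" "y \<noteq> 1" "z = inverse y"
        using z rs by (auto simp: y_def norm_inverse inverse_less_1_iff)
      have "gfun k c z = - y * (\<Sum>j\<le>k. c j * ((-1) ^ j / (1 - y) ^ Suc j))"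
        unfolding y(4) by (rule gfun_inverse[OF y(2,3)])
      with sums_mult[OF Pc_neg_sums[OF y(1), of k c], of "- y"] show ?thesis
        by (simp only: pw y_def[symmetric] power_Suc mult_minus_left mult.left_commute mult_minus_right)
    qed
    show "(\<Sum>n<N. (norm (- Pc k c (- of_nat n - 1)) * s powi - int (Suc n))\<^sup>2) \<le> q" for N
      using q2[of N] by (simp only: pw norm_minus_cancel)
    show "inj (\<lambda>n. - int (Suc n))" by (auto simp: inj_def)
  qed (use rs M2 M20 continuous_on_sphere_weight[OF V] in auto)
  show ?thesis using norm_leading_coeff_le[OF V, of c k] 1 2 by (simp add: algebra_simps)
qed

text \<open>Under \<open>u = z / (1 - z)\<close> the function \<open>gfun\<close> is the polynomial
  with coefficients \<open>c\<close> in \<open>u\<close>, divided by \<open>1 - z\<close>. The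
  denominators \<open>1 - r\<close> and \<open>s - 1\<close> are lower bounds of
  \<open>|1 - z|\<close> on the two circles.\<close>

lemma norm_leading_coeff_le_sup:
  assumes V: "V holomorphic_on annulus l u"
    and M1: "\<And>z. norm z = r \<Longrightarrow> norm ((1 - z) ^ k * V z) \<le> M1" and M10: "0 \<le> M1"
    and M2: "\<And>z. norm z = s \<Longrightarrow> norm ((1 - z) ^ k * V z) \<le> M2" and M20: "0 \<le> M2"
    and m: "\<And>z. norm z = r \<or> norm z = s \<Longrightarrow> norm (\<Sum>j\<le>k. c j * (z / (1 - z)) ^ j) \<le> m"
  shows "norm (c k * V 1) \<le> m * (M1 / (1 - r) + M2 / (s - 1))"
proof -
  have m0: "0 \<le> m" using m[of "of_real r"] rs by (auto intro: order_trans[OF norm_ge_zero])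
  have bound: "norm (fc (\<lambda>z. gfun k c z * ((1 - z) ^ k * V z)) t 0) \<le> m / \<delta> * M"
    if t: "t = r \<or> t = s" and \<delta>: "\<delta> > 0" "\<And>z::complex. norm z = t \<Longrightarrow> \<delta> \<le> norm (1 - z)"
      and M: "\<And>z. norm z = t \<Longrightarrow> norm ((1 - z) ^ k * V z) \<le> M" and M0: "0 \<le> M" for t \<delta> M
  proof (rule norm_fc_le)
    have ne: "1 - z \<noteq> 0" if "z \<in> sphere 0 t" for z :: complex using that t rs by auto
    show "continuous_on (sphere 0 t) (\<lambda>z. gfun k c z * ((1 - z) ^ k * V z))"
      unfolding gfun_def
      by (intro continuous_on_mult[OF _ continuous_on_sphere_weight[OF V t]] continuous_intros) (use ne in auto)
    fix z :: complex assume z: "z \<in> sphere 0 t"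
    have g: "gfun k c z = (\<Sum>j\<le>k. c j * (z / (1 - z)) ^ j) / (1 - z)"
      unfolding gfun_def sum_divide_distrib by (intro sum.cong refl) (simp add: power_divide)
    have "norm (gfun k c z) \<le> m / \<delta>"
      unfolding g norm_divide using m[of z] z t \<delta> m0 by (intro frac_le) auto
    then show "norm (gfun k c z * ((1 - z) ^ k * V z)) \<le> m / \<delta> * M"
      unfolding norm_mult[of "gfun k c z"] using M[of z] z m0 \<delta>(1) by (intro mult_mono) auto
  qed (use t rs m0 \<delta>(1) M0 in auto)
  have "norm (fc (\<lambda>z. gfun k c z * ((1 - z) ^ k * V z)) r 0) \<le> m / (1 - r) * M1"
  proof (rule bound)
    show "1 - r \<le> norm (1 - z)" if "norm z = r" for z :: complex
      using norm_triangle_ineq2[of 1 z] that by simp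
  qed (use rs M1 M10 in auto)
  moreover have "norm (fc (\<lambda>z. gfun k c z * ((1 - z) ^ k * V z)) s 0) \<le> m / (s - 1) * M2"
  proof (rule bound)
    show "s - 1 \<le> norm (1 - z)" if "norm z = s" for z :: complex
      using norm_triangle_ineq3[of 1 z] that by simp
  qed (use rs M2 M20 in auto)
  ultimately show ?thesis using norm_leading_coeff_le[OF V, of c k] by (simp add: algebra_simps)
qed

text \<open>The polynomial is the jump of \<open>H z / (1 - z) ^ Suc k\<close>, so each of its
  values is a difference of two Laurent coefficients, and Bessel controls both families. The factor
  \<open>2\<close> is that of
  \<open>(a + b)\<^sup>2 \<le> 2 * (a\<^sup>2 + b\<^sup>2)\<close>.\<close>

lemma exists_small_Pc:
  assumes H: "H holomorphic_on annulus l u"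
    and M1: "\<And>z. norm z = r \<Longrightarrow> norm (H z / (1 - z) ^ Suc k) \<le> M1"
    and M2: "\<And>z. norm z = s \<Longrightarrow> norm (H z / (1 - z) ^ Suc k) \<le> M2"
  shows "\<exists>c. c k = H 1 \<and> (\<forall>N. (\<Sum>n<N. (norm (Pc k c (of_nat n)) * r ^ n)\<^sup>2) \<le> 2 * (M1\<^sup>2 + M2\<^sup>2))
     \<and> (\<forall>N. (\<Sum>n<N. (norm (Pc k c (- of_nat n - 1)) * inverse s ^ Suc n)\<^sup>2) \<le> 2 * (M1\<^sup>2 + M2\<^sup>2))"
proof -
  define R where "R z = H z / (1 - z) ^ Suc k" for z
  obtain c where c: "c k = H 1" "\<And>n. jump r s R n = (\<Sum>j\<le>k. c j * (of_int n gchoose j))"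
    using jump_pole_polynomial[OF rs H lu, of k] unfolding R_def by auto
  have cR: "continuous_on (sphere 0 t) R" if "t = r \<or> t = s" for t
    unfolding R_def
    by (rule continuous_on_sphere_pole[OF rs that], rule continuous_on_sphere_annulus[OF H]) (use that rs lu in auto)
  have B1: "(\<Sum>n\<in>S. (norm (fc R r n) * r powi n)\<^sup>2) \<le> M1\<^sup>2" if "finite S" for S
    by (rule Bessel_fc[OF _ _ _ that]) (use cR rs M1 in \<open>auto simp: R_def\<close>)
  have B2: "(\<Sum>n\<in>S. (norm (fc R s n) * s powi n)\<^sup>2) \<le> M2\<^sup>2" if "finite S" for S
    by (rule Bessel_fc[OF _ _ _ that]) (use cR rs M2 in \<open>auto simp: R_def\<close>)
  \<comment> \<open>The weight \<open>w\<close> has to be dominated by the weights of both circles.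
    For exponents \<open>n \<ge> 0\<close> this holds for \<open>r ^ n\<close>, for negative
    exponents for the powers of \<open>1 / s\<close>, because \<open>r < s\<close>.\<close>
  have both: "(\<Sum>n<N. (norm (jump r s R (e n)) * w n)\<^sup>2) \<le> 2 * (M1\<^sup>2 + M2\<^sup>2)"
    if e: "inj e" and w: "\<And>n. 0 \<le> w n" "\<And>n. w n \<le> r powi e n" "\<And>n. w n \<le> s powi e n" for e :: "nat \<Rightarrow> int" and w N
  proof -
    have "(norm (jump r s R (e n)) * w n)\<^sup>2 \<le> 2 * ((norm (fc R r (e n)) * r powi e n)\<^sup>2 + (norm (fc R s (e n)) * s powi e n)\<^sup>2)" for n
    proof -
      have "norm (jump r s R (e n)) * w n \<le> (norm (fc R r (e n)) + norm (fc R s (e n))) * w n"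
        unfolding jump_def by (intro mult_right_mono norm_triangle_ineq4 w)
      also have "\<dots> \<le> norm (fc R r (e n)) * r powi e n + norm (fc R s (e n)) * s powi e n"
        unfolding distrib_right by (intro add_mono mult_left_mono w) auto
      finally have "(norm (jump r s R (e n)) * w n)\<^sup>2 \<le> (norm (fc R r (e n)) * r powi e n + norm (fc R s (e n)) * s powi e n)\<^sup>2"
        using w(1) by (intro power_mono) auto
      also have "\<dots> \<le> 2 * ((norm (fc R r (e n)) * r powi e n)\<^sup>2 + (norm (fc R s (e n)) * s powi e n)\<^sup>2)"
        using sum_squares_bound[of "norm (fc R r (e n)) * r powi e n" "norm (fc R s (e n)) * s powi e n"]
        by (simp add: power2_sum)
      finally show ?thesis .
    qed
    then have "(\<Sum>n<N. (norm (jump r s R (e n)) * w n)\<^sup>2)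
        \<le> (\<Sum>n<N. 2 * ((norm (fc R r (e n)) * r powi e n)\<^sup>2 + (norm (fc R s (e n)) * s powi e n)\<^sup>2))"
      by (intro sum_mono)
    also have "\<dots> = 2 * ((\<Sum>n\<in>e ` {..<N}. (norm (fc R r n) * r powi n)\<^sup>2) + (\<Sum>n\<in>e ` {..<N}. (norm (fc R s n) * s powi n)\<^sup>2))"
      using inj_on_subset[OF e subset_UNIV, of "{..<N}"] by (simp add: sum.reindex sum.distrib sum_distrib_left)
    also have "\<dots> \<le> 2 * (M1\<^sup>2 + M2\<^sup>2)" by (intro mult_left_mono add_mono B1 B2 finite_imageI finite_lessThan) auto
    finally show ?thesis .
  qed
  have "(\<Sum>n<N. (norm (Pc k c (of_nat n)) * r ^ n)\<^sup>2) \<le> 2 * (M1\<^sup>2 + M2\<^sup>2)" for N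
    using both[of int "\<lambda>n. r ^ n" N] rs by (simp add: c(2) Pc_def power_mono)
  moreover have "(\<Sum>n<N. (norm (Pc k c (- of_nat n - 1)) * inverse s ^ Suc n)\<^sup>2) \<le> 2 * (M1\<^sup>2 + M2\<^sup>2)" for N
  proof -
    have pw: "z powi - int (Suc n) = inverse z ^ Suc n" for z :: real and n
      by (simp only: power_int_minus power_int_of_nat power_inverse)
    have "inverse s ^ Suc n \<le> inverse r ^ Suc n" for n
      using rs by (intro power_mono) (auto simp: field_simps)
    moreover have "inj (\<lambda>n. - int (Suc n))" by (auto simp: inj_def)
    moreover have "jump r s R (- int (Suc n)) = Pc k c (- of_nat n - 1)" for n
    proof -
      have "complex_of_int (- int (Suc n)) = - of_nat n - 1" by simp
      then show ?thesis by (simp only: c(2) Pc_def)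
    qed
    ultimately show ?thesis
      using both[of "\<lambda>n. - int (Suc n)" "\<lambda>n. inverse s ^ Suc n" N] rs unfolding pw by simp
  qed
  ultimately show ?thesis using c(1) by blast
qed

end

section \<open>The Green function of the annulus and the constant \<open>gam\<close>\<close>

lemma power_series_geometric_sums:
  fixes c :: "nat \<Rightarrow> complex"
  assumes c: "\<And>m. norm (c m) \<le> \<beta> ^ m" and \<beta>: "0 < \<beta>" and z: "norm z < 1 / \<beta>"
  shows "(\<lambda>m. c m * z ^ m) sums (\<Sum>m. c m * z ^ m)"
proof -
  have "summable (\<lambda>m. (\<beta> * norm z) ^ m)"
    using z \<beta> by (intro summable_geometric) (simp add: field_simps)
  moreover have "norm (c n * z ^ n) \<le> (\<beta> * norm z) ^ n" for n
    unfolding norm_mult norm_power power_mult_distrib by (intro mult_right_mono c) simp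
  ultimately have "summable (\<lambda>m. c m * z ^ m)"
    by (rule summable_comparison_test'[where N=0])
  then show ?thesis by (rule summable_sums)
qed

lemma power_series_geometric_holomorphic:
  fixes c :: "nat \<Rightarrow> complex"
  assumes c: "\<And>m. norm (c m) \<le> \<beta> ^ m" and \<beta>: "0 < \<beta>"
  shows "(\<lambda>z. \<Sum>m. c m * z ^ m) holomorphic_on ball 0 (1 / \<beta>)"
proof (rule power_series_holomorphic[where a=c])
  fix w :: complex assume "w \<in> ball 0 (1 / \<beta>)"
  then have "norm w < 1 / \<beta>" by simp
  from power_series_geometric_sums[OF c \<beta> this]
  show "(\<lambda>m. c m * (w - 0) ^ m) sums (\<Sum>m. c m * w ^ m)" by simp
qed

text \<open>Solution of two linear equations: the identity of \<open>green_coeff_combine\<close> and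
  its mirror with \<open>a\<close> and \<open>b\<close> exchanged. On \<open>|z| = 1/A\<close> one
  has \<open>1 / z = A\<^sup>2 * cnj z\<close>, so there the positive and negative powers combine to
  \<open>- Re (z ^ m) / m\<close>, the terms of \<open>ln |1 - z|\<close>; likewise on the outer
  circle. For \<open>m = 0\<close> the division by zero gives \<open>0\<close>, as wanted.\<close>

definition green_coeff :: "real \<Rightarrow> real \<Rightarrow> nat \<Rightarrow> real" where
  "green_coeff a b m = - (b ^ m * (1 - a ^ m) / (1 - (a * b) ^ m)) / m"

lemma green_coeff_bound:
  assumes "0 < a" "a < 1" "0 < b" "b < 1"
  shows "\<bar>green_coeff a b m\<bar> \<le> b ^ m"
proof (cases "m = 0")
  case False
  have lt: "a ^ m < 1" "0 \<le> a ^ m" "b ^ m < 1" "0 < b ^ m"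
    using assms False by (auto simp: power_less_one_iff)
  have le: "a ^ m < 1" "(a * b) ^ m < 1" "0 \<le> a ^ m"
    using lt mult_strict_mono[of "a ^ m" 1 "b ^ m" 1] by (auto simp: power_mult_distrib)
  have "(a * b) ^ m \<le> a ^ m" using assms by (intro power_mono) (auto simp: mult_le_cancel_left1)
  then have q: "0 \<le> (1 - a ^ m) / (1 - (a * b) ^ m)" "(1 - a ^ m) / (1 - (a * b) ^ m) \<le> 1"
    using le by (auto simp: field_simps)
  have "\<bar>green_coeff a b m\<bar> = b ^ m * ((1 - a ^ m) / (1 - (a * b) ^ m)) / m"
  proof -
    have "green_coeff a b m = - (b ^ m * ((1 - a ^ m) / (1 - (a * b) ^ m)) / m)" by (simp add: green_coeff_def)
    moreover have "0 \<le> b ^ m * ((1 - a ^ m) / (1 - (a * b) ^ m)) / m"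
      by (rule divide_nonneg_nonneg[OF mult_nonneg_nonneg[OF _ q(1)]]) (use assms in auto)
    ultimately show ?thesis by linarith
  qed
  also have "\<dots> \<le> b ^ m * 1 / 1"
    using q assms False by (intro frac_le mult_left_mono) auto
  finally show ?thesis by simp
qed (simp add: green_coeff_def)

lemma green_coeff_combine:
  assumes "0 < a" "a < 1" "0 < b" "b < 1"
  shows "green_coeff a b m + green_coeff b a m / a ^ m = - 1 / m"
proof (cases "m = 0")
  case False
  define x y where "x = a ^ m" and "y = b ^ m"
  have xy: "x > 0" "x < 1" "y > 0" "y < 1"
    using assms False by (auto simp: x_def y_def power_less_one_iff)
  moreover have "x * y < 1" using mult_strict_mono[of x 1 y 1] xy by simp
  ultimately have "(y * (1 - x) + (1 - y)) / (1 - x * y) = 1" by (simp add: algebra_simps)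
  moreover have "x * (1 - y) / (1 - y * x) / x = (1 - y) / (1 - x * y)" using xy by (simp add: mult.commute)
  ultimately have "y * (1 - x) / (1 - x * y) + x * (1 - y) / (1 - y * x) / x = 1"
    by (simp only: add_divide_distrib)
  moreover have "green_coeff a b m + green_coeff b a m / a ^ m = - (y * (1 - x) / (1 - x * y) + x * (1 - y) / (1 - y * x) / x) / m"
    by (simp add: green_coeff_def x_def[symmetric] y_def[symmetric] power_mult_distrib add_divide_distrib diff_divide_distrib mult.commute)
  ultimately show ?thesis by simp
qed (simp add: green_coeff_def)

definition tau :: "real \<Rightarrow> real \<Rightarrow> real" where
  "tau A B = - (\<Sum>m. green_coeff (1 / A\<^sup>2) (1 / B\<^sup>2) m + green_coeff (1 / B\<^sup>2) (1 / A\<^sup>2) m)"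

text \<open>
  The regular part of the Green function of the annulus \<open>1/A < |z| < B\<close> with pole at \<open>1\<close>, up to a
  multiple of \<open>ln |z|\<close>: its real part agrees with \<open>ln |1 - z|\<close> up to a constant on each circle.
\<close>

definition green_reg :: "real \<Rightarrow> real \<Rightarrow> complex \<Rightarrow> complex" where
  "green_reg A B z = (\<Sum>m. of_real (green_coeff (1 / A\<^sup>2) (1 / B\<^sup>2) m) * z ^ m)
     + (\<Sum>m. of_real (green_coeff (1 / B\<^sup>2) (1 / A\<^sup>2) m) * inverse z ^ m)"

text \<open>Here \<open>- tau\<close> is the value of \<open>green_reg\<close> at the pole, and the
  other term of the exponent is \<open>ln kap\<close>, the common boundary level after the two
  circles are balanced. \<open>gamma_cap_eq_gam\<close> identifies the result with the
  capacity.\<close>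

definition gam :: "real \<Rightarrow> real \<Rightarrow> real" where
  "gam A B = exp (tau A B - ln A * ln B / ln (A * B))"

lemma gam_pos: "gam A B > 0" by (simp add: gam_def)

context
  fixes A B :: real
  assumes AB: "A > 1" "B > 1"
begin

lemma ab: "0 < 1 / A\<^sup>2" "1 / A\<^sup>2 < 1" "0 < 1 / B\<^sup>2" "1 / B\<^sup>2 < 1"
  using AB by (auto simp: one_less_power)

lemma green_sums:
  assumes "1 / A\<^sup>2 < norm z" "norm z < B\<^sup>2"
  shows "(\<lambda>m. of_real (green_coeff (1 / A\<^sup>2) (1 / B\<^sup>2) m) * z ^ m
     + of_real (green_coeff (1 / B\<^sup>2) (1 / A\<^sup>2) m) * inverse z ^ m) sums green_reg A B z"
  unfolding green_reg_def
proof (rule sums_add)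
  show "(\<lambda>m. of_real (green_coeff (1 / A\<^sup>2) (1 / B\<^sup>2) m) * z ^ m) sums (\<Sum>m. of_real (green_coeff (1 / A\<^sup>2) (1 / B\<^sup>2) m) * z ^ m)"
    by (rule power_series_geometric_sums[where \<beta>="1 / B\<^sup>2"]) (use green_coeff_bound ab assms in auto)
  have "norm z > 0" using assms(1) ab(1) by linarith
  then have "norm (inverse z) < 1 / (1 / A\<^sup>2)" unfolding norm_inverse using assms(1) AB by (simp add: field_simps)
  then show "(\<lambda>m. of_real (green_coeff (1 / B\<^sup>2) (1 / A\<^sup>2) m) * inverse z ^ m) sums (\<Sum>m. of_real (green_coeff (1 / B\<^sup>2) (1 / A\<^sup>2) m) * inverse z ^ m)"
    by (intro power_series_geometric_sums[where \<beta>="1 / A\<^sup>2"]) (use green_coeff_bound ab in auto)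
qed

lemma green_holomorphic: "green_reg A B holomorphic_on annulus (1 / A\<^sup>2) (B\<^sup>2)"
proof -
  let ?f = "\<lambda>z. \<Sum>m. complex_of_real (green_coeff (1 / A\<^sup>2) (1 / B\<^sup>2) m) * z ^ m"
  let ?g = "\<lambda>z. \<Sum>m. complex_of_real (green_coeff (1 / B\<^sup>2) (1 / A\<^sup>2) m) * z ^ m"
  have f: "?f holomorphic_on ball 0 (1 / (1 / B\<^sup>2))"
    by (rule power_series_geometric_holomorphic) (use green_coeff_bound ab in auto)
  have g: "?g holomorphic_on ball 0 (1 / (1 / A\<^sup>2))"
    by (rule power_series_geometric_holomorphic) (use green_coeff_bound ab in auto)
  have "(?g \<circ> inverse) holomorphic_on annulus (1 / A\<^sup>2) (B\<^sup>2)"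
  proof (rule holomorphic_on_compose_gen[OF _ g])
    show "inverse holomorphic_on annulus (1 / A\<^sup>2) (B\<^sup>2)"
      by (intro holomorphic_intros) (use ab in \<open>auto simp: annulus_def\<close>)
    show "inverse ` annulus (1 / A\<^sup>2) (B\<^sup>2) \<subseteq> ball 0 (1 / (1 / A\<^sup>2))"
    proof (rule image_subsetI)
      fix z assume z: "z \<in> annulus (1 / A\<^sup>2) (B\<^sup>2)"
      then have "norm z > 0" using ab(1) unfolding annulus_def by (simp only: mem_Collect_eq) linarith
      then have "norm (inverse z) < 1 / (1 / A\<^sup>2)"
        unfolding norm_inverse using z AB by (simp add: annulus_def field_simps)
      then show "inverse z \<in> ball 0 (1 / (1 / A\<^sup>2))" by simp
    qed
  qed
  moreover have "?f holomorphic_on annulus (1 / A\<^sup>2) (B\<^sup>2)"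
    by (rule holomorphic_on_subset[OF f]) (auto simp: annulus_def)
  ultimately show ?thesis unfolding green_reg_def[abs_def] o_def by (intro holomorphic_intros)
qed

lemma green_1: "green_reg A B 1 = of_real (- tau A B)"
proof -
  have "(\<lambda>m. complex_of_real (green_coeff (1 / A\<^sup>2) (1 / B\<^sup>2) m + green_coeff (1 / B\<^sup>2) (1 / A\<^sup>2) m)) sums green_reg A B 1"
    using green_sums[of 1] ab AB by (simp add: one_less_power)
  then have "Re (green_reg A B 1) = - tau A B" "Im (green_reg A B 1) = 0"
    unfolding tau_def sums_complex_iff by (auto simp: sums_iff)
  then show ?thesis by (simp add: complex_eq_iff)
qed

lemma Re_sums_ln:
  assumes "norm w < 1"
  shows "(\<lambda>m. - 1 / of_nat m * Re (w ^ m)) sums ln (norm (1 - w))"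
proof -
  have "(\<lambda>n. - ((- (- w)) ^ n) / of_nat n) sums ln (1 + - w)"
    by (rule Ln_series') (use assms in simp)
  from sums_Re[OF this] have "(\<lambda>n. Re (- (w ^ n) / of_nat n)) sums Re (ln (1 - w))" by simp
  moreover have "1 - w \<noteq> 0" using assms by auto
  ultimately show ?thesis by simp
qed

lemma inverse_eq_cnj:
  assumes "norm z = 1 / R" "R > 0"
  shows "inverse z = of_real (R\<^sup>2) * cnj z"
proof (rule inverse_unique)
  have "z * (of_real (R\<^sup>2) * cnj z) = of_real (R\<^sup>2) * of_real ((norm z)\<^sup>2)"
    by (simp only: complex_norm_square) (simp only: ac_simps)
  also have "\<dots> = 1" using assms by (simp add: power_divide flip: of_real_mult of_real_power)
  finally show "z * (of_real (R\<^sup>2) * cnj z) = 1" .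
qed

lemma Re_green_inner:
  assumes z: "norm z = 1 / A"
  shows "Re (green_reg A B z) = ln (norm (1 - z))"
proof -
  have A1: "1 / A\<^sup>2 < 1 / A" "1 / A < 1" using AB by (auto simp: field_simps power2_eq_square)
  moreover have "1 < B\<^sup>2" using AB by (simp add: one_less_power)
  ultimately have A2: "1 / A\<^sup>2 < 1 / A" "1 / A < B\<^sup>2" "1 / A < 1" by linarith+
  have inv: "inverse z ^ m = of_real (1 / (1 / A\<^sup>2) ^ m) * cnj (z ^ m)" for m
  proof -
    have "inverse z = of_real (A\<^sup>2) * cnj z"
      by (rule inverse_eq_cnj[OF z]) (use AB in simp)
    then show ?thesis by (simp add: power_mult_distrib power_one_over)
  qed
  have "(\<lambda>m. Re (of_real (green_coeff (1 / A\<^sup>2) (1 / B\<^sup>2) m) * z ^ m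
     + of_real (green_coeff (1 / B\<^sup>2) (1 / A\<^sup>2) m) * inverse z ^ m)) sums Re (green_reg A B z)"
    by (intro sums_Re green_sums) (use z A2 in auto)
  moreover have "Re (of_real (green_coeff (1 / A\<^sup>2) (1 / B\<^sup>2) m) * z ^ m
     + of_real (green_coeff (1 / B\<^sup>2) (1 / A\<^sup>2) m) * inverse z ^ m) = - 1 / of_nat m * Re (z ^ m)" for m
  proof -
    have "Re (of_real (green_coeff (1 / A\<^sup>2) (1 / B\<^sup>2) m) * z ^ m
     + of_real (green_coeff (1 / B\<^sup>2) (1 / A\<^sup>2) m) * inverse z ^ m)
      = (green_coeff (1 / A\<^sup>2) (1 / B\<^sup>2) m + green_coeff (1 / B\<^sup>2) (1 / A\<^sup>2) m / (1 / A\<^sup>2) ^ m) * Re (z ^ m)"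
      unfolding inv by (simp add: algebra_simps del: complex_cnj_power)
    then show ?thesis unfolding green_coeff_combine[OF ab] .
  qed
  ultimately have "(\<lambda>m. - 1 / of_nat m * Re (z ^ m)) sums Re (green_reg A B z)" by simp
  moreover have "(\<lambda>m. - 1 / of_nat m * Re (z ^ m)) sums ln (norm (1 - z))"
    by (rule Re_sums_ln) (use z A2 in simp)
  ultimately show ?thesis by (rule sums_unique2)
qed

text \<open>The combined series is that of \<open>ln |1 - 1/z|\<close>. The constant
  \<open>- ln B\<close>, absent on the inner circle, is the imbalance that a power of
  \<open>z\<close> has to remove.\<close>

lemma Re_green_outer:
  assumes z: "norm z = B"
  shows "Re (green_reg A B z) = ln (norm (1 - z)) - ln B"
proof -
  define w where "w = inverse z"
  have z0: "z \<noteq> 0" using z AB by auto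
  have w: "norm w = 1 / B" "z = inverse w" using z by (simp_all add: w_def norm_inverse divide_inverse del: inverse_eq_divide)
  have B2: "1 / A\<^sup>2 < B" "B < B\<^sup>2" "1 / B < 1"
  proof -
    show "1 / A\<^sup>2 < B" using AB ab(2) by linarith
    show "1 / B < 1" using AB by simp
    show "B < B\<^sup>2" using AB by (simp add: power2_eq_square)
  qed
  have inv: "z ^ m = of_real (1 / (1 / B\<^sup>2) ^ m) * cnj (w ^ m)" for m
  proof -
    have "z = of_real (B\<^sup>2) * cnj w"
      unfolding w(2) by (rule inverse_eq_cnj[OF w(1)]) (use AB in simp)
    then show ?thesis by (simp add: power_mult_distrib power_one_over)
  qed
  have "(\<lambda>m. Re (of_real (green_coeff (1 / A\<^sup>2) (1 / B\<^sup>2) m) * z ^ m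
     + of_real (green_coeff (1 / B\<^sup>2) (1 / A\<^sup>2) m) * w ^ m)) sums Re (green_reg A B z)"
    unfolding w_def by (intro sums_Re green_sums) (use z B2 in auto)
  moreover have "Re (of_real (green_coeff (1 / A\<^sup>2) (1 / B\<^sup>2) m) * z ^ m
     + of_real (green_coeff (1 / B\<^sup>2) (1 / A\<^sup>2) m) * w ^ m) = - 1 / of_nat m * Re (w ^ m)" for m
  proof -
    have "Re (of_real (green_coeff (1 / A\<^sup>2) (1 / B\<^sup>2) m) * z ^ m
     + of_real (green_coeff (1 / B\<^sup>2) (1 / A\<^sup>2) m) * w ^ m)
      = (green_coeff (1 / B\<^sup>2) (1 / A\<^sup>2) m + green_coeff (1 / A\<^sup>2) (1 / B\<^sup>2) m / (1 / B\<^sup>2) ^ m) * Re (w ^ m)"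
      unfolding inv by (simp add: algebra_simps del: complex_cnj_power)
    then show ?thesis unfolding green_coeff_combine[OF ab(3,4,1,2)] .
  qed
  ultimately have "(\<lambda>m. - 1 / of_nat m * Re (w ^ m)) sums Re (green_reg A B z)" by simp
  moreover have "(\<lambda>m. - 1 / of_nat m * Re (w ^ m)) sums ln (norm (1 - w))"
    by (rule Re_sums_ln) (use w B2 in simp)
  ultimately have "Re (green_reg A B z) = ln (norm (1 - w))" by (rule sums_unique2)
  also have "norm (1 - w) = norm (1 - z) / B"
  proof -
    have "1 - w = - (1 - z) / z" using z0 by (simp add: w_def field_simps)
    then show ?thesis using z by (simp only: norm_divide norm_minus_cancel)
  qed
  also have "ln (norm (1 - z) / B) = ln (norm (1 - z)) - ln B"
  proof -
    have "z \<noteq> 1" using z AB by auto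
    then show ?thesis using AB by (intro ln_divide_pos) auto
  qed
  finally show ?thesis .
qed

text \<open>
  The power of \<open>z\<close> that would equalize the moduli on the two circles has a real exponent; \<open>sft\<close> is its
  integer part and \<open>kap ^ k\<close> the exact common value.
\<close>

definition kap :: real where "kap = exp (- (ln A * ln B / ln (A * B)))"

lemma kap_pos: "kap > 0" by (simp add: kap_def)

lemma gam_kap: "gam A B ^ k = kap ^ k * exp (tau A B) ^ k"
  by (simp add: gam_def kap_def exp_diff power_mult_distrib[symmetric] exp_minus divide_inverse mult.commute)

definition sft :: "nat \<Rightarrow> nat" where "sft k = nat \<lfloor>k * (ln B / ln (A * B))\<rfloor>"

text \<open>The real number \<open>x = k * ln B / ln (A * B)\<close> satisfies
  \<open>A powr (-x) = B powr (x - k)\<close>, and \<open>kap ^ k\<close> is this common value.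
  Rounding \<open>x\<close> down moves the two sides by factors of at most \<open>A\<close> and
  \<open>B\<close>, uniformly in \<open>k\<close>.\<close>

lemma sft_bounds:
  shows "A ^ sft k * kap ^ k \<le> 1" and "kap ^ k * A ^ Suc (sft k) \<ge> 1"
    and "B ^ sft k \<le> kap ^ k * B ^ k" and "B ^ k * kap ^ k \<le> B * B ^ sft k"
proof -
  define x where "x = k * (ln B / ln (A * B))"
  have lAB: "ln (A * B) = ln A + ln B" "ln A > 0" "ln B > 0" using AB by (auto simp: ln_mult)
  have x0: "x \<ge> 0" using lAB by (simp add: x_def)
  have "sft k = nat \<lfloor>x\<rfloor>" by (simp only: sft_def x_def)
  then have sx: "real (sft k) \<le> x" "x \<le> real (Suc (sft k))" using x0 by linarith+
  have kapx: "kap ^ k = exp (- x * ln A)"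
    unfolding kap_def exp_of_nat_mult[symmetric] x_def by (simp add: field_simps)
  have kapx2: "kap ^ k = exp ((x - k) * ln B)"
    unfolding kapx x_def using lAB by (simp add: field_simps)
  have Ap: "A ^ n = exp (n * ln A)" "B ^ n = exp (n * ln B)" for n
    using AB by (auto simp: exp_of_nat_mult)
  have mA: "real (sft k) * ln A \<le> x * ln A" "x * ln A \<le> real (Suc (sft k)) * ln A"
    using sx lAB by (intro mult_right_mono; simp)+
  have mB: "real (sft k) * ln B \<le> x * ln B" "x * ln B \<le> real (Suc (sft k)) * ln B"
    using sx lAB by (intro mult_right_mono; simp)+
  show "A ^ sft k * kap ^ k \<le> 1"
    unfolding Ap kapx exp_add[symmetric] using mA(1) by simp
  show "kap ^ k * A ^ Suc (sft k) \<ge> 1"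
    unfolding Ap kapx exp_add[symmetric] using mA(2) by simp
  show "B ^ sft k \<le> kap ^ k * B ^ k"
    unfolding Ap kapx2 exp_add[symmetric] using mB(1) by (simp add: algebra_simps)
  have "B ^ k * kap ^ k \<le> B ^ Suc (sft k)"
    unfolding Ap kapx2 exp_add[symmetric] using mB(2) by (simp add: algebra_simps)
  then show "B ^ k * kap ^ k \<le> B * B ^ sft k" by simp
qed

definition Hk :: "nat \<Rightarrow> complex \<Rightarrow> complex" where
  "Hk k z = exp (of_nat k * green_reg A B z) * z ^ sft k"

lemma Hk_holomorphic: "Hk k holomorphic_on annulus (1 / A\<^sup>2) (B\<^sup>2)"
  unfolding Hk_def by (intro holomorphic_intros green_holomorphic)

lemma Hk_nonzero: "z \<noteq> 0 \<Longrightarrow> Hk k z \<noteq> 0" by (simp add: Hk_def)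

lemma Hk_1: "Hk k 1 = of_real (inverse (exp (tau A B) ^ k))"
  by (simp add: Hk_def green_1 exp_of_nat_mult exp_minus exp_of_real power_inverse)

lemma norm_Hk: "norm (Hk k z) = exp (Re (green_reg A B z)) ^ k * norm z ^ sft k"
  by (simp add: Hk_def norm_mult norm_power norm_exp_eq_Re exp_of_nat_mult)

lemma annulus_radii: "0 < 1 / A" "1 / A < 1" "1 < B" "0 \<le> 1 / A\<^sup>2" "1 / A\<^sup>2 < 1 / A" "B < B\<^sup>2"
proof -
  show "1 / A\<^sup>2 < 1 / A" using AB by (intro divide_strict_left_mono) (auto simp: power2_eq_square)
  show "B < B\<^sup>2" using AB by (simp add: power2_eq_square)
qed (use AB in auto)

lemma norm_1_minus: 
  "norm z = 1 / A \<Longrightarrow> 1 - 1 / A \<le> norm (1 - z)" "norm z = B \<Longrightarrow> B - 1 \<le> norm (1 - z)" for z :: complex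
  using norm_triangle_ineq2[of 1 z] norm_triangle_ineq3[of 1 z] by auto

lemma norm_Hk_inner: "norm z = 1 / A \<Longrightarrow> norm (Hk k z) = norm (1 - z) ^ k / A ^ sft k"
proof -
  assume z: "norm z = 1 / A"
  have "norm (1 - z) > 0" using norm_1_minus(1)[OF z] annulus_radii by linarith
  then show ?thesis by (simp add: norm_Hk Re_green_inner[OF z] z power_divide)
qed

lemma norm_Hk_outer: "norm z = B \<Longrightarrow> norm (Hk k z) = norm (1 - z) ^ k * B ^ sft k / B ^ k"
proof -
  assume z: "norm z = B"
  have "norm (1 - z) > 0" using norm_1_minus(2)[OF z] annulus_radii by linarith
  then show ?thesis using AB by (simp add: norm_Hk Re_green_outer[OF z] z exp_diff power_divide)
qed

lemma upper_weights:
  shows "norm z = 1 / A \<Longrightarrow> norm (Hk k z / (1 - z) ^ Suc k) \<le> kap ^ k * (A / (1 - 1 / A))"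
    and "norm z = B \<Longrightarrow> norm (Hk k z / (1 - z) ^ Suc k) \<le> kap ^ k * (1 / (B - 1))"
proof -
  assume z: "norm z = 1 / A"
  have nz: "norm (1 - z) > 0" using norm_1_minus(1)[OF z] annulus_radii by linarith
  have "norm (Hk k z / (1 - z) ^ Suc k) = 1 / A ^ sft k / norm (1 - z)"
    unfolding norm_divide norm_Hk_inner[OF z] norm_power using nz by (simp add: field_simps)
  also have "\<dots> \<le> (kap ^ k * A) / (1 - 1 / A)"
  proof (intro frac_le)
    show "1 / A ^ sft k \<le> kap ^ k * A" using sft_bounds(2)[of k] AB by (simp add: field_simps)
  qed (use norm_1_minus(1)[OF z] annulus_radii kap_pos AB in auto)
  finally show "norm (Hk k z / (1 - z) ^ Suc k) \<le> kap ^ k * (A / (1 - 1 / A))" by simp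
next
  assume z: "norm z = B"
  have nz: "norm (1 - z) > 0" using norm_1_minus(2)[OF z] annulus_radii by linarith
  have "norm (Hk k z / (1 - z) ^ Suc k) = B ^ sft k / B ^ k / norm (1 - z)"
    unfolding norm_divide norm_Hk_outer[OF z] norm_power using nz AB by (simp add: field_simps)
  also have "\<dots> \<le> kap ^ k / (B - 1)"
  proof (intro frac_le)
    show "B ^ sft k / B ^ k \<le> kap ^ k" using sft_bounds(3)[of k] AB by (simp add: field_simps)
  qed (use norm_1_minus(2)[OF z] annulus_radii kap_pos AB in auto)
  finally show "norm (Hk k z / (1 - z) ^ Suc k) \<le> kap ^ k * (1 / (B - 1))" by simp
qed

lemma lower_weights:
  shows "norm z = 1 / A \<Longrightarrow> norm ((1 - z) ^ k * inverse (Hk k z)) \<le> inverse (kap ^ k)"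
    and "norm z = B \<Longrightarrow> norm ((1 - z) ^ k * inverse (Hk k z)) \<le> B * inverse (kap ^ k)"
proof -
  assume z: "norm z = 1 / A"
  have nz: "norm (1 - z) > 0" using norm_1_minus(1)[OF z] annulus_radii by linarith
  have "norm ((1 - z) ^ k * inverse (Hk k z)) = A ^ sft k"
    unfolding norm_mult norm_inverse norm_Hk_inner[OF z] norm_power using nz AB by (simp add: field_simps)
  also have "\<dots> \<le> inverse (kap ^ k)" using sft_bounds(1)[of k] kap_pos by (simp add: field_simps)
  finally show "norm ((1 - z) ^ k * inverse (Hk k z)) \<le> inverse (kap ^ k)" .
next
  assume z: "norm z = B"
  have nz: "norm (1 - z) > 0" using norm_1_minus(2)[OF z] annulus_radii by linarith
  have "norm ((1 - z) ^ k * inverse (Hk k z)) = B ^ k / B ^ sft k"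
    unfolding norm_mult norm_inverse norm_Hk_outer[OF z] norm_power using nz AB by (simp add: field_simps)
  also have "\<dots> \<le> B * inverse (kap ^ k)" using sft_bounds(4)[of k] kap_pos AB by (simp add: field_simps)
  finally show "norm ((1 - z) ^ k * inverse (Hk k z)) \<le> B * inverse (kap ^ k)" .
qed

lemma inverse_Hk_holomorphic: "(\<lambda>z. inverse (Hk k z)) holomorphic_on annulus (1 / A\<^sup>2) (B\<^sup>2)"
proof (intro holomorphic_intros Hk_holomorphic Hk_nonzero)
  fix z assume "z \<in> annulus (1 / A\<^sup>2) (B\<^sup>2)"
  then show "z \<noteq> 0" using ab(1) by (auto simp: annulus_def)
qed

lemma norm_inverse_Hk_1: "norm (inverse (Hk k 1)) = exp (tau A B) ^ k"
  by (simp add: Hk_1 norm_inverse norm_power)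

text \<open>The test function is \<open>inverse (Hk k z)\<close>: together with
  \<open>(1 - z) ^ k\<close> its modulus is at most \<open>inverse (kap ^ k)\<close> on the inner
  and \<open>B\<close> times that on the outer circle, while its value at \<open>1\<close> is
  \<open>exp tau ^ k\<close>.\<close>

lemma gam_lower_L2:
  fixes c :: "nat \<Rightarrow> complex"
  assumes c: "c k = 1"
    and q1: "\<And>N. (\<Sum>n<N. (norm (Pc k c (of_nat n)) * inverse A ^ n)\<^sup>2) \<le> q"
    and q2: "\<And>N. (\<Sum>n<N. (norm (Pc k c (- of_nat n - 1)) * inverse B ^ Suc n)\<^sup>2) \<le> q"
  shows "gam A B ^ k \<le> sqrt q * (1 + B)"
proof -
  have "norm (c k * inverse (Hk k 1)) \<le> sqrt q * (inverse (kap ^ k) + B * inverse (kap ^ k))"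
    by (rule norm_leading_coeff_le_L2[OF annulus_radii inverse_Hk_holomorphic])
       (use lower_weights kap_pos AB q1 q2 in \<open>auto simp: inverse_eq_divide\<close>)
  then have "exp (tau A B) ^ k \<le> sqrt q * (1 + B) * inverse (kap ^ k)"
    unfolding c mult_1_left norm_inverse_Hk_1 by (simp add: algebra_simps)
  then show ?thesis unfolding gam_kap using kap_pos by (simp add: field_simps)
qed

lemma gam_lower_sup:
  fixes c :: "nat \<Rightarrow> complex"
  assumes c: "c k = 1"
    and m: "\<And>z. norm z = 1 / A \<or> norm z = B \<Longrightarrow> norm (\<Sum>j\<le>k. c j * (z / (1 - z)) ^ j) \<le> m"
  shows "gam A B ^ k \<le> m * (1 / (1 - 1 / A) + B / (B - 1))"
proof -
  have "norm (c k * inverse (Hk k 1)) \<le> m * (inverse (kap ^ k) / (1 - 1 / A) + B * inverse (kap ^ k) / (B - 1))"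
    by (rule norm_leading_coeff_le_sup[OF annulus_radii inverse_Hk_holomorphic])
       (use lower_weights kap_pos AB m in auto)
  also have "\<dots> = m * (1 / (1 - 1 / A) + B / (B - 1)) * inverse (kap ^ k)"
    by (simp add: algebra_simps inverse_eq_divide)
  finally have "exp (tau A B) ^ k \<le> m * (1 / (1 - 1 / A) + B / (B - 1)) * inverse (kap ^ k)"
    unfolding c mult_1_left norm_inverse_Hk_1 .
  then show ?thesis unfolding gam_kap using kap_pos
    by (simp only: inverse_eq_divide times_divide_eq_right mult_1_right) (simp add: pos_le_divide_eq mult.commute)
qed

lemma gam_upper_L2:
  obtains C where "C > 0"
    "\<And>k. \<exists>c. c k = 1 \<and> (\<forall>N. (\<Sum>n<N. (norm (Pc k c (of_nat n)) * inverse A ^ n)\<^sup>2) \<le> C * (gam A B ^ k)\<^sup>2)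
     \<and> (\<forall>N. (\<Sum>n<N. (norm (Pc k c (- of_nat n - 1)) * inverse B ^ Suc n)\<^sup>2) \<le> C * (gam A B ^ k)\<^sup>2)"
proof
  define C where "C = 2 * ((A / (1 - 1 / A))\<^sup>2 + (1 / (B - 1))\<^sup>2)"
  show "C > 0" using AB by (auto simp: C_def intro!: mult_pos_pos add_pos_pos)
  fix k
  \<comment> \<open>The polynomial obtained from the numerator \<open>Hk k\<close> has leading
    coefficient \<open>Hk k 1 = 1 / w\<close>; rescaling by \<open>w\<close> normalizes it and turns
    \<open>kap ^ k\<close> into \<open>gam A B ^ k\<close>.\<close>
  define w where "w = exp (tau A B) ^ k"
  have w0: "w > 0" by (simp add: w_def)
  obtain c where c: "c k = Hk k 1"
    "\<And>N. (\<Sum>n<N. (norm (Pc k c (of_nat n)) * (1 / A) ^ n)\<^sup>2) \<le> 2 * ((kap ^ k * (A / (1 - 1 / A)))\<^sup>2 + (kap ^ k * (1 / (B - 1)))\<^sup>2)"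
    "\<And>N. (\<Sum>n<N. (norm (Pc k c (- of_nat n - 1)) * inverse B ^ Suc n)\<^sup>2) \<le> 2 * ((kap ^ k * (A / (1 - 1 / A)))\<^sup>2 + (kap ^ k * (1 / (B - 1)))\<^sup>2)"
    using exists_small_Pc[OF annulus_radii Hk_holomorphic[of k] upper_weights] by blast
  define c' where "c' j = of_real w * c j" for j
  have P: "Pc k c' x = of_real w * Pc k c x" for x
    by (simp add: Pc_def c'_def sum_distrib_left mult.assoc)
  have Ck: "w\<^sup>2 * (2 * ((kap ^ k * (A / (1 - 1 / A)))\<^sup>2 + (kap ^ k * (1 / (B - 1)))\<^sup>2)) = C * (gam A B ^ k)\<^sup>2"
    unfolding gam_kap C_def w_def by (simp only: power_mult_distrib) (simp only: algebra_simps)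
  have sc: "(\<Sum>n<N. (norm (Pc k c' (x n)) * y n)\<^sup>2) = w\<^sup>2 * (\<Sum>n<N. (norm (Pc k c (x n)) * y n)\<^sup>2)" for x y and N :: nat
    using w0 by (simp add: P norm_mult power_mult_distrib sum_distrib_left mult.assoc)
  have "c' k = 1" using w0 by (simp add: c'_def c(1) Hk_1 w_def[symmetric])
  moreover have "(\<Sum>n<N. (norm (Pc k c' (of_nat n)) * inverse A ^ n)\<^sup>2) \<le> C * (gam A B ^ k)\<^sup>2" for N
    unfolding sc Ck[symmetric] using c(2)[of N] by (intro mult_left_mono) (auto simp: inverse_eq_divide)
  moreover have "(\<Sum>n<N. (norm (Pc k c' (- of_nat n - 1)) * inverse B ^ Suc n)\<^sup>2) \<le> C * (gam A B ^ k)\<^sup>2" for N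
    unfolding sc Ck[symmetric] using c(3)[of N] by (intro mult_left_mono) auto
  ultimately show "\<exists>c. c k = 1 \<and> (\<forall>N. (\<Sum>n<N. (norm (Pc k c (of_nat n)) * inverse A ^ n)\<^sup>2) \<le> C * (gam A B ^ k)\<^sup>2)
     \<and> (\<forall>N. (\<Sum>n<N. (norm (Pc k c (- of_nat n - 1)) * inverse B ^ Suc n)\<^sup>2) \<le> C * (gam A B ^ k)\<^sup>2)"
    by blast
qed

end

section \<open>The capacity of the two disks\<close>

text \<open>A disk of Apollonius. With \<open>z = u / (1 + u)\<close>, the inverse of
  \<open>u = z / (1 - z)\<close>, the condition says \<open>|z| \<le> 1/A\<close>.\<close>

lemma in_disk1_iff:
  assumes "A > 1"
  shows "u \<in> disk1 A \<longleftrightarrow> A * norm u \<le> norm (1 + u)"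
proof -
  have A2: "A\<^sup>2 - 1 > 0" using assms by (simp add: one_less_power)
  define c where "c = 1 / (A\<^sup>2 - 1)"
  have r: "A / (A\<^sup>2 - 1) \<ge> 0" using A2 assms by simp
  have r2: "(A / (A\<^sup>2 - 1))\<^sup>2 = c + c\<^sup>2"
  proof -
    define m where "m = A\<^sup>2 - 1"
    have "m > 0" "A\<^sup>2 = m + 1" using A2 by (auto simp: m_def)
    then show ?thesis unfolding c_def m_def[symmetric] power_divide
      by (simp add: field_simps power2_eq_square)
  qed
  have c: "c > 0" "c * (A\<^sup>2 - 1) = 1" using A2 by (auto simp: c_def)
  have "u \<in> disk1 A \<longleftrightarrow> (norm (u - of_real c))\<^sup>2 \<le> (A / (A\<^sup>2 - 1))\<^sup>2"
    unfolding disk1_def c_def[symmetric] using r abs_le_square_iff[of "norm (u - of_real c)" "A / (A\<^sup>2 - 1)"]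
    by (simp add: dist_norm norm_minus_commute)
  also have "\<dots> \<longleftrightarrow> (Re u)\<^sup>2 + (Im u)\<^sup>2 - 2 * c * Re u \<le> c"
    unfolding r2 cmod_power2 by (auto simp: power2_eq_square algebra_simps)
  also have "\<dots> \<longleftrightarrow> (A\<^sup>2 - 1) * ((Re u)\<^sup>2 + (Im u)\<^sup>2 - 2 * c * Re u) \<le> (A\<^sup>2 - 1) * c"
    using A2 by simp
  also have "\<dots> \<longleftrightarrow> (A\<^sup>2 - 1) * ((Re u)\<^sup>2 + (Im u)\<^sup>2) - 2 * Re u * (c * (A\<^sup>2 - 1)) \<le> c * (A\<^sup>2 - 1)"
    by (simp add: algebra_simps)
  also have "\<dots> \<longleftrightarrow> (A * norm u)\<^sup>2 \<le> (norm (1 + u))\<^sup>2"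
    unfolding c(2) power_mult_distrib cmod_power2 by (auto simp: power2_eq_square algebra_simps)
  also have "\<dots> \<longleftrightarrow> A * norm u \<le> norm (1 + u)"
    using assms abs_le_square_iff[of "A * norm u" "norm (1 + u)"] by simp
  finally show ?thesis .
qed

text \<open>In the coordinate \<open>z = u / (1 + u)\<close> this is \<open>|z| \<ge> B\<close>,
  with \<open>u = -1\<close> corresponding to \<open>z\<close> at infinity.\<close>

lemma in_disk2_iff:
  assumes "B > 1"
  shows "u \<in> disk2 B \<longleftrightarrow> B * norm (1 + u) \<le> norm u"
proof -
  have B2: "B\<^sup>2 - 1 > 0" using assms by (simp add: one_less_power)
  define c where "c = B\<^sup>2 / (B\<^sup>2 - 1)"
  have cc: "B\<^sup>2 / (1 - B\<^sup>2) = - c" unfolding c_def by (metis minus_diff_eq minus_divide_right)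
  have r: "B / (B\<^sup>2 - 1) \<ge> 0" using B2 assms by simp
  have r2: "(B / (B\<^sup>2 - 1))\<^sup>2 = c\<^sup>2 - c"
  proof -
    define m where "m = B\<^sup>2 - 1"
    have "m > 0" "B\<^sup>2 = m + 1" using B2 by (auto simp: m_def)
    then show ?thesis unfolding c_def m_def[symmetric] power_divide
      by (simp add: field_simps power2_eq_square)
  qed
  have c: "c * (B\<^sup>2 - 1) = B\<^sup>2" using B2 by (auto simp: c_def)
  have "u \<in> disk2 B \<longleftrightarrow> (norm (u + of_real c))\<^sup>2 \<le> (B / (B\<^sup>2 - 1))\<^sup>2"
    unfolding disk2_def cc using r abs_le_square_iff[of "norm (u + of_real c)" "B / (B\<^sup>2 - 1)"]
    by (simp add: dist_norm norm_minus_commute[of "- _"])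
  also have "\<dots> \<longleftrightarrow> (Re u)\<^sup>2 + (Im u)\<^sup>2 + 2 * c * Re u \<le> - c"
    unfolding r2 cmod_power2 by (auto simp: power2_eq_square algebra_simps)
  also have "\<dots> \<longleftrightarrow> (B\<^sup>2 - 1) * ((Re u)\<^sup>2 + (Im u)\<^sup>2 + 2 * c * Re u) \<le> (B\<^sup>2 - 1) * (- c)"
    by (rule mult_le_cancel_left_pos[OF B2, symmetric])
  also have "\<dots> \<longleftrightarrow> (B\<^sup>2 - 1) * ((Re u)\<^sup>2 + (Im u)\<^sup>2) + 2 * Re u * (c * (B\<^sup>2 - 1)) \<le> - (c * (B\<^sup>2 - 1))"
    by (simp add: algebra_simps)
  also have "\<dots> \<longleftrightarrow> (B * norm (1 + u))\<^sup>2 \<le> (norm u)\<^sup>2"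
    unfolding c power_mult_distrib cmod_power2 by (auto simp: power2_eq_square algebra_simps)
  also have "\<dots> \<longleftrightarrow> B * norm (1 + u) \<le> norm u"
    using assms abs_le_square_iff[of "B * norm (1 + u)" "norm u"] by simp
  finally show ?thesis .
qed

lemma norm_suminf_geometric_le:
  fixes f :: "nat \<Rightarrow> complex"
  assumes f: "f sums S" and b: "\<And>n. norm (f n) \<le> M * \<rho> ^ n" and \<rho>: "0 \<le> \<rho>" "\<rho> < 1"
  shows "norm S \<le> M / (1 - \<rho>)"
proof -
  have g: "(\<lambda>n. M * \<rho> ^ n) sums (M * (1 / (1 - \<rho>)))"
    using \<rho> by (intro sums_mult geometric_sums) simp
  have sn: "summable (\<lambda>n. norm (f n))"
    by (rule summable_comparison_test'[OF sums_summable[OF g], of 0]) (use b in simp)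
  have "norm S = norm (suminf f)" using f by (simp add: sums_iff)
  also have "\<dots> \<le> (\<Sum>n. norm (f n))" by (rule summable_norm[OF sn])
  also have "\<dots> \<le> (\<Sum>n. M * \<rho> ^ n)" by (rule suminf_le[OF b sn sums_summable[OF g]])
  also have "\<dots> = M / (1 - \<rho>)" using g by (simp add: sums_iff)
  finally show ?thesis .
qed

lemma term_le_sqrt:
  fixes f :: "nat \<Rightarrow> real"
  assumes "\<And>N. (\<Sum>n<N. (f n)\<^sup>2) \<le> q"
  shows "f n \<le> sqrt q"
proof -
  have "(f n)\<^sup>2 \<le> (\<Sum>n<Suc n. (f n)\<^sup>2)" by (simp add: sum_nonneg)
  also have "\<dots> \<le> q" by (rule assms)
  finally show ?thesis by (rule real_le_rsqrt)
qed

text \<open>The square sum bounds each single value by \<open>sqrt q\<close> over its weight. On the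
  disks for the larger parameters the generating series is then dominated by a geometric series of
  ratio \<open>A / A'\<close> or \<open>B / B'\<close>; this is where strict inequality of the
  parameters enters.\<close>

lemma poly_bound_on_disks:
  assumes AB: "1 < A" "1 < B" "A < A'" "B < B'" and u: "u \<in> disk1 A' \<union> disk2 B'"
    and q1: "\<And>N. (\<Sum>n<N. (norm (Pc k c (of_nat n)) * inverse A ^ n)\<^sup>2) \<le> q"
    and q2: "\<And>N. (\<Sum>n<N. (norm (Pc k c (- of_nat n - 1)) * inverse B ^ Suc n)\<^sup>2) \<le> q"
  shows "norm (\<Sum>j\<le>k. c j * u ^ j) \<le> sqrt q * (2 / (1 - A / A') + 2 * B / (1 - B / B'))"
proof -
  have q0: "q \<ge> 0" using q1[of 0] by simp
  have pos: "0 < 1 - A / A'" "0 < 1 - B / B'" using AB by auto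
  consider "u \<in> disk1 A'" | "u \<in> disk2 B'" using u by blast
  then show ?thesis
  proof cases
    case 1
    then have le: "A' * norm u \<le> norm (1 + u)" using in_disk1_iff[of A' u] AB by simp
    have "1 + u \<noteq> 0"
    proof
      assume "1 + u = 0"
      then have "u = -1" by (simp add: add_eq_0_iff)
      then show False using le AB by simp
    qed
    define z where "z = u / (1 + u)"
    have z1: "1 - z = 1 / (1 + u)" "z / (1 - z) = u" using \<open>1 + u \<noteq> 0\<close> by (auto simp: z_def field_simps)
    have nz: "norm z \<le> 1 / A'" using le AB \<open>1 + u \<noteq> 0\<close> by (simp add: z_def norm_divide field_simps)
    have nz1: "norm z < 1" 
    proof -
      have "1 / A' < 1" using AB by simp
      then show ?thesis using nz by linarith
    qed
    have bnd: "norm (Pc k c (of_nat n) * z ^ n) \<le> sqrt q * (A / A') ^ n" for n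
    proof -
      have "norm (Pc k c (of_nat n)) * inverse A ^ n \<le> sqrt q" by (rule term_le_sqrt[OF q1])
      then have "norm (Pc k c (of_nat n)) \<le> sqrt q * A ^ n" using AB by (simp add: power_inverse field_simps)
      then have "norm (Pc k c (of_nat n) * z ^ n) \<le> (sqrt q * A ^ n) * (1 / A') ^ n"
        unfolding norm_mult norm_power using nz AB q0 by (intro mult_mono power_mono) auto
      then show ?thesis by (simp add: power_divide)
    qed
    have g: "norm (gfun k c z) \<le> sqrt q / (1 - A / A')"
      by (rule norm_suminf_geometric_le[OF Pc_sums[OF nz1] bnd]) (use AB in auto)
    have "(\<Sum>j\<le>k. c j * u ^ j) = (1 - z) * gfun k c z"
    proof -
      have "1 - z \<noteq> 0" using z1(1) \<open>1 + u \<noteq> 0\<close> by simp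
      have "c j * u ^ j = (1 - z) * (c j * (z ^ j / (1 - z) ^ Suc j))" for j
        unfolding z1(2)[symmetric] power_divide using \<open>1 - z \<noteq> 0\<close> by simp
      then show ?thesis unfolding gfun_def sum_distrib_left by simp
    qed
    then have "norm (\<Sum>j\<le>k. c j * u ^ j) = norm (1 - z) * norm (gfun k c z)" by (simp add: norm_mult)
    also have "\<dots> \<le> 2 * (sqrt q / (1 - A / A'))"
    proof (intro mult_mono g)
      show "norm (1 - z) \<le> 2" using norm_triangle_ineq4[of 1 z] nz1 by simp
    qed auto
    also have "\<dots> = sqrt q * (2 / (1 - A / A'))" by simp
    also have "\<dots> \<le> sqrt q * (2 / (1 - A / A') + 2 * B / (1 - B / B'))"
      using q0 pos AB by (intro mult_left_mono) auto
    finally show ?thesis .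
  next
    case 2
    then have le: "B' * norm (1 + u) \<le> norm u" using in_disk2_iff[of B' u] AB by simp
    have "u \<noteq> 0"
    proof
      assume "u = 0"
      then show False using le AB by simp
    qed
    \<comment> \<open>This is \<open>1 / z\<close>; it stays finite at \<open>u = -1\<close>, a
      point of the second disk.\<close>
    define y where "y = (1 + u) / u"
    have y1: "1 - y = - 1 / u" using \<open>u \<noteq> 0\<close> by (auto simp: y_def field_simps)
    have ny: "norm y \<le> 1 / B'" using le AB \<open>u \<noteq> 0\<close> by (simp add: y_def norm_divide field_simps)
    have ny1: "norm y < 1" 
    proof -
      have "1 / B' < 1" using AB by simp
      then show ?thesis using ny by linarith
    qed
    let ?S = "\<Sum>j\<le>k. c j * ((-1) ^ j / (1 - y) ^ Suc j)"
    have bnd: "norm (Pc k c (- of_nat n - 1) * y ^ n) \<le> (sqrt q * B) * (B / B') ^ n" for n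
    proof -
      have "norm (Pc k c (- of_nat n - 1)) * inverse B ^ Suc n \<le> sqrt q" by (rule term_le_sqrt[OF q2])
      then have "norm (Pc k c (- of_nat n - 1)) \<le> sqrt q * B ^ Suc n" using AB by (simp add: power_inverse field_simps)
      then have "norm (Pc k c (- of_nat n - 1) * y ^ n) \<le> (sqrt q * B ^ Suc n) * (1 / B') ^ n"
        unfolding norm_mult norm_power using ny AB q0 by (intro mult_mono power_mono) auto
      then show ?thesis by (simp add: power_divide algebra_simps)
    qed
    have g: "norm ?S \<le> (sqrt q * B) / (1 - B / B')"
      by (rule norm_suminf_geometric_le[OF Pc_neg_sums[OF ny1] bnd]) (use AB in auto)
    have "(\<Sum>j\<le>k. c j * u ^ j) = (1 - y) * ?S"
    proof -
      have "(-1) ^ j / (1 - y) ^ Suc j = - u * u ^ j" for j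
      proof -
        have "(-1) ^ j / (1 - y) ^ Suc j = (-1) ^ j * (- u) ^ Suc j"
          unfolding y1 power_divide using \<open>u \<noteq> 0\<close> by (simp add: power_minus' field_simps)
        also have "\<dots> = - u * ((-1) ^ j * (- u) ^ j)" by simp
        also have "(-1) ^ j * (- u) ^ j = u ^ j" by (simp only: power_mult_distrib[symmetric]) simp
        finally show ?thesis .
      qed
      then show ?thesis using \<open>u \<noteq> 0\<close> by (simp add: y1 sum_distrib_left)
    qed
    then have "norm (\<Sum>j\<le>k. c j * u ^ j) = norm (1 - y) * norm ?S" by (simp add: norm_mult)
    also have "\<dots> \<le> 2 * ((sqrt q * B) / (1 - B / B'))"
    proof (intro mult_mono g)
      show "norm (1 - y) \<le> 2" using norm_triangle_ineq4[of 1 y] ny1 by simp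
    qed auto
    also have "\<dots> = sqrt q * (2 * B / (1 - B / B'))" by simp
    also have "\<dots> \<le> sqrt q * (2 / (1 - A / A') + 2 * B / (1 - B / B'))"
      using q0 pos AB by (intro mult_left_mono) auto
    finally show ?thesis .
  qed
qed

text \<open>The same numbers \<open>c\<close> serve as Newton coefficients of a polynomial in
  \<open>n\<close> and as monomial coefficients in \<open>u\<close>, so leading coefficient
  \<open>1\<close> means monic.\<close>

lemma exists_monic_poly_bounded:
  assumes AB: "1 < A" "1 < B" "A < A'" "B < B'"
  obtains C where "C > 0"
    "\<And>k. \<exists>c::nat \<Rightarrow> complex. c k = 1 \<and> (\<forall>u\<in>disk1 A' \<union> disk2 B'. norm (\<Sum>j\<le>k. c j * u ^ j) \<le> C * gam A B ^ k)"
proof -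
  obtain C where C: "C > 0"
    "\<And>k. \<exists>c. c k = 1 \<and> (\<forall>N. (\<Sum>n<N. (norm (Pc k c (of_nat n)) * inverse A ^ n)\<^sup>2) \<le> C * (gam A B ^ k)\<^sup>2)
     \<and> (\<forall>N. (\<Sum>n<N. (norm (Pc k c (- of_nat n - 1)) * inverse B ^ Suc n)\<^sup>2) \<le> C * (gam A B ^ k)\<^sup>2)"
    using gam_upper_L2[OF AB(1,2)] by blast
  define K where "K = 2 / (1 - A / A') + 2 * B / (1 - B / B')"
  have K: "K > 0" using AB by (auto simp: K_def intro!: add_pos_pos divide_pos_pos)
  show ?thesis
  proof (rule that[of "sqrt C * K"])
    show "sqrt C * K > 0" using C(1) K by simp
    fix k
    from C(2)[of k] obtain c where c: "c k = 1"
      "\<And>N. (\<Sum>n<N. (norm (Pc k c (of_nat n)) * inverse A ^ n)\<^sup>2) \<le> C * (gam A B ^ k)\<^sup>2"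
      "\<And>N. (\<Sum>n<N. (norm (Pc k c (- of_nat n - 1)) * inverse B ^ Suc n)\<^sup>2) \<le> C * (gam A B ^ k)\<^sup>2" by blast
    have s: "sqrt (C * (gam A B ^ k)\<^sup>2) * K = sqrt C * K * gam A B ^ k"
      using gam_pos[of A B] by (simp add: real_sqrt_mult)
    show "\<exists>c::nat \<Rightarrow> complex. c k = 1 \<and> (\<forall>u\<in>disk1 A' \<union> disk2 B'. norm (\<Sum>j\<le>k. c j * u ^ j) \<le> sqrt C * K * gam A B ^ k)"
      using poly_bound_on_disks[OF AB _ c(2,3)] c(1) unfolding K_def[symmetric] s by blast
  qed
qed

section \<open>Vandermonde products and the lower bound for energies\<close>

lemma Lagrange_leading_coeff:
  fixes x :: "nat \<Rightarrow> complex" and c :: "nat \<Rightarrow> complex"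
  assumes I: "finite I" "card I = Suc n" and x: "inj_on x I"
  shows "(\<Sum>i\<in>I. (\<Sum>j\<le>n. c j * x i ^ j) / (\<Prod>j\<in>I - {i}. x i - x j)) = c n"
proof -
  define p where "p = (\<Sum>j\<le>n. monom (c j) j)"
  have pp: "poly p u = (\<Sum>j\<le>n. c j * u ^ j)" for u by (simp add: p_def poly_sum poly_monom)
  define l where "l i = (\<Prod>j\<in>I - {i}. [:- x j, 1:])" for i
  define q where "q = (\<Sum>i\<in>I. smult (poly p (x i) / (\<Prod>j\<in>I - {i}. x i - x j)) (l i))"
  have dl: "degree (l i) = n" if "i \<in> I" for i
    unfolding l_def using that I by (subst degree_prod_sum_eq) auto
  have ll: "coeff (l i) n = 1" if "i \<in> I" for i
  proof -
    have "lead_coeff (l i) = 1" unfolding l_def by (simp add: lead_coeff_prod)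
    then show ?thesis using dl[OF that] by simp
  qed
  have "p = q"
  proof (rule poly_eqI_degree[of "x ` I"])
    fix y assume "y \<in> x ` I"
    then obtain m where m: "m \<in> I" "y = x m" by auto
    have "poly q y = (\<Sum>i\<in>I. if i = m then poly p (x m) else 0)"
      unfolding q_def poly_sum
    proof (intro sum.cong refl)
      fix i assume i: "i \<in> I"
      show "poly (smult (poly p (x i) / (\<Prod>j\<in>I - {i}. x i - x j)) (l i)) y = (if i = m then poly p (x m) else 0)"
      proof (cases "i = m")
        case True
        have "(\<Prod>j\<in>I - {m}. x m - x j) \<noteq> 0"
          using I(1) x m(1) by (auto simp: inj_on_def)
        then show ?thesis using True m by (simp add: l_def poly_prod)
      next
        case False
        then have "poly (l i) y = 0" using I(1) m by (auto simp: l_def poly_prod)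
        then show ?thesis using False by simp
      qed
    qed
    also have "\<dots> = poly p (x m)" using I(1) m(1) by simp
    finally show "poly p y = poly q y" using m(2) by simp
  next
    have card: "card (x ` I) = Suc n" using I x by (simp add: card_image)
    have "degree p \<le> n" unfolding p_def by (intro degree_sum_le) (auto intro: order_trans[OF degree_monom_le])
    then show "degree p < card (x ` I)" using card by simp
    have "degree q \<le> n" unfolding q_def using I(1) dl by (intro degree_sum_le) auto
    then show "degree q < card (x ` I)" using card by simp
  qed
  have "c n = coeff p n" by (simp add: p_def coeff_sum)
  also have "\<dots> = coeff q n" by (simp only: \<open>p = q\<close>)
  also have "\<dots> = (\<Sum>i\<in>I. poly p (x i) / (\<Prod>j\<in>I - {i}. x i - x j) * coeff (l i) n)"
    by (simp add: q_def coeff_sum)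
  also have "\<dots> = (\<Sum>i\<in>I. poly p (x i) / (\<Prod>j\<in>I - {i}. x i - x j))"
    using ll by (intro sum.cong) auto
  finally show ?thesis by (simp add: pp)
qed

text \<open>
  By Lagrange interpolation, some point has a product of distances to the others bounded through
  the monic polynomial of the next degree. Removing it one step at a time avoids the usual
  expansion of a Vandermonde determinant in the monic basis.
\<close>

lemma Vandermonde_bound:
  fixes x :: "nat \<Rightarrow> complex" and M :: "nat \<Rightarrow> real"
  assumes E: "\<And>k. \<exists>c::nat \<Rightarrow> complex. c k = 1 \<and> (\<forall>u\<in>E. norm (\<Sum>j\<le>k. c j * u ^ j) \<le> M k)"
    and M: "\<And>k. M k > 0" and I: "finite I" and x: "inj_on x I" "x ` I \<subseteq> E"
  shows "(\<Prod>i\<in>I. \<Prod>j\<in>I - {i}. norm (x i - x j)) \<le> (\<Prod>m<card I. Suc m * M m)\<^sup>2"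
  using I x
proof (induction "card I" arbitrary: I)
  case 0
  then show ?case by simp
next
  case (Suc n)
  define P where "P i = (\<Prod>j\<in>I - {i}. norm (x i - x j))" for i
  have Ppos: "P i > 0" if "i \<in> I" for i
    unfolding P_def using that Suc.prems(2) by (intro prod_pos) (auto simp: inj_on_def)
  obtain c :: "nat \<Rightarrow> complex" where c: "c n = 1" "\<And>u. u \<in> E \<Longrightarrow> norm (\<Sum>j\<le>n. c j * u ^ j) \<le> M n"
    using E[of n] by blast
  \<comment> \<open>Otherwise each of the \<open>Suc n\<close> terms in the Lagrange formula for the
    leading coefficient \<open>1\<close> is smaller than \<open>1 / Suc n\<close>.\<close>
  have "\<exists>i\<in>I. P i \<le> Suc n * M n"
  proof (rule ccontr)
    assume "\<not> ?thesis"
    then have big: "P i > Suc n * M n" if "i \<in> I" for i using that by (auto simp: not_le)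
    have "1 = norm (\<Sum>i\<in>I. (\<Sum>j\<le>n. c j * x i ^ j) / (\<Prod>j\<in>I - {i}. x i - x j))"
      using Lagrange_leading_coeff[OF Suc.prems(1) Suc.hyps(2)[symmetric] Suc.prems(2), of c] c(1) by simp
    also have "\<dots> \<le> (\<Sum>i\<in>I. norm ((\<Sum>j\<le>n. c j * x i ^ j) / (\<Prod>j\<in>I - {i}. x i - x j)))"
      by (rule norm_sum)
    also have "\<dots> < (\<Sum>i\<in>I. 1 / Suc n)"
    proof (rule sum_strict_mono)
      fix i assume i: "i \<in> I"
      have "norm ((\<Sum>j\<le>n. c j * x i ^ j) / (\<Prod>j\<in>I - {i}. x i - x j)) = norm (\<Sum>j\<le>n. c j * x i ^ j) / P i"
        by (simp add: norm_divide P_def prod_norm)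
      also have "\<dots> \<le> M n / P i" using c(2)[of "x i"] Suc.prems(3) i Ppos[OF i] by (intro divide_right_mono) auto
      also have "\<dots> < 1 / Suc n"
        using big[OF i] Ppos[OF i] by (simp add: field_simps)
      finally show "norm ((\<Sum>j\<le>n. c j * x i ^ j) / (\<Prod>j\<in>I - {i}. x i - x j)) < 1 / Suc n" .
    qed (use Suc in auto)
    also have "\<dots> = 1" using Suc.hyps(2) by simp
    finally show False by simp
  qed
  then obtain i where i: "i \<in> I" "P i \<le> Suc n * M n" by blast
  define J where "J = I - {i}"
  have J: "finite J" "n = card J" "inj_on x J" "x ` J \<subseteq> E" "I = insert i J" "i \<notin> J"
    using Suc i by (auto simp: J_def inj_on_diff)
  \<comment> \<open>Ordered pairs are multiplied, so the removed point contributes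
    \<open>P i\<close> twice; hence the square in the bound.\<close>
  have "(\<Prod>k\<in>I. \<Prod>j\<in>I - {k}. norm (x k - x j)) = P i * (\<Prod>k\<in>J. \<Prod>j\<in>I - {k}. norm (x k - x j))"
    using J by (simp add: P_def)
  also have "(\<Prod>k\<in>J. \<Prod>j\<in>I - {k}. norm (x k - x j)) = (\<Prod>k\<in>J. norm (x k - x i) * (\<Prod>j\<in>J - {k}. norm (x k - x j)))"
  proof (intro prod.cong refl)
    fix k assume "k \<in> J"
    then have "I - {k} = insert i (J - {k})" using J by auto
    then show "(\<Prod>j\<in>I - {k}. norm (x k - x j)) = norm (x k - x i) * (\<Prod>j\<in>J - {k}. norm (x k - x j))"
      using J by simp
  qed
  also have "\<dots> = P i * (\<Prod>k\<in>J. \<Prod>j\<in>J - {k}. norm (x k - x j))"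
    unfolding prod.distrib P_def J_def[symmetric] by (simp add: norm_minus_commute)
  also have "P i * (P i * (\<Prod>k\<in>J. \<Prod>j\<in>J - {k}. norm (x k - x j)))
      \<le> (Suc n * M n) * ((Suc n * M n) * (\<Prod>m<n. Suc m * M m)\<^sup>2)"
    using Suc.hyps(1)[OF J(2) J(1,3,4)] i Ppos[OF i(1)] M[of n] unfolding J(2)[symmetric]
    by (intro mult_mono) (auto intro!: prod_nonneg mult_nonneg_nonneg simp: less_imp_le)
  also have "\<dots> = (\<Prod>m<card I. Suc m * M m)\<^sup>2"
    unfolding Suc.hyps(2)[symmetric] by (simp add: power2_eq_square)
  finally show ?case .
qed

text \<open>
  The constant \<open>D\<close> bounds the diameter of the set under consideration: rescaling makes the
  logarithmic kernel nonnegative, so that energies become \<open>nn_integral\<close>s. Outside that range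
  \<open>ennreal\<close> truncates negative values to \<open>0\<close>.
\<close>

definition ker :: "real \<Rightarrow> complex \<Rightarrow> complex \<Rightarrow> ennreal" where
  "ker D z w = (if norm (z - w) = 0 then \<infinity> else ennreal (ln (D / norm (z - w))))"

lemma ker_commute: "ker D z w = ker D w z"
  by (simp add: ker_def norm_minus_commute)

lemma measurable_ker[measurable (raw)]:
  assumes [measurable]: "f \<in> borel_measurable M" "g \<in> borel_measurable M"
  shows "(\<lambda>x. ker D (f x) (g x)) \<in> borel_measurable M"
  unfolding ker_def by measurable

lemma e2ennreal_log_kernel:
  "e2ennreal (log_kernel z w) = (if norm (z - w) = 0 then \<infinity> else ennreal (ln (1 / norm (z - w))))"
  "e2ennreal (- log_kernel z w) = (if norm (z - w) = 0 then 0 else ennreal (- ln (1 / norm (z - w))))"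
  by (auto simp: log_kernel_def e2ennreal_neg simp flip: ennreal.rep_eq) 

text \<open>The identity \<open>ker D = log_kernel + ln D\<close>, with the negative part of the
  kernel moved to the left because subtraction in \<open>ennreal\<close> truncates. On the diagonal
  both sides are infinite.\<close>

lemma ker_log_kernel:
  assumes "norm (z - w) \<le> D" "D \<ge> 1"
  shows "ker D z w + e2ennreal (- log_kernel z w) = e2ennreal (log_kernel z w) + ennreal (ln D)"
    and "e2ennreal (- log_kernel z w) \<le> ennreal (ln D)"
proof -
  have "ker D z w + e2ennreal (- log_kernel z w) = e2ennreal (log_kernel z w) + ennreal (ln D) \<and>
    e2ennreal (- log_kernel z w) \<le> ennreal (ln D)"
  proof (cases "norm (z - w) = 0")
    case True
    then show ?thesis by (simp add: ker_def e2ennreal_log_kernel)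
  next
    case False
    define v where "v = ln (1 / norm (z - w))"
    have n0: "norm (z - w) > 0" using False by simp
    have lnD: "ln D \<ge> 0" using assms by simp
    have e: "ln (D / norm (z - w)) = ln D + v"
      using n0 assms by (simp add: v_def ln_divide_pos ln_inverse divide_inverse ln_mult)
    have "0 \<le> ln (D / norm (z - w))" using assms(1) n0 by (intro ln_ge_zero) simp
    then have nn: "0 \<le> ln D + v" using e by simp
    show ?thesis
    proof (cases "v \<ge> 0")
      case True
      then have "ennreal (- v) = 0" by (simp add: ennreal_neg)
      then show ?thesis using False True lnD
        by (simp add: ker_def e2ennreal_log_kernel e v_def[symmetric] ennreal_plus add.commute)
    next
      case F: False
      then have "ennreal v = 0" by (simp add: ennreal_neg)
      moreover have "ennreal (ln D + v) + ennreal (- v) = ennreal (ln D)"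
        using F nn by (simp add: ennreal_plus[symmetric] del: ennreal_plus)
      moreover have "ennreal (- v) \<le> ennreal (ln D)" using nn by (intro ennreal_leI) simp
      ultimately show ?thesis using False
        by (simp add: ker_def e2ennreal_log_kernel e v_def[symmetric])
    qed
  qed
  then show "ker D z w + e2ennreal (- log_kernel z w) = e2ennreal (log_kernel z w) + ennreal (ln D)"
    and "e2ennreal (- log_kernel z w) \<le> ennreal (ln D)" by auto
qed

text \<open>The integral \<open>N\<close> of the negative part is at most \<open>ln D\<close>, hence
  finite, and can be cancelled in \<open>K + N = P + ln D\<close> after passing to
  \<open>ereal\<close>; \<open>K\<close> and \<open>P\<close> may be infinite together.\<close>

lemma log_energy_eq_ker:
  assumes \<nu>: "\<nu> \<in> prob_measures_on E" and E: "closed E" and D: "D \<ge> 1"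
    and diam: "\<And>z w. z \<in> E \<Longrightarrow> w \<in> E \<Longrightarrow> norm (z - w) \<le> D"
  shows "log_energy \<nu> = enn2ereal (\<integral>\<^sup>+ p. ker D (fst p) (snd p) \<partial>(\<nu> \<Otimes>\<^sub>M \<nu>)) - ereal (ln D)"
proof -
  have sets[measurable_cong]: "sets \<nu> = sets borel" and prob: "prob_space \<nu>" and AE: "AE z in \<nu>. z \<in> E"
    using \<nu> by (auto simp: prob_measures_on_def)
  interpret prob_space \<nu> by (rule prob)
  interpret P: pair_prob_space \<nu> \<nu> by standard
  have [measurable]: "E \<in> sets borel" using E by simp
  have AE2: "AE p in \<nu> \<Otimes>\<^sub>M \<nu>. fst p \<in> E \<and> snd p \<in> E"
  proof (rule P.AE_pair_measure)
    show "{x \<in> space (\<nu> \<Otimes>\<^sub>M \<nu>). fst x \<in> E \<and> snd x \<in> E} \<in> sets (\<nu> \<Otimes>\<^sub>M \<nu>)" by measurable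
    show "AE x in \<nu>. AE y in \<nu>. fst (x, y) \<in> E \<and> snd (x, y) \<in> E" using AE by auto
  qed
  define K where "K = (\<integral>\<^sup>+ p. ker D (fst p) (snd p) \<partial>(\<nu> \<Otimes>\<^sub>M \<nu>))"
  define P where "P = (\<integral>\<^sup>+ p. e2ennreal (log_kernel (fst p) (snd p)) \<partial>(\<nu> \<Otimes>\<^sub>M \<nu>))"
  define N where "N = (\<integral>\<^sup>+ p. e2ennreal (- log_kernel (fst p) (snd p)) \<partial>(\<nu> \<Otimes>\<^sub>M \<nu>))"
  have mP[measurable]: "(\<lambda>p. e2ennreal (log_kernel (fst p) (snd p))) \<in> borel_measurable (\<nu> \<Otimes>\<^sub>M \<nu>)"
    unfolding e2ennreal_log_kernel by measurable
  have mN[measurable]: "(\<lambda>p. e2ennreal (- log_kernel (fst p) (snd p))) \<in> borel_measurable (\<nu> \<Otimes>\<^sub>M \<nu>)"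
    unfolding e2ennreal_log_kernel by measurable
  have "K + N = (\<integral>\<^sup>+ p. ker D (fst p) (snd p) + e2ennreal (- log_kernel (fst p) (snd p)) \<partial>(\<nu> \<Otimes>\<^sub>M \<nu>))"
    unfolding K_def N_def by (rule nn_integral_add[symmetric]) measurable
  also have "\<dots> = (\<integral>\<^sup>+ p. e2ennreal (log_kernel (fst p) (snd p)) + ennreal (ln D) \<partial>(\<nu> \<Otimes>\<^sub>M \<nu>))"
  proof (rule nn_integral_cong_AE)
    show "AE p in \<nu> \<Otimes>\<^sub>M \<nu>. ker D (fst p) (snd p) + e2ennreal (- log_kernel (fst p) (snd p))
        = e2ennreal (log_kernel (fst p) (snd p)) + ennreal (ln D)"
      using AE2 by eventually_elim (intro ker_log_kernel(1) diam D; simp)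
  qed
  also have "\<dots> = P + ennreal (ln D)"
    unfolding P_def by (subst nn_integral_add) (auto simp: P.emeasure_space_1)
  finally have KN: "K + N = P + ennreal (ln D)" .
  have "N \<le> (\<integral>\<^sup>+ p. ennreal (ln D) \<partial>(\<nu> \<Otimes>\<^sub>M \<nu>))"
    unfolding N_def
  proof (rule nn_integral_mono_AE)
    show "AE p in \<nu> \<Otimes>\<^sub>M \<nu>. e2ennreal (- log_kernel (fst p) (snd p)) \<le> ennreal (ln D)"
      using AE2 by eventually_elim (intro ker_log_kernel(2) diam D; simp)
  qed
  then have "N \<le> ennreal (ln D)" by (simp add: P.emeasure_space_1)
  then have "N < \<infinity>" using le_less_trans ennreal_less_top by fastforce
  then obtain m where m: "N = ennreal m" "m \<ge> 0" by (cases N) auto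
  have lnD: "ln D \<ge> 0" using D by simp
  have "enn2ereal P - enn2ereal N = enn2ereal K - ereal (ln D)"
  proof (cases P)
    case (real p)
    then have "K < \<infinity>" using KN lnD by (cases K) (auto simp: ennreal_plus[symmetric] simp del: ennreal_plus)
    then obtain k where k: "K = ennreal k" "k \<ge> 0" by (cases K) auto
    then have "ennreal (k + m) = ennreal (p + ln D)" using KN real m lnD by simp
    then have "k + m = p + ln D" by (subst (asm) ennreal_inj) (use k m real lnD in auto)
    then show ?thesis using k m real by (simp add: enn2ereal_ennreal)
  next
    case top
    then have "K = \<infinity>" using KN m by (cases K) auto
    then show ?thesis using top m by (simp add: enn2ereal_ennreal)
  qed
  then show ?thesis unfolding log_energy_def K_def P_def N_def .
qed

lemma sum_real_lessThan: "(\<Sum>m<n. real m) = real n * (real n - 1) / 2"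
  by (induction n) (auto simp: field_simps)

lemma nn_integral_PiM_pair:
  assumes "prob_space \<nu>" and ij: "i < n" "j < (n::nat)" "i \<noteq> j"
    and f: "(\<lambda>p. f (fst p) (snd p)) \<in> borel_measurable (\<nu> \<Otimes>\<^sub>M \<nu>)"
  shows "(\<integral>\<^sup>+ x. f (x i) (x j) \<partial>(\<Pi>\<^sub>M i\<in>{..<n}. \<nu>)) = (\<integral>\<^sup>+ p. f (fst p) (snd p) \<partial>(\<nu> \<Otimes>\<^sub>M \<nu>))"
proof -
  interpret prob_space \<nu> by fact
  interpret product_prob_space "\<lambda>_::nat. \<nu>" UNIV by standard
  have f': "case_prod f \<in> borel_measurable (\<nu> \<Otimes>\<^sub>M \<nu>)" using f by (simp add: case_prod_beta')
  have m: "(\<lambda>x. f (x i) (x j)) \<in> borel_measurable (\<Pi>\<^sub>M k\<in>{i, j}. \<nu>)"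
  proof -
    have "(\<lambda>x. (x i, x j)) \<in> measurable (\<Pi>\<^sub>M k\<in>{i, j}. \<nu>) (\<nu> \<Otimes>\<^sub>M \<nu>)" by measurable
    from measurable_compose[OF this f] show ?thesis by simp
  qed
  have "(\<integral>\<^sup>+ x. f (x i) (x j) \<partial>(\<Pi>\<^sub>M k\<in>{i, j}. \<nu>)) = (\<integral>\<^sup>+ x. f (x i) (x j) \<partial>(\<Pi>\<^sub>M i\<in>{..<n}. \<nu>))"
    using ij by (subst distr_restrict[of "{i, j}" "{..<n}"]) (auto simp: nn_integral_distr m measurable_restrict_subset)
  moreover have "(\<integral>\<^sup>+ x. f (x i) (x j) \<partial>(\<Pi>\<^sub>M k\<in>{i, j}. \<nu>)) = (\<integral>\<^sup>+ p. f (fst p) (snd p) \<partial>(\<nu> \<Otimes>\<^sub>M \<nu>))"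
    using product_nn_integral_pair[OF f' ij(3)] by simp
  ultimately show ?thesis by simp
qed

text \<open>The Vandermonde bound is integrated over \<open>n\<close> independent points with law
  \<open>\<nu>\<close>. Each ordered pair of distinct indices contributes the integral
  \<open>K\<close>, so division by \<open>n * (n - 1)\<close> and
  \<open>n \<rightarrow> \<infinity>\<close> give the bound for \<open>\<nu>\<close> itself, without
  any discretization.\<close>

lemma log_energy_ge:
  assumes \<nu>: "\<nu> \<in> prob_measures_on E" and E: "closed E" "bounded E"
    and M: "\<And>k. \<exists>c::nat \<Rightarrow> complex. c k = 1 \<and> (\<forall>u\<in>E. norm (\<Sum>j\<le>k. c j * u ^ j) \<le> C * \<gamma> ^ k)"
    and C: "C > 0" and \<gamma>: "\<gamma> > 0"
  shows "log_energy \<nu> \<ge> ereal (- ln \<gamma>)"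
proof -
  have sets[measurable_cong]: "sets \<nu> = sets borel" and prob: "prob_space \<nu>" and AE: "AE z in \<nu>. z \<in> E"
    using \<nu> by (auto simp: prob_measures_on_def)
  obtain D0 where D0: "\<And>z. z \<in> E \<Longrightarrow> norm z \<le> D0" using E(2) by (auto simp: bounded_iff)
  define D where "D = max 1 (2 * D0)"
  have D: "D \<ge> 1" by (simp add: D_def)
  have diam: "norm (z - w) \<le> D" if "z \<in> E" "w \<in> E" for z w
    using norm_triangle_ineq4[of z w] D0[OF that(1)] D0[OF that(2)] by (simp add: D_def)
  define K where "K = (\<integral>\<^sup>+ p. ker D (fst p) (snd p) \<partial>(\<nu> \<Otimes>\<^sub>M \<nu>))"
  \<comment> \<open>The pointwise lower bound for the sum of \<open>ker\<close> over ordered pairs: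
    one \<open>ln D\<close> per pair, minus the logarithm of the Vandermonde bound. Tuples with
    coinciding points have an infinite sum.\<close>
  define S where "S n = real n * (real n - 1) * ln D - 2 * (\<Sum>m<n. ln (Suc m * (C * \<gamma> ^ m)))" for n
  have tuple: "ennreal (S n) \<le> (\<Sum>i<n. \<Sum>j\<in>{..<n} - {i}. ker D (w i) (w j))" if w: "\<And>i. i < n \<Longrightarrow> w i \<in> E" for n w
  proof (cases "inj_on w {..<n}")
    case False
    then obtain i j where ij: "i < n" "j < n" "i \<noteq> j" "w i = w j" by (auto simp: inj_on_def)
    have "\<infinity> = ker D (w i) (w j)" using ij by (simp add: ker_def)
    also have "\<dots> \<le> (\<Sum>j\<in>{..<n} - {i}. ker D (w i) (w j))" using ij by (intro member_le_sum) auto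
    also have "\<dots> \<le> (\<Sum>i<n. \<Sum>j\<in>{..<n} - {i}. ker D (w i) (w j))"
      using ij by (intro member_le_sum[where f="\<lambda>i. \<Sum>j\<in>{..<n} - {i}. ker D (w i) (w j)"]) auto
    finally have "\<infinity> \<le> (\<Sum>i<n. \<Sum>j\<in>{..<n} - {i}. ker D (w i) (w j))" .
    then show ?thesis by (rule order_trans[rotated]) simp
  next
    case True
    have pos: "norm (w i - w j) > 0" if "i < n" "j \<in> {..<n} - {i}" for i j
      using True that by (auto simp: inj_on_def)
    have pp: "0 < (\<Prod>i<n. \<Prod>j\<in>{..<n} - {i}. norm (w i - w j))"
      by (intro prod_pos ballI pos) auto
    have "(\<Prod>i<n. \<Prod>j\<in>{..<n} - {i}. norm (w i - w j)) \<le> (\<Prod>m<card {..<n}. Suc m * (C * \<gamma> ^ m))\<^sup>2"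
      by (rule Vandermonde_bound[OF M]) (use C \<gamma> True w in auto)
    then have Vb: "(\<Prod>i<n. \<Prod>j\<in>{..<n} - {i}. norm (w i - w j)) \<le> (\<Prod>m<n. Suc m * (C * \<gamma> ^ m))\<^sup>2"
      by simp
    have "ln (\<Prod>i<n. \<Prod>j\<in>{..<n} - {i}. norm (w i - w j)) \<le> ln ((\<Prod>m<n. Suc m * (C * \<gamma> ^ m))\<^sup>2)"
      by (rule iffD2[OF ln_le_cancel_iff[OF pp less_le_trans[OF pp Vb]] Vb])
    also have "\<dots> = 2 * (\<Sum>m<n. ln (Suc m * (C * \<gamma> ^ m)))"
    proof -
      have "ln (\<Prod>m<n. Suc m * (C * \<gamma> ^ m)) = (\<Sum>m<n. ln (Suc m * (C * \<gamma> ^ m)))"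
        by (rule ln_prod) (use C \<gamma> in auto)
      then show ?thesis by (simp add: ln_realpow del: of_nat_Suc)
    qed
    also have "ln (\<Prod>i<n. \<Prod>j\<in>{..<n} - {i}. norm (w i - w j)) = (\<Sum>i<n. \<Sum>j\<in>{..<n} - {i}. ln (norm (w i - w j)))"
    proof -
      have Q: "0 < (\<Prod>j\<in>{..<n} - {i}. norm (w i - w j))" if "i < n" for i
        using that by (intro prod_pos ballI pos) auto
      have "ln (\<Prod>i<n. \<Prod>j\<in>{..<n} - {i}. norm (w i - w j)) = (\<Sum>i<n. ln (\<Prod>j\<in>{..<n} - {i}. norm (w i - w j)))"
        by (rule ln_prod, simp, rule less_imp_neq[OF Q, THEN not_sym], simp)
      also have "\<dots> = (\<Sum>i<n. \<Sum>j\<in>{..<n} - {i}. ln (norm (w i - w j)))"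
        by (intro sum.cong refl ln_prod) (use pos in force)+
      finally show ?thesis .
    qed
    finally have V: "(\<Sum>i<n. \<Sum>j\<in>{..<n} - {i}. ln (norm (w i - w j))) \<le> 2 * (\<Sum>m<n. ln (Suc m * (C * \<gamma> ^ m)))" .
    have "(\<Sum>i<n. \<Sum>j\<in>{..<n} - {i}. ker D (w i) (w j)) = (\<Sum>i<n. \<Sum>j\<in>{..<n} - {i}. ennreal (ln D - ln (norm (w i - w j))))"
    proof (intro sum.cong refl)
      fix i j assume "i \<in> {..<n}" "j \<in> {..<n} - {i}"
      then show "ker D (w i) (w j) = ennreal (ln D - ln (norm (w i - w j)))"
        using pos[of i j] D by (simp add: ker_def ln_divide_pos)
    qed
    also have "\<dots> = ennreal (\<Sum>i<n. \<Sum>j\<in>{..<n} - {i}. (ln D - ln (norm (w i - w j))))"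
    proof -
      have nn: "0 \<le> ln D - ln (norm (w i - w j))" if "i < n" "j \<in> {..<n} - {i}" for i j
        using pos[OF that] diam[of "w i" "w j"] w that D by (simp add: ln_le_cancel_iff)
      have "(\<Sum>j\<in>{..<n} - {i}. ennreal (ln D - ln (norm (w i - w j)))) = ennreal (\<Sum>j\<in>{..<n} - {i}. (ln D - ln (norm (w i - w j))))" if "i < n" for i
        using nn that by (intro sum_ennreal) auto
      then have "(\<Sum>i<n. \<Sum>j\<in>{..<n} - {i}. ennreal (ln D - ln (norm (w i - w j)))) = (\<Sum>i<n. ennreal (\<Sum>j\<in>{..<n} - {i}. (ln D - ln (norm (w i - w j)))))"
        by simp
      also have "\<dots> = ennreal (\<Sum>i<n. \<Sum>j\<in>{..<n} - {i}. (ln D - ln (norm (w i - w j))))"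
        using nn by (intro sum_ennreal sum_nonneg) auto
      finally show ?thesis .
    qed
    also have "(\<Sum>i<n. \<Sum>j\<in>{..<n} - {i}. (ln D - ln (norm (w i - w j))))
       = real n * (real n - 1) * ln D - (\<Sum>i<n. \<Sum>j\<in>{..<n} - {i}. ln (norm (w i - w j)))"
    proof -
      have "(\<Sum>j\<in>{..<n} - {i}. (ln D - ln (norm (w i - w j)))) = (real n - 1) * ln D - (\<Sum>j\<in>{..<n} - {i}. ln (norm (w i - w j)))" if "i < n" for i
        using that by (simp add: sum_subtractf of_nat_diff)
      then show ?thesis by (simp add: sum_subtractf)
    qed
    finally have e: "(\<Sum>i<n. \<Sum>j\<in>{..<n} - {i}. ker D (w i) (w j))
      = ennreal (real n * (real n - 1) * ln D - (\<Sum>i<n. \<Sum>j\<in>{..<n} - {i}. ln (norm (w i - w j))))" .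
    show ?thesis unfolding e S_def using V by (intro ennreal_leI) simp
  qed
  have mK[measurable]: "(\<lambda>p. ker D (fst p) (snd p)) \<in> borel_measurable (\<nu> \<Otimes>\<^sub>M \<nu>)" by measurable
  have int: "ennreal (S n) \<le> of_nat (n * (n - 1)) * K" for n
  proof -
    interpret prob_space \<nu> by (rule prob)
    have PS: "prob_space (\<Pi>\<^sub>M i\<in>{..<n}. \<nu>)" by (rule prob_space_PiM) (rule prob)
    have AEw: "AE w in \<Pi>\<^sub>M i\<in>{..<n}. \<nu>. \<forall>i\<in>{..<n}. w i \<in> E"
      by (intro AE_finite_allI AE_PiM_component prob AE) auto
    have mK': "(\<lambda>w. ker D (w i) (w j)) \<in> borel_measurable (\<Pi>\<^sub>M i\<in>{..<n}. \<nu>)" if "i < n" "j < n" for i j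
    proof -
      have "(\<lambda>w. w k) \<in> borel_measurable (\<Pi>\<^sub>M i\<in>{..<n}. \<nu>)" if "k < n" for k
        using measurable_component_singleton[of k "{..<n}" "\<lambda>_. \<nu>"] that
        by (simp add: measurable_cong_sets[OF refl sets])
      then show ?thesis using that by (intro measurable_ker)
    qed
    have "ennreal (S n) = (\<integral>\<^sup>+ w. ennreal (S n) \<partial>(\<Pi>\<^sub>M i\<in>{..<n}. \<nu>))" by (simp add: prob_space.emeasure_space_1[OF PS])
    also have "\<dots> \<le> (\<integral>\<^sup>+ w. (\<Sum>i<n. \<Sum>j\<in>{..<n} - {i}. ker D (w i) (w j)) \<partial>(\<Pi>\<^sub>M i\<in>{..<n}. \<nu>))"
      using AEw by (intro nn_integral_mono_AE) (auto elim!: eventually_mono intro!: tuple)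
    also have "\<dots> = (\<Sum>i<n. \<Sum>j\<in>{..<n} - {i}. \<integral>\<^sup>+ w. ker D (w i) (w j) \<partial>(\<Pi>\<^sub>M i\<in>{..<n}. \<nu>))"
      by (subst nn_integral_sum) (auto intro!: borel_measurable_sum mK' sum.cong nn_integral_sum)
    also have "\<dots> = (\<Sum>i<n. \<Sum>j\<in>{..<n} - {i}. K)"
      unfolding K_def by (intro sum.cong refl nn_integral_PiM_pair prob mK) auto
    also have "\<dots> = of_nat (n * (n - 1)) * K"
    proof -
      have "(\<Sum>j\<in>{..<n} - {i}. K) = of_nat (n - 1) * K" if "i \<in> {..<n}" for i using that by simp
      then have "(\<Sum>i<n. \<Sum>j\<in>{..<n} - {i}. K) = (\<Sum>i<n. of_nat (n - 1) * K)" by simp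
      then show ?thesis by (simp add: mult.assoc)
    qed
    finally show ?thesis .
  qed
  have "ennreal (ln D - ln \<gamma>) \<le> K"
  proof (cases K)
    case (real k)
    \<comment> \<open>The factors \<open>Suc m\<close> and \<open>C\<close> of the Vandermonde bound
      cost \<open>O(n ln n)\<close> in total, which vanishes against the \<open>n * (n - 1)\<close>
      pairs.\<close>
    define L where "L n = ln D - ln \<gamma> - 2 * (real n * ln (real n) + real n * \<bar>ln C\<bar>) / (real n * (real n - 1))" for n
    have "L n \<le> k" if n: "n \<ge> 2" for n
    proof -
      have nn1: "real (n * (n - 1)) = real n * (real n - 1)" using n by (simp add: of_nat_diff)
      have "ennreal (real (n * (n - 1)) * k) = ennreal (real (n * (n - 1))) * ennreal k"
        by (rule ennreal_mult) (use real in auto)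
      then have "ennreal (S n) \<le> ennreal (real (n * (n - 1)) * k)"
        using int[of n] unfolding real(2) ennreal_of_nat_eq_real_of_nat by simp
      then have "S n \<le> real n * (real n - 1) * k"
        unfolding nn1 by (subst (asm) ennreal_le_iff) (use real n in auto)
      moreover have "(\<Sum>m<n. ln (Suc m * (C * \<gamma> ^ m))) \<le> (\<Sum>m<n. ln n + \<bar>ln C\<bar> + m * ln \<gamma>)"
      proof (rule sum_mono)
        fix m assume m: "m \<in> {..<n}"
        have "ln (Suc m * (C * \<gamma> ^ m)) = ln (Suc m) + (ln C + m * ln \<gamma>)"
          using C \<gamma> by (simp add: ln_mult ln_realpow del: of_nat_Suc)
        moreover have "ln (Suc m) \<le> ln (real n)" using m by (subst ln_le_cancel_iff) auto
        ultimately show "ln (Suc m * (C * \<gamma> ^ m)) \<le> ln n + \<bar>ln C\<bar> + m * ln \<gamma>" by linarith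
      qed
      moreover have "(\<Sum>m<n. ln n + \<bar>ln C\<bar> + m * ln \<gamma>) = n * ln n + n * \<bar>ln C\<bar> + real n * (real n - 1) / 2 * ln \<gamma>"
        by (simp add: sum.distrib sum_distrib_right[symmetric] sum_real_lessThan distrib_left)
      ultimately have "real n * (real n - 1) * ln D - 2 * (n * ln n + n * \<bar>ln C\<bar> + real n * (real n - 1) / 2 * ln \<gamma>) \<le> real n * (real n - 1) * k"
      proof -
        assume a: "S n \<le> real n * (real n - 1) * k" and b: "(\<Sum>m<n. ln (Suc m * (C * \<gamma> ^ m))) \<le> (\<Sum>m<n. ln n + \<bar>ln C\<bar> + m * ln \<gamma>)"
          and c: "(\<Sum>m<n. ln n + \<bar>ln C\<bar> + m * ln \<gamma>) = n * ln n + n * \<bar>ln C\<bar> + real n * (real n - 1) / 2 * ln \<gamma>"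
        have "real n * (real n - 1) * ln D - 2 * (n * ln n + n * \<bar>ln C\<bar> + real n * (real n - 1) / 2 * ln \<gamma>) \<le> S n"
          unfolding S_def using b[unfolded c] by (intro diff_left_mono mult_left_mono) auto
        then show ?thesis using a by (rule order_trans)
      qed
      moreover have "real n * (real n - 1) * L n = real n * (real n - 1) * ln D - 2 * (n * ln n + n * \<bar>ln C\<bar> + real n * (real n - 1) / 2 * ln \<gamma>)"
        using n by (simp add: L_def right_diff_distrib)
      ultimately have "real n * (real n - 1) * L n \<le> real n * (real n - 1) * k" by simp
      moreover have "real n * (real n - 1) > 0" using n by simp
      ultimately show ?thesis by (simp only: mult_le_cancel_left_pos)
    qed
    moreover have "L \<longlonglongrightarrow> ln D - ln \<gamma>" unfolding L_def by real_asymp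
    ultimately have "ln D - ln \<gamma> \<le> k" by (intro LIMSEQ_le_const2) auto
    then show ?thesis using real by (simp add: ennreal_leI)
  qed simp
  then have "enn2ereal (ennreal (ln D - ln \<gamma>)) \<le> enn2ereal K" by (simp add: less_eq_ennreal.rep_eq)
  moreover have "ereal (ln D - ln \<gamma>) \<le> enn2ereal (ennreal (ln D - ln \<gamma>))"
    by (cases "0 \<le> ln D - ln \<gamma>") (auto simp: enn2ereal_ennreal ennreal_neg zero_ennreal.rep_eq)
  ultimately have "ereal (ln D - ln \<gamma>) \<le> enn2ereal K" by (rule order_trans[rotated])
  then have "ereal (ln D - ln \<gamma>) - ereal (ln D) \<le> enn2ereal K - ereal (ln D)"
    by (rule ereal_minus_mono) simp
  moreover have "log_energy \<nu> = enn2ereal K - ereal (ln D)"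
    unfolding K_def by (rule log_energy_eq_ker[OF \<nu> E(1) D diam])
  ultimately show ?thesis by simp
qed

section \<open>Circle means of the logarithmic kernel and smeared point masses\<close>

definition unif :: "real measure" where "unif = uniform_measure lborel {0..1}"

lemma sets_unif[measurable_cong, simp]: "sets unif = sets borel" by (simp add: unif_def)
lemma space_unif[simp]: "space unif = UNIV" by (simp add: unif_def)

lemma prob_space_unif: "prob_space unif"
  unfolding unif_def by (rule prob_space_uniform_measure) auto

lemma nn_integral_unif_has_integral:
  assumes h: "(h has_integral I) {0..1}" and m[measurable]: "h \<in> borel_measurable borel"
    and nn: "\<And>t. t \<in> {0..1} \<Longrightarrow> 0 \<le> h t"
  shows "(\<integral>\<^sup>+ t. ennreal (h t) \<partial>unif) = ennreal I"
proof -
  have "(\<integral>\<^sup>+ t. ennreal (h t) \<partial>unif) = (\<integral>\<^sup>+ t. ennreal (h t) * indicator {0..1} t \<partial>lborel)"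
    unfolding unif_def by (subst nn_integral_uniform_measure) (auto simp: divide_ennreal_def)
  also have "\<dots> = (\<integral>\<^sup>+ t. ennreal (h t * indicator {0..1} t) \<partial>lborel)"
    by (intro nn_integral_cong) (auto simp: indicator_def)
  also have "\<dots> = ennreal I"
  proof (rule nn_integral_has_integral_lborel)
    have "((\<lambda>t. if t \<in> {0..1} then h t else 0) has_integral I) UNIV"
      using h by (simp only: has_integral_restrict_UNIV)
    then show "((\<lambda>t. h t * indicator {0..1} t) has_integral I) UNIV"
      by (rule has_integral_eq[rotated]) (auto simp: indicator_def)
    show "0 \<le> h t * indicator {0..1} t" for t using nn by (auto simp: indicator_def)
  qed measurable
  finally show ?thesis .
qed

text \<open>The mean value property at \<open>0\<close> of \<open>Ln (1 - \<zeta> * z)\<close>,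
  holomorphic on the closed unit disk because \<open>1 - \<zeta> * z\<close> has positive real part
  there.\<close>

lemma mean_ln_circle:
  assumes "norm \<zeta> < 1"
  shows "((\<lambda>t. ln (norm (1 - \<zeta> * ee 1 t))) has_integral 0) {0..1}"
proof -
  have re: "Re (1 - \<zeta> * z) > 0" if "norm z \<le> 1" for z
  proof -
    have "Re (\<zeta> * z) \<le> norm (\<zeta> * z)" by (rule complex_Re_le_cmod)
    also have "\<dots> \<le> norm \<zeta> * 1" unfolding norm_mult using that by (intro mult_left_mono) auto
    finally show ?thesis using assms by simp
  qed
  define f where "f z = Ln (1 - \<zeta> * z)" for z
  have holo: "f holomorphic_on cball 0 1"
    unfolding f_def
  proof (intro holomorphic_intros)
    fix z :: complex assume "z \<in> cball 0 1"
    then have "Re (1 - \<zeta> * z) > 0" by (intro re) simp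
    then show "1 - \<zeta> * z \<notin> \<real>\<^sub>\<le>\<^sub>0" by (auto simp: complex_nonpos_Reals_iff)
  qed
  have "((\<lambda>u. f u / (u - 0)) has_contour_integral (2 * of_real pi * \<i> * f 0)) (circlepath 0 1)"
    by (rule Cauchy_integral_circlepath_simple[OF holo]) simp
  then have "contour_integral (circlepath 0 1) (\<lambda>z. f z * z powi (- 0 - 1)) = 0"
    by (intro contour_integral_unique) (simp add: f_def power_int_minus divide_inverse)
  then have "fc f 1 0 = 0" using fc_contour[of 1 f 0] by simp
  then have 0: "integral {0..1} (\<lambda>t. f (ee 1 t)) = 0" by (simp add: fc_def circlepath_ee)
  have cont: "continuous_on {0..1} (\<lambda>t. f (ee 1 t))"
    by (rule continuous_on_compose2[OF holomorphic_on_imp_continuous_on[OF holo]]) (auto intro!: continuous_intros)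
  have "((\<lambda>t. f (ee 1 t)) has_integral 0) {0..1}"
    using integrable_integral[OF integrable_continuous_real[OF cont]] 0 by simp
  from has_integral_linear[OF this bounded_linear_Re]
  have "((\<lambda>t. Re (f (ee 1 t))) has_integral 0) {0..1}" by (simp add: o_def)
  moreover have "Re (f (ee 1 t)) = ln (norm (1 - \<zeta> * ee 1 t))" for t
  proof -
    have "1 - \<zeta> * ee 1 t \<noteq> 0"
    proof
      assume "1 - \<zeta> * ee 1 t = 0"
      moreover have "Re (1 - \<zeta> * ee 1 t) > 0" by (rule re) simp
      ultimately show False by (simp only: zero_complex.sel less_irrefl)
    qed
    then show ?thesis by (simp add: f_def)
  qed
  ultimately show ?thesis by simp
qed

lemma borel_measurable_ee[measurable]: "ee n \<in> borel_measurable borel"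
  by (intro borel_measurable_continuous_onI continuous_on_ee)

lemma ker_translate: "ker D a (b + x) = ker D (a - b) x"
  by (simp add: ker_def algebra_simps)

text \<open>Superharmonicity of the kernel. Factoring out \<open>m = max (norm w) r\<close> leaves a
  logarithm with mean zero, so the circle mean is \<open>ln (D / m)\<close>. The size of
  \<open>D\<close> keeps the integrand nonnegative, so that \<open>ennreal\<close> does not truncate
  it.\<close>

lemma ker_mean_ne:
  assumes r: "0 < r" and D: "norm w + r \<le> D" and ne: "norm w \<noteq> r"
  shows "(\<integral>\<^sup>+ t. ker D w (of_real r * ee 1 t) \<partial>unif) \<le> ker D w 0"
proof (cases "w = 0")
  case True
  then show ?thesis by (simp add: ker_def)
next
  case False
  define m where "m = max (norm w) r"
  have m0: "m > 0" "norm w \<le> m" using r by (auto simp: m_def)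
  obtain \<zeta> where \<zeta>: "norm \<zeta> < 1" "\<And>t. norm (w - of_real r * ee 1 t) = m * norm (1 - \<zeta> * ee 1 t)"
  proof (cases "r < norm w")
    case True
    show ?thesis
    proof (rule that[of "of_real r / w"])
      show "norm (of_real r / w) < 1" 
      proof -
        have "norm w > 0" using True r by linarith
        then show ?thesis using True r by (simp add: norm_divide)
      qed
      fix t
      have "w - of_real r * ee 1 t = w * (1 - of_real r / w * ee 1 t)" using False by (simp add: field_simps)
      then show "norm (w - of_real r * ee 1 t) = m * norm (1 - of_real r / w * ee 1 t)"
        using True by (simp add: norm_mult m_def del: right_diff_distrib)
    qed
  next
    case F: False
    then have lt: "norm w < r" using ne by simp
    show ?thesis
    proof (rule that[of "cnj w / of_real r"])
      show "norm (cnj w / of_real r) < 1" using lt r by (simp add: norm_divide)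
      fix t
      have cc: "ee 1 t * cnj (ee 1 t) = 1" by (metis complex_norm_square norm_ee of_real_1 one_power2)
      \<comment> \<open>Inside the circle the roles are exchanged by conjugation, using that
        \<open>ee 1 t\<close> has modulus one.\<close>
      have "w - of_real r * ee 1 t = - of_real r * ee 1 t * cnj (1 - cnj w / of_real r * ee 1 t)"
        using r cc by (simp add: field_simps)
      then have "norm (w - of_real r * ee 1 t) = r * norm (1 - cnj w / of_real r * ee 1 t)"
        using r by (simp only: norm_mult complex_mod_cnj norm_ee) simp
      then show "norm (w - of_real r * ee 1 t) = m * norm (1 - cnj w / of_real r * ee 1 t)"
        using lt by (simp add: m_def)
    qed
  qed
  have pos: "norm (1 - \<zeta> * ee 1 t) > 0" for t
  proof -
    have "norm (\<zeta> * ee 1 t) < 1" using \<zeta>(1) by (simp add: norm_mult)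
    then have "1 \<noteq> \<zeta> * ee 1 t" by force
    then show ?thesis by simp
  qed
  have Dm: "D / m > 0" "D > 0" using m0 D r by (auto simp: m_def intro!: divide_pos_pos) (smt (verit) norm_ge_zero)+
  define h where "h t = ln (D / m) - ln (norm (1 - \<zeta> * ee 1 t))" for t
  have hk: "ker D w (of_real r * ee 1 t) = ennreal (h t)" for t
  proof -
    have "D / (m * norm (1 - \<zeta> * ee 1 t)) = (D / m) / norm (1 - \<zeta> * ee 1 t)" by simp
    then have "ln (D / norm (w - of_real r * ee 1 t)) = h t"
      unfolding \<zeta>(2) h_def using ln_divide_pos[OF Dm(1) pos] by simp
    then show ?thesis using pos[of t] m0 by (simp add: ker_def \<zeta>(2))
  qed
  have hn: "0 \<le> h t" for t
  proof -
    have "norm (w - of_real r * ee 1 t) \<le> norm w + r" using norm_triangle_ineq4[of w "of_real r * ee 1 t"] r by (simp add: norm_mult)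
    then have "m * norm (1 - \<zeta> * ee 1 t) \<le> D" using D \<zeta>(2) by simp
    then have "norm (1 - \<zeta> * ee 1 t) \<le> D / m" using m0 by (simp add: field_simps)
    then show ?thesis using pos[of t] Dm by (simp add: h_def)
  qed
  have hm: "h \<in> borel_measurable borel" unfolding h_def by measurable
  have "(h has_integral (ln (D / m) * (1 - 0) - 0)) {0..1}"
    unfolding h_def
    by (intro has_integral_diff mean_ln_circle \<zeta>(1)) (use has_integral_const_real[of "ln (D / m)" 0 1] in simp)
  then have "(\<integral>\<^sup>+ t. ennreal (h t) \<partial>unif) = ennreal (ln (D / m))"
    by (subst nn_integral_unif_has_integral[of h "ln (D / m)"]) (use hn hm in auto)
  also have "\<dots> \<le> ennreal (ln (D / norm w))"
    using m0 Dm False by (intro ennreal_leI) (auto intro!: divide_left_mono)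
  also have "\<dots> = ker D w 0" using False by (simp add: ker_def)
  finally show ?thesis unfolding hk .
qed

text \<open>Lower semicontinuity: continuity off the diagonal, and values tending to infinity on it.
  It supplies the integrand bound for Fatou's lemma in \<open>ker_mean\<close>.\<close>

lemma ker_liminf:
  assumes x: "x \<longlonglongrightarrow> l" and D: "D > 0"
  shows "ker D w l \<le> liminf (\<lambda>m. ker D w (x m))"
proof (cases "w = l")
  case True
  show ?thesis unfolding le_Liminf_iff
  proof (intro allI impI)
    fix y assume "y < ker D w l"
    then have "y < \<infinity>" using True by (simp add: ker_def)
    then obtain v where v: "y = ennreal v" "v \<ge> 0" by (cases y) auto
    have "eventually (\<lambda>m. dist (x m) l < D * exp (- (v + 1))) sequentially"
      using tendstoD[OF x, of "D * exp (- (v + 1))"] D by simp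
    then show "eventually (\<lambda>m. y < ker D w (x m)) sequentially"
    proof eventually_elim
      case (elim m)
      show "y < ker D w (x m)"
      proof (cases "norm (w - x m) = 0")
        case False
        then have p: "norm (w - x m) > 0" by simp
        have lt: "norm (w - x m) < D * exp (- (v + 1))" using elim True by (simp add: dist_norm norm_minus_commute)
        have "exp (v + 1) * norm (w - x m) < exp (v + 1) * (D * exp (- (v + 1)))" using lt by simp
        also have "\<dots> = D * (exp (v + 1) * exp (- (v + 1)))" by simp
        also have "\<dots> = D" by (simp only: exp_add[symmetric]) simp
        finally have "exp (v + 1) < D / norm (w - x m)" using p by (simp add: field_simps)
        moreover have "0 < D / norm (w - x m)" using p D by simp
        ultimately have "ln (exp (v + 1)) < ln (D / norm (w - x m))" by (subst ln_less_cancel_iff) auto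
        then have "v + 1 < ln (D / norm (w - x m))" by simp
        then show ?thesis using False v by (simp add: ker_def ennreal_less_iff)
      qed (use v in \<open>simp add: ker_def\<close>)
    qed
  qed
next
  case False
  have t: "(\<lambda>m. ennreal (ln (D / norm (w - x m)))) \<longlonglongrightarrow> ennreal (ln (D / norm (w - l)))"
    using False D by (intro tendsto_ennrealI tendsto_intros x) auto
  have "eventually (\<lambda>m. x m \<noteq> w) sequentially"
    using x False by (intro tendsto_imp_eventually_ne) auto
  then have "eventually (\<lambda>m. ker D w (x m) = ennreal (ln (D / norm (w - x m)))) sequentially"
    by eventually_elim (simp add: ker_def)
  then have "(\<lambda>m. ker D w (x m)) \<longlonglongrightarrow> ennreal (ln (D / norm (w - l)))"
    using t by (simp add: tendsto_cong)
  then have "liminf (\<lambda>m. ker D w (x m)) = ennreal (ln (D / norm (w - l)))"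
    by (intro lim_imp_Liminf) auto
  then show ?thesis using False by (simp add: ker_def)
qed

lemma ker_mean:
  assumes r: "0 < r" and D: "norm w + r \<le> D"
  shows "(\<integral>\<^sup>+ t. ker D w (of_real r * ee 1 t) \<partial>unif) \<le> ker D w 0"
proof (cases "norm w = r")
  case True
  \<comment> \<open>If \<open>w\<close> lies on the circle itself, the circle is approximated from
    inside. The offset \<open>m + 2\<close> keeps all radii positive.\<close>
  define \<rho> where "\<rho> m = r * (1 - 1 / real (Suc (Suc m)))" for m :: nat
  have \<rho>: "0 < \<rho> m" "\<rho> m < r" for m using r by (auto simp: \<rho>_def)
  have lim: "\<rho> \<longlonglongrightarrow> r"
  proof -
    have "(\<lambda>m. r * (1 - 1 / real (Suc (Suc m)))) \<longlonglongrightarrow> r" by real_asymp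
    then show ?thesis by (simp only: \<rho>_def[abs_def])
  qed
  have D0: "D > 0" using D r norm_ge_zero[of w] by linarith
  have "(\<integral>\<^sup>+ t. ker D w (of_real r * ee 1 t) \<partial>unif) \<le> (\<integral>\<^sup>+ t. liminf (\<lambda>m. ker D w (of_real (\<rho> m) * ee 1 t)) \<partial>unif)"
    by (intro nn_integral_mono ker_liminf D0 tendsto_intros lim)
  also have "\<dots> \<le> liminf (\<lambda>m. \<integral>\<^sup>+ t. ker D w (of_real (\<rho> m) * ee 1 t) \<partial>unif)"
    by (rule nn_integral_liminf) measurable
  also have "\<dots> \<le> liminf (\<lambda>m. ker D w 0)"
  proof (intro Liminf_mono always_eventually allI ker_mean_ne)
    fix m show "0 < \<rho> m" "norm w + \<rho> m \<le> D" "norm w \<noteq> \<rho> m" using \<rho>[of m] D True by auto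
  qed
  also have "\<dots> = ker D w 0" by (simp add: Liminf_const)
  finally show ?thesis .
qed (use ker_mean_ne assms in auto)

lemma ker_mean':
  assumes "0 < r" "norm (a - b) + r \<le> D"
  shows "(\<integral>\<^sup>+ t. ker D a (b + of_real r * ee 1 t) \<partial>unif) \<le> ker D a b"
proof -
  have "ker D a b = ker D (a - b) 0" using ker_translate[of D a b 0] by simp
  then show ?thesis using ker_mean[OF assms] by (simp only: ker_translate)
qed

text \<open>The law of \<open>z i + r * ee 1 t\<close> for independent uniform \<open>i < n\<close>
  and \<open>t\<close>. Point masses at the \<open>z i\<close> would have infinite energy; circles
  of a fixed radius make the diagonal terms finite.\<close>

definition smear :: "nat \<Rightarrow> (nat \<Rightarrow> complex) \<Rightarrow> real \<Rightarrow> complex measure" where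
  "smear n z r = distr (measure_pmf (pmf_of_set {..<n}) \<Otimes>\<^sub>M unif) borel (\<lambda>(i, t). z i + of_real r * ee 1 t)"

lemma prob_space_smear: "prob_space (smear n z r)"
proof -
  interpret U: prob_space unif by (rule prob_space_unif)
  interpret P: prob_space "measure_pmf (pmf_of_set {..<n})" by (rule prob_space_measure_pmf)
  interpret PU: pair_prob_space "measure_pmf (pmf_of_set {..<n})" unif by standard
  show ?thesis unfolding smear_def by (rule PU.prob_space_distr) measurable
qed

lemma nn_integral_smear:
  assumes n: "n > 0" and [measurable]: "f \<in> borel_measurable borel"
  shows "(\<integral>\<^sup>+ x. f x \<partial>smear n z r) = (\<Sum>i<n. \<integral>\<^sup>+ t. f (z i + of_real r * ee 1 t) \<partial>unif) / of_nat n"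
proof -
  interpret U: prob_space unif by (rule prob_space_unif)
  have [measurable]: "z \<in> borel_measurable (measure_pmf p)" for p by simp
  have "(\<integral>\<^sup>+ x. f x \<partial>smear n z r) = (\<integral>\<^sup>+ p. f (case p of (i, t) \<Rightarrow> z i + of_real r * ee 1 t) \<partial>(measure_pmf (pmf_of_set {..<n}) \<Otimes>\<^sub>M unif))"
    unfolding smear_def by (rule nn_integral_distr) measurable
  also have "\<dots> = (\<integral>\<^sup>+ i. \<integral>\<^sup>+ t. f (z i + of_real r * ee 1 t) \<partial>unif \<partial>measure_pmf (pmf_of_set {..<n}))"
    by (subst U.nn_integral_fst[symmetric]) auto
  also have "\<dots> = (\<Sum>i<n. \<integral>\<^sup>+ t. f (z i + of_real r * ee 1 t) \<partial>unif) / of_nat n"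
    using n by (subst nn_integral_pmf_of_set) (auto simp: ennreal_of_nat_eq_real_of_nat)
  finally show ?thesis .
qed

text \<open>The mean inequality is applied first in the second variable and then in the first. For
  \<open>i = j\<close> the first application already leaves the kernel between a point of the circle
  and its centre, the constant \<open>ln (D / r)\<close>.\<close>

lemma ker_energy_smear_le:
  assumes n: "n > 0" and r: "r > 0" and b: "\<And>i. i < n \<Longrightarrow> norm (z i) \<le> b" and D: "2 * b + 2 * r \<le> D"
  shows "(\<integral>\<^sup>+ p. ker D (fst p) (snd p) \<partial>(smear n z r \<Otimes>\<^sub>M smear n z r))
    \<le> (\<Sum>i<n. \<Sum>j<n. if i = j then ennreal (ln (D / r)) else ker D (z i) (z j)) / of_nat n / of_nat n"
proof -
  interpret S: prob_space "smear n z r" by (rule prob_space_smear)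
  have ss[measurable_cong]: "sets (smear n z r) = sets borel" by (simp add: smear_def)
  have [measurable]: "(\<lambda>p. ker D (fst p) (snd p)) \<in> borel_measurable (smear n z r \<Otimes>\<^sub>M smear n z r)" by measurable
  have b0: "b \<ge> 0" using b[OF n] norm_ge_zero order_trans by blast
  have dle: "norm (z i - z j) \<le> 2 * b" if "i < n" "j < n" for i j
    using norm_triangle_ineq4[of "z i" "z j"] b[OF that(1)] b[OF that(2)] by linarith
  have dle1: "norm (z i + of_real r * ee 1 s - z j) \<le> 2 * b + r" if "i < n" "j < n" for i j s
  proof -
    have "norm (z i + of_real r * ee 1 s - z j) \<le> norm (z i - z j) + norm (of_real r * ee 1 s)"
      using norm_triangle_ineq[of "z i - z j" "of_real r * ee 1 s"] by (simp add: algebra_simps)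
    then show ?thesis using dle[OF that] r by (simp add: norm_mult)
  qed
  have inner: "(\<integral>\<^sup>+ y. ker D x y \<partial>smear n z r) = (\<Sum>j<n. \<integral>\<^sup>+ t. ker D x (z j + of_real r * ee 1 t) \<partial>unif) / of_nat n" for x
    by (rule nn_integral_smear[OF n]) measurable
  interpret U: prob_space unif by (rule prob_space_unif)
  have mU: "(\<lambda>x. \<integral>\<^sup>+ t. ker D x (z j + of_real r * ee 1 t) \<partial>unif) \<in> borel_measurable borel" for j
    by measurable
  have mS: "(\<lambda>x. \<integral>\<^sup>+ y. ker D x y \<partial>smear n z r) \<in> borel_measurable borel"
    unfolding inner by (intro borel_measurable_divide_ennreal borel_measurable_sum mU borel_measurable_const)
  have fin: "(\<integral>\<^sup>+ s. (if i = j then ennreal (ln (D / r)) else ker D (z i + of_real r * ee 1 s) (z j)) \<partial>unif)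
     \<le> (if i = j then ennreal (ln (D / r)) else ker D (z i) (z j))" if ij: "i < n" "j < n" for i j
  proof (cases "i = j")
    case True
    show ?thesis using True U.emeasure_space_1 by simp
  next
    case False
    have "norm (z j - z i) + r \<le> D" using dle[OF ij(2,1)] D r by linarith
    then show ?thesis
      using ker_mean'[OF r, of "z j" "z i" D] False by (simp add: ker_commute[of D _ "z j"])
  qed
  have "(\<integral>\<^sup>+ p. ker D (fst p) (snd p) \<partial>(smear n z r \<Otimes>\<^sub>M smear n z r)) = (\<integral>\<^sup>+ x. \<integral>\<^sup>+ y. ker D x y \<partial>smear n z r \<partial>smear n z r)"
    by (subst S.nn_integral_fst[symmetric]) auto
  also have "\<dots> = (\<Sum>i<n. \<integral>\<^sup>+ s. (\<integral>\<^sup>+ y. ker D (z i + of_real r * ee 1 s) y \<partial>smear n z r) \<partial>unif) / of_nat n"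
    by (rule nn_integral_smear[OF n mS])
  also have "\<dots> \<le> (\<Sum>i<n. \<integral>\<^sup>+ s. (\<Sum>j<n. (if i = j then ennreal (ln (D / r)) else ker D (z i + of_real r * ee 1 s) (z j))) / of_nat n \<partial>unif) / of_nat n"
    unfolding inner
  proof (intro divide_right_mono_ennreal sum_mono nn_integral_mono)
    fix i s j assume ij: "i \<in> {..<n}" "j \<in> {..<n}"
    have "(\<integral>\<^sup>+ t. ker D (z i + of_real r * ee 1 s) (z j + of_real r * ee 1 t) \<partial>unif) \<le> ker D (z i + of_real r * ee 1 s) (z j)"
      by (rule ker_mean'[OF r]) (use dle1[of i j s] ij D in auto)
    moreover have "ker D (z i + of_real r * ee 1 s) (z i) = ennreal (ln (D / r))"
      using r by (simp add: ker_def norm_mult)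
    ultimately show "(\<integral>\<^sup>+ t. ker D (z i + of_real r * ee 1 s) (z j + of_real r * ee 1 t) \<partial>unif)
       \<le> (if i = j then ennreal (ln (D / r)) else ker D (z i + of_real r * ee 1 s) (z j))" by auto
  qed
  also have "\<dots> = (\<Sum>i<n. (\<Sum>j<n. \<integral>\<^sup>+ s. (if i = j then ennreal (ln (D / r)) else ker D (z i + of_real r * ee 1 s) (z j)) \<partial>unif) / of_nat n) / of_nat n"
    by (subst nn_integral_divide, measurable, subst nn_integral_sum) auto
  also have "\<dots> \<le> (\<Sum>i<n. (\<Sum>j<n. if i = j then ennreal (ln (D / r)) else ker D (z i) (z j)) / of_nat n) / of_nat n"
    by (intro divide_right_mono_ennreal sum_mono fin) auto
  also have "\<dots> = (\<Sum>i<n. \<Sum>j<n. if i = j then ennreal (ln (D / r)) else ker D (z i) (z j)) / of_nat n / of_nat n"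
    by (simp add: divide_ennreal_def sum_distrib_right)
  finally show ?thesis .
qed

section \<open>Leja points and the upper bound for the least energy\<close>

lemma exists_point_poly_large:
  assumes AB: "A > 1" "B > 1"
  shows "\<exists>c0>0. \<forall>k. \<forall>c::nat \<Rightarrow> complex. c k = 1 \<longrightarrow>
    (\<exists>u\<in>disk1 A \<union> disk2 B. c0 * gam A B ^ k \<le> norm (\<Sum>j\<le>k. c j * u ^ j))"
proof -
  define K where "K = 1 / (1 - 1 / A) + B / (B - 1)"
  have K: "K > 0" using AB by (auto simp: K_def intro!: add_pos_pos divide_pos_pos)
  \<comment> \<open>Half of the constant that \<open>gam_lower_sup\<close> would allow, so that the
    negation contradicts that bound strictly.\<close>
  have "\<exists>u\<in>disk1 A \<union> disk2 B. 1 / (2 * K) * gam A B ^ k \<le> norm (\<Sum>j\<le>k. c j * u ^ j)" if c: "c k = 1" for k and c :: "nat \<Rightarrow> complex"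
  proof (rule ccontr)
    assume "\<not> ?thesis"
    then have small: "norm (\<Sum>j\<le>k. c j * u ^ j) \<le> 1 / (2 * K) * gam A B ^ k" if "u \<in> disk1 A \<union> disk2 B" for u
      using that by (auto simp: not_le intro: less_imp_le)
    have "gam A B ^ k \<le> (1 / (2 * K) * gam A B ^ k) * (1 / (1 - 1 / A) + B / (B - 1))"
    proof (rule gam_lower_sup[where c=c and k=k, OF AB c])
      fix z :: complex assume z: "norm z = 1 / A \<or> norm z = B"
      then have "z \<noteq> 1" using AB by auto
      define u where "u = z / (1 - z)"
      have u1: "1 + u = 1 / (1 - z)" using \<open>z \<noteq> 1\<close> by (simp add: u_def field_simps)
      have nu: "norm u = norm z / norm (1 - z)" "norm (1 + u) = 1 / norm (1 - z)"
        unfolding u1 by (simp_all add: u_def norm_divide)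
      have "u \<in> disk1 A \<union> disk2 B"
      proof (cases "norm z = 1 / A")
        case True
        have "A * norm u \<le> norm (1 + u)" unfolding nu True using AB by simp
        then show ?thesis using in_disk1_iff[OF AB(1)] by simp
      next
        case False
        then have "norm z = B" using z by simp
        then have "B * norm (1 + u) \<le> norm u" unfolding nu by simp
        then show ?thesis using in_disk2_iff[OF AB(2)] by simp
      qed
      then show "norm (\<Sum>j\<le>k. c j * (z / (1 - z)) ^ j) \<le> 1 / (2 * K) * gam A B ^ k"
        unfolding u_def[symmetric] by (rule small)
    qed
    also have "\<dots> = gam A B ^ k / 2" unfolding K_def[symmetric] using K by simp
    finally show False using gam_pos[of A B] by simp
  qed
  then show ?thesis using K by (intro exI[of _ "1 / (2 * K)"]) auto
qed

text \<open>The hypothesis is applied to the monic polynomial whose zeros are the points chosen so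
  far. A point where it is merely large, and not maximal, is enough.\<close>

lemma Leja_sequence:
  assumes "\<And>k c. c k = (1::complex) \<Longrightarrow> \<exists>u\<in>E. M k \<le> norm (\<Sum>j\<le>k. c j * u ^ j)"
  obtains z :: "nat \<Rightarrow> complex" where "\<And>k. z k \<in> E" "\<And>k. M k \<le> (\<Prod>j<k. norm (z k - z j))"
proof -
  have "\<exists>z. \<forall>k. z k \<in> E \<and> M k \<le> (\<Prod>j<k. norm (z k - z j))"
  proof (rule dependent_wellorder_choice[where P="\<lambda>z k u. u \<in> E \<and> M k \<le> (\<Prod>j<k. norm (u - z j))"])
    fix r :: complex and f g :: "nat \<Rightarrow> complex" and k :: nat
    assume "\<And>y. y < k \<Longrightarrow> f y = g y"
    then have "(\<Prod>j<k. norm (r - f j)) = (\<Prod>j<k. norm (r - g j))" by (intro prod.cong) auto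
    then show "(r \<in> E \<and> M k \<le> (\<Prod>j<k. norm (r - f j))) = (r \<in> E \<and> M k \<le> (\<Prod>j<k. norm (r - g j)))" by simp
  next
    fix k :: nat and f :: "nat \<Rightarrow> complex"
    define p where "p = (\<Prod>j<k. [:- f j, 1:])"
    have deg: "degree p = k" unfolding p_def by (subst degree_prod_sum_eq) auto
    have "lead_coeff p = 1" unfolding p_def by (simp add: lead_coeff_prod)
    then have "coeff p k = 1" using deg by simp
    from assms[where c="coeff p" and k=k, OF this] obtain u where u: "u \<in> E" "M k \<le> norm (\<Sum>j\<le>k. coeff p j * u ^ j)" by blast
    have "(\<Sum>j\<le>k. coeff p j * u ^ j) = poly p u" by (simp add: poly_altdef deg)
    also have "\<dots> = (\<Prod>j<k. u - f j)" by (simp add: p_def poly_prod)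
    finally show "\<exists>r. r \<in> E \<and> M k \<le> (\<Prod>j<k. norm (r - f j))" using u by (auto simp: prod_norm)
  qed
  then show ?thesis using that by blast
qed

lemma sum_symmetric_off_diagonal:
  fixes g :: "nat \<Rightarrow> nat \<Rightarrow> real"
  assumes "\<And>i j. g i j = g j i"
  shows "(\<Sum>i<n. \<Sum>j<n. if i = j then d else g i j) = n * d + 2 * (\<Sum>i<n. \<Sum>j<i. g i j)"
proof (induction n)
  case (Suc n)
  have 1: "(\<Sum>j<n. if n = j then d else g n j) = (\<Sum>j<n. g n j)" by (intro sum.cong) auto
  have 2: "(\<Sum>i<n. if i = n then d else g i n) = (\<Sum>j<n. g n j)" by (intro sum.cong) (auto simp: assms)
  have "(\<Sum>i<Suc n. \<Sum>j<Suc n. if i = j then d else g i j)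
     = (\<Sum>i<n. \<Sum>j<n. if i = j then d else g i j) + (\<Sum>i<n. if i = n then d else g i n) + ((\<Sum>j<n. if n = j then d else g n j) + d)"
    by (simp add: sum.distrib)
  then show ?case unfolding 1 2 Suc.IH by (simp add: algebra_simps)
qed simp

text \<open>The first \<open>n\<close> points, smeared at the fixed radius \<open>r\<close>, give a
  measure on \<open>F\<close>. Its diagonal costs \<open>n * ln (D / r)\<close>, negligible against
  \<open>n\<^sup>2\<close>, and the Leja bounds give the limit \<open>- ln \<gamma>\<close>.\<close>

lemma min_energy_le:
  assumes z: "\<And>k. z k \<in> E" and c0: "c0 > 0" and \<gamma>: "\<gamma> > 0"
    and M: "\<And>k. c0 * \<gamma> ^ k \<le> (\<Prod>j<k. norm (z k - z j))"
    and r: "r > 0" and F: "\<And>x y. x \<in> E \<Longrightarrow> norm (y - x) \<le> r \<Longrightarrow> y \<in> F"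
    and Fc: "closed F" "bounded F"
  shows "min_energy F \<le> ereal (- ln \<gamma>)"
proof -
  obtain b where b: "\<And>x. x \<in> F \<Longrightarrow> norm x \<le> b" using Fc(2) by (auto simp: bounded_iff)
  have zF: "z k \<in> F" for k using F[OF z, of "z k" k] r by simp
  have b0: "b \<ge> 0" using b[OF zF[of 0]] norm_ge_zero order_trans by blast
  define D where "D = max 1 (2 * b + 2 * r)"
  have D: "D \<ge> 1" "2 * b + 2 * r \<le> D" "D > 0" by (auto simp: D_def)
  have diam: "norm (x - y) \<le> D" if "x \<in> F" "y \<in> F" for x y
    using norm_triangle_ineq4[of x y] b[OF that(1)] b[OF that(2)] D r by linarith
  have ne: "norm (z k - z j) > 0" if "j < k" for j k
  proof -
    have p: "(\<Prod>j<k. norm (z k - z j)) > 0" by (rule less_le_trans[OF _ M]) (use c0 \<gamma> in simp)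
    show ?thesis
    proof (rule ccontr)
      assume "\<not> ?thesis"
      then have "norm (z k - z j) = 0" by simp
      then have "(\<Prod>j<k. norm (z k - z j)) = 0" using that by (intro prod_zero) auto
      then show False using p by linarith
    qed
  qed
  have pos: "norm (z i - z j) > 0" if "i \<noteq> j" for i j
    using ne[of i j] ne[of j i] that by (cases "i < j") (auto simp: norm_minus_commute)
  define V where "V n = (n * ln (D / r) + 2 * (real n * (real n - 1) / 2 * (ln D - ln \<gamma>) - n * ln c0)) / n / n" for n :: nat
  have rD: "0 \<le> ln (D / r)" using D r b0 by (intro ln_ge_zero) auto
  have S_nn: "0 \<le> (\<Sum>i<n. \<Sum>j<i. ln D - ln (norm (z i - z j)))" for n :: nat
  proof (intro sum_nonneg)
    fix i j :: nat assume "j \<in> {..<i}"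
    then show "0 \<le> ln D - ln (norm (z i - z j))" using ne[of j i] diam[OF zF zF, of i j] D by simp
  qed
  have S_le: "(\<Sum>i<n. \<Sum>j<i. ln D - ln (norm (z i - z j))) \<le> real n * (real n - 1) / 2 * (ln D - ln \<gamma>) - n * ln c0" for n :: nat
  proof -
    have "(\<Sum>i<n. \<Sum>j<i. ln D - ln (norm (z i - z j))) \<le> (\<Sum>i<n. real i * (ln D - ln \<gamma>) - ln c0)"
      proof (rule sum_mono)
        fix i
        have "ln (c0 * \<gamma> ^ i) \<le> ln (\<Prod>j<i. norm (z i - z j))"
        proof -
          have p: "0 < c0 * \<gamma> ^ i" using c0 \<gamma> by simp
          show ?thesis by (rule iffD2[OF ln_le_cancel_iff[OF p less_le_trans[OF p M]] M])
        qed
        also have "\<dots> = (\<Sum>j<i. ln (norm (z i - z j)))" by (rule ln_prod) (use ne in force)+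
        finally have "ln c0 + i * ln \<gamma> \<le> (\<Sum>j<i. ln (norm (z i - z j)))" using c0 \<gamma> by (simp add: ln_mult ln_realpow)
        then show "(\<Sum>j<i. ln D - ln (norm (z i - z j))) \<le> real i * (ln D - ln \<gamma>) - ln c0"
          by (simp add: sum_subtractf algebra_simps)
      qed
      also have "\<dots> = real n * (real n - 1) / 2 * (ln D - ln \<gamma>) - n * ln c0"
        by (simp add: sum_subtractf sum_distrib_right[symmetric] sum_real_lessThan)
    finally show ?thesis .
  qed
  have le: "min_energy F \<le> ereal (V n - ln D)" if n: "n > 0" for n
  proof -
    have pm: "smear n z r \<in> prob_measures_on F"
    proof -
      have "AE x in smear n z r. x \<in> F"
        unfolding smear_def
      proof (subst AE_distr_iff)
        show "{x \<in> space borel. x \<in> F} \<in> sets borel" using Fc by simp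
        have "norm ((z i + of_real r * ee 1 t) - z i) \<le> r" for i t using r by (simp add: norm_mult)
        then have "z i + of_real r * ee 1 t \<in> F" for i t using F[OF z] by blast
        then show "AE x in measure_pmf (pmf_of_set {..<n}) \<Otimes>\<^sub>M unif. (case x of (i, t) \<Rightarrow> z i + of_real r * ee 1 t) \<in> F"
          by (auto simp: case_prod_beta)
      qed measurable
      then show ?thesis by (simp add: prob_measures_on_def prob_space_smear) (simp add: smear_def)
    qed
    have "(\<integral>\<^sup>+ p. ker D (fst p) (snd p) \<partial>(smear n z r \<Otimes>\<^sub>M smear n z r))
       \<le> (\<Sum>i<n. \<Sum>j<n. if i = j then ennreal (ln (D / r)) else ker D (z i) (z j)) / of_nat n / of_nat n"
      by (rule ker_energy_smear_le[OF n r b[OF zF] D(2)])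
    also have "(\<Sum>i<n. \<Sum>j<n. if i = j then ennreal (ln (D / r)) else ker D (z i) (z j))
        = ennreal (\<Sum>i<n. \<Sum>j<n. if i = j then ln (D / r) else ln D - ln (norm (z i - z j)))"
    proof -
      have nn: "0 \<le> (if i = j then ln (D / r) else ln D - ln (norm (z i - z j)))" for i j
        using rD pos[of i j] diam[OF zF zF, of i j] D by auto
      have "(if i = j then ennreal (ln (D / r)) else ker D (z i) (z j)) = ennreal (if i = j then ln (D / r) else ln D - ln (norm (z i - z j)))" for i j
        using pos[of i j] D by (auto simp: ker_def ln_divide_pos)
      then show ?thesis using nn by (simp add: sum_ennreal sum_nonneg)
    qed
    also have "(\<Sum>i<n. \<Sum>j<n. if i = j then ln (D / r) else ln D - ln (norm (z i - z j)))
       = n * ln (D / r) + 2 * (\<Sum>i<n. \<Sum>j<i. ln D - ln (norm (z i - z j)))"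
      by (rule sum_symmetric_off_diagonal) (simp add: norm_minus_commute)
    also have "ennreal (n * ln (D / r) + 2 * (\<Sum>i<n. \<Sum>j<i. ln D - ln (norm (z i - z j)))) / of_nat n / of_nat n \<le> ennreal (V n)"
    proof -
      have le: "(n * ln (D / r) + 2 * (\<Sum>i<n. \<Sum>j<i. ln D - ln (norm (z i - z j)))) / n / n \<le> V n"
        unfolding V_def using S_le[of n] by (intro divide_right_mono) auto
      have nn: "0 \<le> n * ln (D / r) + 2 * (\<Sum>i<n. \<Sum>j<i. ln D - ln (norm (z i - z j)))"
        using rD S_nn[of n] by simp
      have "ennreal (n * ln (D / r) + 2 * (\<Sum>i<n. \<Sum>j<i. ln D - ln (norm (z i - z j)))) / of_nat n / of_nat n
         = ennreal ((n * ln (D / r) + 2 * (\<Sum>i<n. \<Sum>j<i. ln D - ln (norm (z i - z j)))) / n / n)"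
        using nn n by (simp only: ennreal_of_nat_eq_real_of_nat) (subst divide_ennreal, simp, simp, subst divide_ennreal, simp, simp, simp)
      then show ?thesis using le by (simp add: ennreal_leI)
    qed
    finally have K: "(\<integral>\<^sup>+ p. ker D (fst p) (snd p) \<partial>(smear n z r \<Otimes>\<^sub>M smear n z r)) \<le> ennreal (V n)" .
    have "min_energy F \<le> log_energy (smear n z r)"
      unfolding min_energy_def by (rule INF_lower[OF pm])
    also have "\<dots> = enn2ereal (\<integral>\<^sup>+ p. ker D (fst p) (snd p) \<partial>(smear n z r \<Otimes>\<^sub>M smear n z r)) - ereal (ln D)"
      by (rule log_energy_eq_ker[OF pm Fc(1) D(1) diam])
    also have "\<dots> \<le> ereal (max 0 (V n)) - ereal (ln D)"
    proof (intro ereal_minus_mono)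
      have "enn2ereal (\<integral>\<^sup>+ p. ker D (fst p) (snd p) \<partial>(smear n z r \<Otimes>\<^sub>M smear n z r)) \<le> enn2ereal (ennreal (V n))"
        using K by (simp add: less_eq_ennreal.rep_eq)
      also have "\<dots> = ereal (max 0 (V n))" by (cases "0 \<le> V n") (auto simp: enn2ereal_ennreal ennreal_neg zero_ennreal.rep_eq)
      finally show "enn2ereal (\<integral>\<^sup>+ p. ker D (fst p) (snd p) \<partial>(smear n z r \<Otimes>\<^sub>M smear n z r)) \<le> ereal (max 0 (V n))" .
    qed simp
    finally have "min_energy F \<le> ereal (max 0 (V n)) - ereal (ln D)" .
    \<comment> \<open>The estimate passes through \<open>ennreal (V n)\<close>, which would replace
      a negative value by \<open>0\<close>.\<close>
    moreover have "V n \<ge> 0"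
    proof -
      have "0 \<le> n * ln (D / r) + 2 * (real n * (real n - 1) / 2 * (ln D - ln \<gamma>) - n * ln c0)"
        using rD S_nn[of n] S_le[of n] by (intro add_nonneg_nonneg) auto
      then show ?thesis unfolding V_def by (intro divide_nonneg_nonneg) auto
    qed
    ultimately show ?thesis by (simp add: max_def)
  qed
  have "(\<lambda>n. V n - ln D) \<longlonglongrightarrow> - ln \<gamma>"
    unfolding V_def by real_asymp (simp add: field_simps)
  then have "(\<lambda>n. ereal (V n - ln D)) \<longlonglongrightarrow> ereal (- ln \<gamma>)" by simp
  moreover have "eventually (\<lambda>n. min_energy F \<le> ereal (V n - ln D)) sequentially"
    using le by (intro eventually_sequentiallyI[of 1]) auto
  ultimately show ?thesis by (rule tendsto_lowerbound) simp
qed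

lemma disks_closed_bounded: "closed (disk1 A \<union> disk2 B)" "bounded (disk1 A \<union> disk2 B)"
  by (auto simp: disk1_def disk2_def)

lemma min_energy_disks_ge:
  assumes "1 < A" "1 < B" "A < A'" "B < B'"
  shows "ereal (- ln (gam A B)) \<le> min_energy (disk1 A' \<union> disk2 B')"
proof -
  obtain C where C: "C > 0"
    "\<And>k. \<exists>c::nat \<Rightarrow> complex. c k = 1 \<and> (\<forall>u\<in>disk1 A' \<union> disk2 B'. norm (\<Sum>j\<le>k. c j * u ^ j) \<le> C * gam A B ^ k)"
    using exists_monic_poly_bounded[OF assms] by blast
  show ?thesis unfolding min_energy_def
    by (intro INF_greatest log_energy_ge[OF _ disks_closed_bounded C(2,1) gam_pos])
qed

text \<open>By the characterizations through \<open>norm u\<close> and \<open>norm (1 + u)\<close>,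
  a strict change of the parameter leaves room for a perturbation of fixed size.\<close>

lemma disks_neighbourhood:
  assumes AB: "1 < A" "1 < B" "A < A'" "B < B'"
  obtains r where "r > 0" "\<And>x y. x \<in> disk1 A' \<union> disk2 B' \<Longrightarrow> norm (y - x) \<le> r \<Longrightarrow> y \<in> disk1 A \<union> disk2 B"
proof -
  \<comment> \<open>Used with \<open>(v, w)\<close> equal to \<open>(x, 1 + x)\<close> and to
    \<open>(1 + x, x)\<close>, hence only \<open>norm (v - w) = 1\<close> is assumed. It forces
    \<open>norm w \<ge> 1 / 2\<close>, which bounds the available slack from below.\<close>
  have key: "A * norm b \<le> norm a"
    if A: "1 < A" "A < A'" and u: "A' * norm v \<le> norm w" "norm (v - w) = 1"
      and ab: "norm (b - v) \<le> (1 - A / A') / (2 * (A + 1))" "norm (a - w) \<le> (1 - A / A') / (2 * (A + 1))"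
    for A A' :: real and a b v w :: complex
  proof -
    define r where "r = (1 - A / A') / (2 * (A + 1))"
    have "1 \<le> norm v + norm w" using u(2) norm_triangle_ineq4[of v w] by simp
    moreover have "1 * norm v \<le> A' * norm v" using A by (intro mult_right_mono) auto
    ultimately have w: "norm w \<ge> 1 / 2" using u(1) by linarith
    have vw: "A * norm v \<le> A / A' * norm w"
    proof -
      have "A / A' * (A' * norm v) \<le> A / A' * norm w" using u(1) A by (intro mult_left_mono) auto
      then show ?thesis using A by simp
    qed
    have "(1 - A / A') * (1 / 2) \<le> (1 - A / A') * norm w" using w A by (intro mult_left_mono) auto
    moreover have "(A + 1) * r = (1 - A / A') * (1 / 2)"
    proof -
      have "x * (y / (2 * x)) = y * (1 / 2)" if "x \<noteq> 0" for x y :: real using that by simp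
      from this[of "A + 1"] show ?thesis unfolding r_def using A by auto
    qed
    ultimately have r: "(A + 1) * r \<le> (1 - A / A') * norm w" by (rule ord_eq_le_trans[rotated])
    have "norm b \<le> norm v + r" using norm_triangle_ineq2[of b v] ab(1) by (simp add: r_def)
    then have "A * norm b \<le> A * norm v + A * r" using A mult_left_mono[of "norm b" "norm v + r" A] by (simp add: distrib_left)
    moreover have "norm w - r \<le> norm a" using norm_triangle_ineq2[of w a] ab(2) by (simp add: r_def norm_minus_commute)
    ultimately show ?thesis using vw r by (simp add: algebra_simps)
  qed
  define r where "r = min ((1 - A / A') / (2 * (A + 1))) ((1 - B / B') / (2 * (B + 1)))"
  show ?thesis
  proof (rule that[of r])
    show "r > 0" using AB by (auto simp: r_def)
    fix x y assume x: "x \<in> disk1 A' \<union> disk2 B'" and y: "norm (y - x) \<le> r"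
    have e: "(1 + y) - (1 + x) = y - x" by simp
    consider "A' * norm x \<le> norm (1 + x)" | "B' * norm (1 + x) \<le> norm x"
      using x in_disk1_iff[of A' x] in_disk2_iff[of B' x] AB by auto
    then show "y \<in> disk1 A \<union> disk2 B"
    proof cases
      case 1
      have "A * norm y \<le> norm (1 + y)"
        by (rule key[OF AB(1,3) 1]) (use y in \<open>auto simp: r_def e norm_minus_commute[of x]\<close>)
      then show ?thesis using in_disk1_iff[OF AB(1)] by simp
    next
      case 2
      have "B * norm (1 + y) \<le> norm y"
        by (rule key[OF AB(2,4) 2]) (use y in \<open>auto simp: r_def e\<close>)
      then show ?thesis using in_disk2_iff[OF AB(2)] by simp
    qed
  qed
qed

lemma min_energy_disks_le:
  assumes AB: "1 < A" "1 < B" "A < A'" "B < B'"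
  shows "min_energy (disk1 A \<union> disk2 B) \<le> ereal (- ln (gam A' B'))"
proof -
  obtain r where r: "r > 0" "\<And>x y. x \<in> disk1 A' \<union> disk2 B' \<Longrightarrow> norm (y - x) \<le> r \<Longrightarrow> y \<in> disk1 A \<union> disk2 B"
    using disks_neighbourhood[OF AB] by blast
  have AB': "1 < A'" "1 < B'" using AB by auto
  obtain c0 where c0: "c0 > 0"
    "\<And>k c. c k = (1::complex) \<Longrightarrow> \<exists>u\<in>disk1 A' \<union> disk2 B'. c0 * gam A' B' ^ k \<le> norm (\<Sum>j\<le>k. c j * u ^ j)"
    using exists_point_poly_large[OF AB'] by blast
  obtain z where z: "\<And>k. z k \<in> disk1 A' \<union> disk2 B'" "\<And>k. c0 * gam A' B' ^ k \<le> (\<Prod>j<k. norm (z k - z j))"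
    using Leja_sequence[OF c0(2)] by blast
  show ?thesis
    by (rule min_energy_le[OF z(1) c0(1) gam_pos z(2) r disks_closed_bounded])
qed

section \<open>Continuity in the radii and identification of the capacity\<close>

text \<open>The energy comparisons change both parameters in the same direction, so continuity is
  taken along a ray. For \<open>s \<ge> s0\<close> all terms have the geometric majorants of
  \<open>s0\<close>, and the series converges uniformly.\<close>

lemma continuous_tau:
  assumes s0: "s0 > 0" "A * s0 > 1" "B * s0 > 1"
  shows "continuous_on {s0..} (\<lambda>s. tau (A * s) (B * s))"
proof -
  define f where "f m s = green_coeff (1 / (A * s)\<^sup>2) (1 / (B * s)\<^sup>2) m + green_coeff (1 / (B * s)\<^sup>2) (1 / (A * s)\<^sup>2) m" for m s
  have AB: "A > 0" "B > 0" using s0 by (auto simp: zero_less_mult_iff intro: order_less_trans dest!: order_less_trans[OF zero_less_one])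
  have big: "A * s0 \<le> A * s" "B * s0 \<le> B * s" "A * s > 1" "B * s > 1" if "s \<ge> s0" for s
  proof -
    show m: "A * s0 \<le> A * s" "B * s0 \<le> B * s" using AB that by (auto intro: mult_left_mono)
    show "A * s > 1" "B * s > 1" using m s0 by linarith+
  qed
  have sm: "0 < 1 / (X * s)\<^sup>2" "1 / (X * s)\<^sup>2 < 1" "1 / (X * s)\<^sup>2 \<le> 1 / (X * s0)\<^sup>2"
    if "s \<ge> s0" "X = A \<or> X = B" for X s
  proof -
    have X: "X * s > 1" "X * s0 > 1" "X * s0 \<le> X * s" using big[OF that(1)] s0 that(2) by auto
    show "0 < 1 / (X * s)\<^sup>2" by (intro divide_pos_pos zero_less_power) (use X(1) in linarith)+
    have "1 / y < 1" if "1 < y" for y :: real using that by simp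
    from this[OF one_less_power[OF X(1), of 2]] show "1 / (X * s)\<^sup>2 < 1" by (simp only: pos2)
    show "1 / (X * s)\<^sup>2 \<le> 1 / (X * s0)\<^sup>2" using X AB that s0 by (intro divide_left_mono power_mono mult_pos_pos zero_less_power) auto
  qed
  have cont: "continuous_on {s0..} (f m)" for m
  proof (cases "m = 0")
    case True
    then show ?thesis by (simp add: f_def[abs_def] green_coeff_def)
  next
    case False
    have lt: "(1 / (X * s)\<^sup>2 * (1 / (Y * s)\<^sup>2)) ^ m < 1" if "s \<ge> s0" "X = A \<or> X = B" "Y = A \<or> Y = B" for X Y s
    proof -
      have "1 / (X * s)\<^sup>2 * (1 / (Y * s)\<^sup>2) < 1"
        using sm[OF that(1,2)] sm[OF that(1,3)] mult_strict_mono[of "1 / (X * s)\<^sup>2" 1 "1 / (Y * s)\<^sup>2" 1] by simp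
      moreover have "0 \<le> 1 / (X * s)\<^sup>2 * (1 / (Y * s)\<^sup>2)" by simp
      ultimately show ?thesis using False by (simp only: power_less_one_iff) simp
    qed
    have nz: "X * s \<noteq> 0" if "s \<in> {s0..}" "X = A \<or> X = B" for X s using sm(1)[of s X] that by auto
    have one: "continuous_on {s0..} (\<lambda>s. green_coeff (1 / (X * s)\<^sup>2) (1 / (Y * s)\<^sup>2) m)"
      if "X = A \<or> X = B" "Y = A \<or> Y = B" for X Y
      unfolding green_coeff_def
    proof (intro continuous_intros ballI)
      fix s assume s: "s \<in> {s0..}"
      show "(X * s)\<^sup>2 \<noteq> 0" "(Y * s)\<^sup>2 \<noteq> 0" using nz[OF s that(1)] nz[OF s that(2)] by simp_all
      show "1 - (1 / (X * s)\<^sup>2 * (1 / (Y * s)\<^sup>2)) ^ m \<noteq> 0" using lt[of s X Y] s that by simp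
      show "real m \<noteq> 0" using False by simp
    qed (use nz[OF _ that(1)] nz[OF _ that(2)] in auto)
    show ?thesis unfolding f_def by (intro continuous_intros one) auto
  qed
  have "uniform_limit {s0..} (\<lambda>n s. \<Sum>m<n. f m s) (\<lambda>s. \<Sum>m. f m s) sequentially"
  proof (rule Weierstrass_m_test)
    show "norm (f m s) \<le> (1 / (B * s0)\<^sup>2) ^ m + (1 / (A * s0)\<^sup>2) ^ m" if "s \<in> {s0..}" for m s
    proof -
      have s: "s \<ge> s0" using that by simp
      have "\<bar>green_coeff (1 / (A * s)\<^sup>2) (1 / (B * s)\<^sup>2) m\<bar> \<le> (1 / (B * s)\<^sup>2) ^ m"
        by (rule green_coeff_bound) (use sm[OF s, of A] sm[OF s, of B] in auto)
      also have "\<dots> \<le> (1 / (B * s0)\<^sup>2) ^ m" using sm[OF s, of B] by (intro power_mono) auto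
      finally have 1: "\<bar>green_coeff (1 / (A * s)\<^sup>2) (1 / (B * s)\<^sup>2) m\<bar> \<le> (1 / (B * s0)\<^sup>2) ^ m" .
      have "\<bar>green_coeff (1 / (B * s)\<^sup>2) (1 / (A * s)\<^sup>2) m\<bar> \<le> (1 / (A * s)\<^sup>2) ^ m"
        by (rule green_coeff_bound) (use sm[OF s, of A] sm[OF s, of B] in auto)
      also have "\<dots> \<le> (1 / (A * s0)\<^sup>2) ^ m" using sm[OF s, of A] by (intro power_mono) auto
      finally have 2: "\<bar>green_coeff (1 / (B * s)\<^sup>2) (1 / (A * s)\<^sup>2) m\<bar> \<le> (1 / (A * s0)\<^sup>2) ^ m" .
      show ?thesis unfolding f_def real_norm_def using 1 2 by linarith
    qed
    show "summable (\<lambda>m. (1 / (B * s0)\<^sup>2) ^ m + (1 / (A * s0)\<^sup>2) ^ m)"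
      by (intro summable_add summable_geometric) (use sm[of s0 A] sm[of s0 B] in auto)
  qed
  then have "continuous_on {s0..} (\<lambda>s. \<Sum>m. f m s)"
    by (rule uniform_limit_theorem[rotated]) (auto intro!: continuous_intros cont always_eventually)
  then have "continuous_on {s0..} (\<lambda>s. - (\<Sum>m. f m s))" by (rule continuous_on_minus)
  then show ?thesis unfolding tau_def f_def .
qed

lemma isCont_ln_gam:
  assumes AB: "A > 1" "B > 1"
  shows "isCont (\<lambda>s. - ln (gam (A * s) (B * s))) 1"
proof -
  \<comment> \<open>Halfway between \<open>1\<close> and the least admissible scale, so that
    \<open>1\<close> is interior to the range of uniform convergence.\<close>
  define s0 where "s0 = (1 + max (1 / A) (1 / B)) / 2"
  have "max (1 / A) (1 / B) < 1" using AB by simp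
  then have lt: "s0 < 1" "1 / A < s0" "1 / B < s0" by (auto simp: s0_def)
  moreover have "0 < 1 / A" using AB by simp
  ultimately have "s0 > 0" by linarith
  with lt have s0: "s0 > 0" "A * s0 > 1" "B * s0 > 1" using AB by (auto simp: field_simps)
  have "continuous_on {s0<..} (\<lambda>s. tau (A * s) (B * s))"
    by (rule continuous_on_subset[OF continuous_tau[OF s0]]) auto
  then have t: "isCont (\<lambda>s. tau (A * s) (B * s)) 1"
    using lt by (simp add: continuous_on_eq_continuous_at)
  have "isCont (\<lambda>s. - (tau (A * s) (B * s) - ln (A * s) * ln (B * s) / ln (A * s * (B * s)))) 1"
    using AB less_1_mult[of A B] by (intro continuous_intros t) auto
  then show ?thesis by (simp add: gam_def)
qed

text \<open>Scales \<open>s > 1\<close> bound the least energy from above and scales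
  \<open>s < 1\<close> from below; the two one-sided limits at \<open>1\<close> coincide.\<close>

lemma gamma_cap_eq_gam:
  assumes AB: "A > 1" "B > 1"
  shows "gamma_cap A B = gam A B"
proof -
  let ?\<phi> = "\<lambda>s. - ln (gam (A * s) (B * s))"
  have lim: "(?\<phi> \<longlongrightarrow> ?\<phi> 1) (at 1)" using isCont_ln_gam[OF AB] by (simp add: isCont_def)
  define e where "e = min_energy (disk1 A \<union> disk2 B)"
  have "e \<le> ereal (?\<phi> 1)"
  proof (rule tendsto_lowerbound)
    show "((\<lambda>s. ereal (?\<phi> s)) \<longlongrightarrow> ereal (?\<phi> 1)) (at_right 1)"
      using lim by (intro tendsto_ereal) (simp add: filterlim_at_split)
    have "e \<le> ereal (?\<phi> s)" if "s > 1" for s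
      unfolding e_def by (rule min_energy_disks_le) (use that AB in auto)
    then show "eventually (\<lambda>s. e \<le> ereal (?\<phi> s)) (at_right 1)"
      by (auto simp: eventually_at_filter intro: always_eventually)
  qed simp
  moreover have "ereal (?\<phi> 1) \<le> e"
  proof (rule tendsto_upperbound)
    show "((\<lambda>s. ereal (?\<phi> s)) \<longlongrightarrow> ereal (?\<phi> 1)) (at_left 1)"
      using lim by (intro tendsto_ereal) (simp add: filterlim_at_split)
    have "eventually (\<lambda>s. s \<in> {max (1 / A) (1 / B)<..<1}) (at_left 1)"
      by (rule eventually_at_left_real) (use AB in auto)
    then show "eventually (\<lambda>s. ereal (?\<phi> s) \<le> e) (at_left 1)"
    proof eventually_elim
      case (elim s)
      have "1 < A * s" "1 < B * s" using elim AB by (auto simp: field_simps)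
      moreover have "A * s < A" "B * s < B" using elim AB by auto
      ultimately show ?case unfolding e_def by (rule min_energy_disks_ge)
    qed
  qed simp
  ultimately have "e = ereal (- ln (gam A B))" by simp
  then show ?thesis
    unfolding gamma_cap_def log_capacity_def e_def[symmetric] using gam_pos[of A B] by simp
qed

section \<open>Orthogonalization, pigeonhole cells and interpolation\<close>

definition ip :: "(nat \<Rightarrow> nat \<Rightarrow> real) \<Rightarrow> nat \<Rightarrow> (nat \<Rightarrow> real) \<Rightarrow> (nat \<Rightarrow> real) \<Rightarrow> real" where
  "ip g N x y = (\<Sum>l<N. \<Sum>m<N. x l * y m * g l m)"

text \<open>Entry \<open>i\<close> of the \<open>k\<close>-th Gram-Schmidt vector for the Gram
  matrix \<open>g\<close>. It involves only rows up to \<open>k\<close>, so one infinite system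
  \<open>gs_h\<close>, \<open>gs_T\<close> serves all degrees \<open>d\<close> at once.\<close>

fun gs :: "(nat \<Rightarrow> nat \<Rightarrow> real) \<Rightarrow> nat \<Rightarrow> nat \<Rightarrow> real" where
  "gs g k = (\<lambda>i. (if i = k then 1 else 0)
     - (\<Sum>j<k. (\<Sum>l<Suc j. gs g j l * g k l) / ip g (Suc j) (gs g j) (gs g j) * gs g j i))"

declare gs.simps[simp del]

definition gs_h :: "(nat \<Rightarrow> nat \<Rightarrow> real) \<Rightarrow> nat \<Rightarrow> real" where
  "gs_h g k = ip g (Suc k) (gs g k) (gs g k)"

definition gs_T :: "(nat \<Rightarrow> nat \<Rightarrow> real) \<Rightarrow> nat \<Rightarrow> nat \<Rightarrow> real" where
  "gs_T g k j = (\<Sum>l<Suc j. gs g j l * g k l) / gs_h g j"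

lemma gs_eq: "gs g k i = (if i = k then 1 else 0) - (\<Sum>j<k. gs_T g k j * gs g j i)"
  by (subst gs.simps) (simp add: gs_T_def gs_h_def)

lemma gs_above: "k < i \<Longrightarrow> gs g k i = 0"
proof (induction k rule: less_induct)
  case (less k)
  then have "(\<Sum>j<k. gs_T g k j * gs g j i) = 0" by (intro sum.neutral) auto
  then show ?case using less.prems by (simp add: gs_eq[of g k i])
qed

lemma gs_diag: "gs g k k = 1"
proof -
  have "(\<Sum>j<k. gs_T g k j * gs g j k) = 0" by (intro sum.neutral) (auto simp: gs_above)
  then show ?thesis by (simp add: gs_eq[of g k k])
qed

lemma ip_ext:
  assumes "a \<le> N" "\<And>l. a \<le> l \<Longrightarrow> x l = 0" "\<And>l. a \<le> l \<Longrightarrow> y l = 0"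
  shows "ip g N x y = ip g a x y"
proof -
  have "ip g N x y = (\<Sum>l<a. \<Sum>m<N. x l * y m * g l m)"
    unfolding ip_def by (rule sum.mono_neutral_right) (use assms in auto)
  also have "\<dots> = ip g a x y"
    unfolding ip_def by (intro sum.cong refl sum.mono_neutral_right) (use assms in auto)
  finally show ?thesis .
qed

lemma ip_sum_left: "ip g N (\<lambda>i. \<Sum>j\<in>J. a j * x j i) y = (\<Sum>j\<in>J. a j * ip g N (x j) y)"
proof -
  have "ip g N (\<lambda>i. \<Sum>j\<in>J. a j * x j i) y = (\<Sum>l<N. \<Sum>m<N. \<Sum>j\<in>J. a j * (x j l * y m * g l m))"
    unfolding ip_def by (intro sum.cong refl) (simp add: sum_distrib_right mult.assoc)
  also have "\<dots> = (\<Sum>l<N. \<Sum>j\<in>J. \<Sum>m<N. a j * (x j l * y m * g l m))"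
    by (intro sum.cong refl sum.swap)
  also have "\<dots> = (\<Sum>j\<in>J. \<Sum>l<N. \<Sum>m<N. a j * (x j l * y m * g l m))"
    by (rule sum.swap)
  finally show ?thesis by (simp add: ip_def sum_distrib_left)
qed

lemma ip_commute:
  assumes "\<And>l m. g l m = g m l"
  shows "ip g N x y = ip g N y x"
proof -
  have "ip g N x y = (\<Sum>m<N. \<Sum>l<N. x l * y m * g l m)" unfolding ip_def by (rule sum.swap)
  also have "\<dots> = ip g N y x" unfolding ip_def by (intro sum.cong refl) (simp add: assms mult.commute)
  finally show ?thesis .
qed

lemma ip_cong: "(\<And>l. l < N \<Longrightarrow> x l = x' l) \<Longrightarrow> (\<And>l. l < N \<Longrightarrow> y l = y' l) \<Longrightarrow> ip g N x y = ip g N x' y'"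
  unfolding ip_def by (intro sum.cong refl) auto

lemma ip_unit_gs:
  assumes "j < N" "k < N"
  shows "ip g N (\<lambda>i. if i = k then 1 else 0) (gs g j) = (\<Sum>l<Suc j. gs g j l * g k l)"
proof -
  have "ip g N (\<lambda>i. if i = k then 1 else 0) (gs g j) = (\<Sum>l<N. if l = k then (\<Sum>m<N. gs g j m * g l m) else 0)"
    unfolding ip_def by (intro sum.cong refl) auto
  also have "\<dots> = (\<Sum>m<N. gs g j m * g k m)" using assms by simp
  also have "\<dots> = (\<Sum>l<Suc j. gs g j l * g k l)"
    by (rule sum.mono_neutral_right) (use assms in \<open>auto simp: gs_above\<close>)
  finally show ?thesis .
qed

lemma ip_gs_diag: "k < N \<Longrightarrow> ip g N (gs g k) (gs g k) = gs_h g k"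
  unfolding gs_h_def by (rule ip_ext) (auto simp: gs_above)

lemma gs_orthogonal:
  assumes sym: "\<And>l m. g l m = g m l" and h: "\<And>j. gs_h g j \<noteq> 0"
  shows "j < k \<Longrightarrow> k < N \<Longrightarrow> ip g N (gs g k) (gs g j) = 0"
proof (induction k arbitrary: j rule: less_induct)
  case (less k)
  have orth: "ip g N (gs g i) (gs g j) = (if i = j then gs_h g j else 0)" if "i < k" for i
  proof (cases i j rule: linorder_cases)
    case less
    then show ?thesis using less.IH[of j i] \<open>j < k\<close> \<open>k < N\<close> ip_commute[of g, OF sym] by auto
  next
    case equal
    then show ?thesis using \<open>j < k\<close> \<open>k < N\<close> by (simp add: ip_gs_diag)
  next
    case greater
    then show ?thesis using less.IH[of i j] that \<open>k < N\<close> by auto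
  qed
  have "ip g N (\<lambda>i. if i = k then 1 else 0) (gs g j)
     = ip g N (\<lambda>i. \<Sum>m\<in>{..<Suc k}. (if m = k then 1 else gs_T g k m) * gs g m i) (gs g j)"
    by (rule ip_cong) (simp_all add: gs_eq[of g k])
  also have "\<dots> = (\<Sum>m<Suc k. (if m = k then 1 else gs_T g k m) * ip g N (gs g m) (gs g j))"
    by (rule ip_sum_left)
  also have "\<dots> = ip g N (gs g k) (gs g j) + (\<Sum>m<k. gs_T g k m * ip g N (gs g m) (gs g j))"
    by simp
  also have "(\<Sum>m<k. gs_T g k m * ip g N (gs g m) (gs g j)) = (\<Sum>m<k. if m = j then gs_T g k j * gs_h g j else 0)"
    by (intro sum.cong refl) (auto simp: orth)
  also have "\<dots> = gs_T g k j * gs_h g j" using less.prems by simp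
  also have "gs_T g k j * gs_h g j = ip g N (\<lambda>i. if i = k then 1 else 0) (gs g j)"
    using h[of j] less.prems by (simp add: gs_T_def ip_unit_gs)
  finally show ?case by simp
qed

text \<open>Solving the recursion for the unit vector \<open>e_k\<close> gives \<open>gs g k\<close>
  plus the terms \<open>gs_T g k j * gs g j\<close>. Collecting these over \<open>k\<close> yields
  the coordinates \<open>tri (gs_T g) n c j\<close>; orthogonality does the rest.\<close>

lemma ip_gs_decomposition:
  assumes sym: "\<And>l m. g l m = g m l" and h: "\<And>j. gs_h g j \<noteq> 0"
  shows "ip g n c c = (\<Sum>j<n. gs_h g j * (tri (gs_T g) n c j)\<^sup>2)"
proof -
  have c: "c i = (\<Sum>j<n. tri (gs_T g) n c j * gs g j i)" if i: "i < n" for i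
  proof -
    have "c i = (\<Sum>k<n. if i = k then c k else 0)" using i by simp
    also have "\<dots> = (\<Sum>k<n. c k * gs g k i + (\<Sum>j<k. c k * gs_T g k j * gs g j i))"
    proof (intro sum.cong refl)
      fix k
      have "(if i = k then 1 else 0) = gs g k i + (\<Sum>j<k. gs_T g k j * gs g j i)"
        using gs_eq[of g k i] by linarith
      then have "c k * (if i = k then 1 else 0) = c k * gs g k i + c k * (\<Sum>j<k. gs_T g k j * gs g j i)"
        by (simp only: distrib_left)
      moreover have "c k * (if i = k then 1 else 0) = (if i = k then c k else 0)" by simp
      ultimately show "(if i = k then c k else 0) = c k * gs g k i + (\<Sum>j<k. c k * gs_T g k j * gs g j i)"
        by (simp only: sum_distrib_left mult.assoc)
    qed
    also have "\<dots> = (\<Sum>k<n. c k * gs g k i) + (\<Sum>k<n. \<Sum>j<k. c k * gs_T g k j * gs g j i)"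
      by (rule sum.distrib)
    also have "(\<Sum>k<n. \<Sum>j<k. c k * gs_T g k j * gs g j i) = (\<Sum>j<n. \<Sum>k\<in>{j<..<n}. c k * gs_T g k j * gs g j i)"
      by (subst sum.Sigma, simp, simp, subst sum.Sigma, simp, simp)
         (rule sum.reindex_bij_witness[of _ "\<lambda>(a, b). (b, a)" "\<lambda>(a, b). (b, a)"], auto)
    also have "(\<Sum>k<n. c k * gs g k i) + \<dots> = (\<Sum>j<n. tri (gs_T g) n c j * gs g j i)"
      by (simp add: tri_def sum.distrib distrib_right sum_distrib_right)
    finally show ?thesis .
  qed
  let ?y = "tri (gs_T g) n c"
  have "ip g n c c = ip g n (\<lambda>i. \<Sum>j<n. ?y j * gs g j i) c" by (rule ip_cong) (use c in auto)
  also have "\<dots> = (\<Sum>j<n. ?y j * ip g n (gs g j) c)" by (rule ip_sum_left)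
  also have "\<dots> = (\<Sum>j<n. ?y j * (?y j * gs_h g j))"
  proof (intro sum.cong refl arg_cong2[where f="(*)"])
    fix j assume j: "j \<in> {..<n}"
    have "ip g n (gs g j) c = ip g n (\<lambda>i. \<Sum>m<n. ?y m * gs g m i) (gs g j)"
      by (subst ip_commute[of g, OF sym]) (rule ip_cong, use c in auto)
    also have "\<dots> = (\<Sum>m<n. ?y m * ip g n (gs g m) (gs g j))" by (rule ip_sum_left)
    also have "\<dots> = (\<Sum>m<n. if m = j then ?y j * gs_h g j else 0)"
    proof (intro sum.cong refl)
      fix m assume m: "m \<in> {..<n}"
      show "?y m * ip g n (gs g m) (gs g j) = (if m = j then ?y j * gs_h g j else 0)"
      proof (cases m j rule: linorder_cases)
        case less
        then show ?thesis using gs_orthogonal[of g, OF sym h, of m j n] j ip_commute[of g, OF sym] by simp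
      next
        case equal
        then show ?thesis using j by (simp add: ip_gs_diag)
      next
        case greater
        then show ?thesis using gs_orthogonal[of g, OF sym h, of j m n] m by simp
      qed
    qed
    also have "\<dots> = ?y j * gs_h g j" using j by simp
    finally show "ip g n (gs g j) c = ?y j * gs_h g j" .
  qed
  finally show ?thesis by (simp add: power2_eq_square algebra_simps)
qed

section \<open>Counting cells, and Newton coefficients from values\<close>

lemma sum_half_powers: "(\<Sum>i\<in>{- int R..int R}. (1 / 2 :: real) ^ nat \<bar>i\<bar>) \<le> 3"
proof -
  have "(\<Sum>i\<in>{- int R..int R}. (1 / 2 :: real) ^ nat \<bar>i\<bar>) = 3 - 2 * (1 / 2) ^ R"
  proof (induction R)
    case (Suc R)
    have "{- int (Suc R)..int (Suc R)} = insert (int (Suc R)) (insert (- int (Suc R)) {- int R..int R})" by auto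
    moreover have "nat (1 + int R) = Suc R" "nat (int R + 1) = Suc R" by auto
    ultimately show ?case using Suc by simp
  qed simp
  then show ?thesis by simp
qed

text \<open>A generating function argument: each vector counted has weight
  \<open>\<Prod>j\<in>J. (1/2) ^ |\<kappa> j|\<close> at least \<open>(1/2) ^ R\<close>, while the
  total weight factors and is at most \<open>3\<close> per index.\<close>

lemma card_bounded_l1:
  assumes J: "finite J"
  shows "finite {\<kappa> \<in> J \<rightarrow>\<^sub>E (UNIV :: int set). (\<Sum>j\<in>J. \<bar>\<kappa> j\<bar>) \<le> int R}"
    and "real (card {\<kappa> \<in> J \<rightarrow>\<^sub>E (UNIV :: int set). (\<Sum>j\<in>J. \<bar>\<kappa> j\<bar>) \<le> int R}) \<le> 2 ^ R * 3 ^ card J"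
proof -
  define K where "K = {\<kappa> \<in> J \<rightarrow>\<^sub>E (UNIV :: int set). (\<Sum>j\<in>J. \<bar>\<kappa> j\<bar>) \<le> int R}"
  define P where "P = J \<rightarrow>\<^sub>E {- int R..int R}"
  have sub: "K \<subseteq> P"
  proof
    fix \<kappa> assume \<kappa>: "\<kappa> \<in> K"
    have "\<kappa> j \<in> {- int R..int R}" if "j \<in> J" for j
    proof -
      have "\<bar>\<kappa> j\<bar> \<le> (\<Sum>j\<in>J. \<bar>\<kappa> j\<bar>)" using that J by (intro member_le_sum) auto
      then show ?thesis using \<kappa> by (auto simp: K_def)
    qed
    then show "\<kappa> \<in> P" using \<kappa> by (auto simp: P_def K_def PiE_def)
  qed
  have fP: "finite P" unfolding P_def using J by (intro finite_PiE) auto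
  then have fK: "finite K" using sub finite_subset by blast
  have "real (card K) * (1 / 2) ^ R \<le> (\<Sum>\<kappa>\<in>K. \<Prod>j\<in>J. (1 / 2) ^ nat \<bar>\<kappa> j\<bar>)"
  proof -
    have "(1 / 2 :: real) ^ R \<le> (\<Prod>j\<in>J. (1 / 2) ^ nat \<bar>\<kappa> j\<bar>)" if "\<kappa> \<in> K" for \<kappa>
    proof -
      have "int (\<Sum>j\<in>J. nat \<bar>\<kappa> j\<bar>) = (\<Sum>j\<in>J. \<bar>\<kappa> j\<bar>)" by simp
      also have "\<dots> \<le> int R" using that by (simp add: K_def)
      finally have "(\<Sum>j\<in>J. nat \<bar>\<kappa> j\<bar>) \<le> R" by linarith
      then show ?thesis by (simp only: power_sum[symmetric]) (rule power_decreasing, auto)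
    qed
    then have "(\<Sum>\<kappa>\<in>K. (1 / 2 :: real) ^ R) \<le> (\<Sum>\<kappa>\<in>K. \<Prod>j\<in>J. (1 / 2) ^ nat \<bar>\<kappa> j\<bar>)" by (rule sum_mono)
    then show ?thesis by simp
  qed
  also have "\<dots> \<le> (\<Sum>\<kappa>\<in>P. \<Prod>j\<in>J. (1 / 2) ^ nat \<bar>\<kappa> j\<bar>)"
    by (rule sum_mono2[OF fP sub]) (simp add: prod_nonneg)
  also have "\<dots> = (\<Prod>j\<in>J. \<Sum>i\<in>{- int R..int R}. (1 / 2) ^ nat \<bar>i\<bar>)"
    unfolding P_def using J by (subst prod_sum_PiE) auto
  also have "\<dots> \<le> (\<Prod>j\<in>J. 3)"
    by (intro prod_mono conjI sum_nonneg sum_half_powers) auto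
  finally have "real (card K) * (1 / 2) ^ R \<le> 3 ^ card J" by simp
  then have c: "real (card K) \<le> 2 ^ R * 3 ^ card J" by (simp add: power_one_over field_simps)
  show "finite {\<kappa> \<in> J \<rightarrow>\<^sub>E (UNIV :: int set). (\<Sum>j\<in>J. \<bar>\<kappa> j\<bar>) \<le> int R}" using fK by (simp add: K_def)
  show "real (card {\<kappa> \<in> J \<rightarrow>\<^sub>E (UNIV :: int set). (\<Sum>j\<in>J. \<bar>\<kappa> j\<bar>) \<le> int R}) \<le> 2 ^ R * 3 ^ card J"
    using c by (simp add: K_def)
qed

text \<open>
  Pigeonhole lower bound for the volume of a section of a cube: the cells given by the integer
  parts of the functionals are contained in translates of the section.
\<close>

lemma emeasure_le_cells:
  fixes f :: "'j \<Rightarrow> (nat \<Rightarrow> real) \<Rightarrow> real"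
  assumes J: "finite J" and S: "S \<in> sets (lebn n)"
    and f[measurable]: "\<And>j. j \<in> J \<Longrightarrow> f j \<in> borel_measurable (lebn n)"
    and diff: "\<And>j x y. j \<in> J \<Longrightarrow> f j (\<lambda>i\<in>{..<n}. x i + - y i) = f j x - f j y"
    and R: "\<And>c. c \<in> S \<Longrightarrow> (\<Sum>j\<in>J. \<bar>\<lfloor>f j c\<rfloor>\<bar>) \<le> int R"
  shows "emeasure (lebn n) S \<le> ennreal (2 ^ R * 3 ^ card J) * emeasure (lebn n) {c \<in> space (lebn n). \<forall>j\<in>J. \<bar>f j c\<bar> \<le> 1}"
proof -
  define F where "F = {\<kappa> \<in> J \<rightarrow>\<^sub>E (UNIV :: int set). (\<Sum>j\<in>J. \<bar>\<kappa> j\<bar>) \<le> int R}"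
  define K where "K = {c \<in> space (lebn n). \<forall>j\<in>J. \<bar>f j c\<bar> \<le> 1}"
  have K: "K \<in> sets (lebn n)" unfolding K_def using J by measurable
  define cell where "cell \<kappa> = {c \<in> S. \<forall>j\<in>J. \<lfloor>f j c\<rfloor> = \<kappa> j}" for \<kappa>
  have Ssp: "S \<subseteq> space (lebn n)" using S by (rule sets.sets_into_space)
  have cell_sets: "cell \<kappa> \<in> sets (lebn n)" for \<kappa>
  proof -
    have "cell \<kappa> = S \<inter> {c \<in> space (lebn n). \<forall>j\<in>J. \<lfloor>f j c\<rfloor> = \<kappa> j}" using Ssp by (auto simp: cell_def)
    moreover have "{c \<in> space (lebn n). \<forall>j\<in>J. \<lfloor>f j c\<rfloor> = \<kappa> j} \<in> sets (lebn n)" using J by measurable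
    ultimately show ?thesis using S by auto
  qed
  have F: "finite F" "real (card F) \<le> 2 ^ R * 3 ^ card J"
    using card_bounded_l1[OF J, of R] by (auto simp: F_def)
  have "S \<subseteq> (\<Union>\<kappa>\<in>F. cell \<kappa>)"
  proof
    fix c assume c: "c \<in> S"
    define \<kappa> where "\<kappa> = (\<lambda>j\<in>J. \<lfloor>f j c\<rfloor>)"
    have "\<kappa> \<in> F" using R[OF c] by (auto simp: F_def \<kappa>_def)
    moreover have "c \<in> cell \<kappa>" using c by (simp add: cell_def \<kappa>_def)
    ultimately show "c \<in> (\<Union>\<kappa>\<in>F. cell \<kappa>)" by blast
  qed
  then have "emeasure (lebn n) S \<le> emeasure (lebn n) (\<Union>\<kappa>\<in>F. cell \<kappa>)"
    using F(1) cell_sets by (intro emeasure_mono) auto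
  also have "\<dots> \<le> (\<Sum>\<kappa>\<in>F. emeasure (lebn n) (cell \<kappa>))"
    using F(1) cell_sets by (intro emeasure_subadditive_finite) auto
  also have "\<dots> \<le> (\<Sum>\<kappa>\<in>F. emeasure (lebn n) K)"
  proof (rule sum_mono)
    fix \<kappa>
    show "emeasure (lebn n) (cell \<kappa>) \<le> emeasure (lebn n) K"
    proof (cases "cell \<kappa> = {}")
      case False
      then obtain c0 where c0: "c0 \<in> cell \<kappa>" by blast
      have "cell \<kappa> \<subseteq> {c \<in> space (lebn n). (\<lambda>i\<in>{..<n}. c i + - c0 i) \<in> K}"
      proof
        fix c assume c: "c \<in> cell \<kappa>"
        have "\<bar>f j (\<lambda>i\<in>{..<n}. c i + - c0 i)\<bar> \<le> 1" if j: "j \<in> J" for j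
        proof -
          have "\<lfloor>f j c\<rfloor> = \<lfloor>f j c0\<rfloor>" using c c0 j by (simp add: cell_def)
          then have "\<bar>f j c - f j c0\<bar> \<le> 1" by linarith
          then show ?thesis by (simp only: diff[OF j])
        qed
        then show "c \<in> {c \<in> space (lebn n). (\<lambda>i\<in>{..<n}. c i + - c0 i) \<in> K}"
          using c Ssp by (auto simp: K_def cell_def space_PiM)
      qed
      moreover have "{c \<in> space (lebn n). (\<lambda>i\<in>{..<n}. c i + - c0 i) \<in> K} \<in> sets (lebn n)"
      proof -
        have "(\<lambda>c. \<lambda>i\<in>{..<n}. c i + - c0 i) \<in> measurable (lebn n) (lebn n)"
          by (rule measurable_restrict) simp
        from measurable_sets[OF this K] show ?thesis by (simp add: vimage_def Int_def conj_commute)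
      qed
      ultimately have "emeasure (lebn n) (cell \<kappa>) \<le> emeasure (lebn n) {c \<in> space (lebn n). (\<lambda>i\<in>{..<n}. c i + - c0 i) \<in> K}"
        by (rule emeasure_mono)
      also have "\<dots> = emeasure (lebn n) K" using emeasure_translate[OF K, of "\<lambda>i. - c0 i"] by simp
      finally show ?thesis .
    qed simp
  qed
  also have "\<dots> = ennreal (real (card F)) * emeasure (lebn n) K" by (simp add: ennreal_of_nat_eq_real_of_nat)
  also have "\<dots> \<le> ennreal (2 ^ R * 3 ^ card J) * emeasure (lebn n) K"
    by (intro mult_right_mono ennreal_leI F(2)) auto
  finally show ?thesis by (simp add: K_def)
qed

text \<open>\<open>c k\<close> is the \<open>k\<close>-th forward difference of the polynomial at
  \<open>0\<close>, and each difference at most doubles the bound.\<close>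

lemma newton_coeff_bound:
  fixes c :: "nat \<Rightarrow> real"
  assumes M: "\<And>i. i \<le> d \<Longrightarrow> \<bar>P_poly d c (real i)\<bar> \<le> M" and k: "k \<le> d"
  shows "\<bar>c k\<bar> \<le> 2 ^ d * M"
proof -
  have M0: "M \<ge> 0" using M[of 0] by linarith
  \<comment> \<open>The sum is the \<open>j\<close>-th forward difference at \<open>i\<close>; it is
    controlled only for \<open>i \<le> d - j\<close>, because it involves the values up to
    \<open>i + j\<close>.\<close>
  have D: "\<bar>\<Sum>k\<le>d - j. c (k + j) * real (i choose k)\<bar> \<le> 2 ^ j * M" if "j \<le> d" "i \<le> d - j" for i j
    using that
  proof (induction j arbitrary: i)
    case 0
    then show ?case using M[of i] by (simp add: P_poly_def binomial_gbinomial)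
  next
    case (Suc j)
    have Dj: "d - j = Suc (d - Suc j)" using Suc.prems by simp
    have "(\<Sum>k\<le>d - j. c (k + j) * real (Suc i choose k)) - (\<Sum>k\<le>d - j. c (k + j) * real (i choose k))
      = (\<Sum>k\<le>d - Suc j. c (k + Suc j) * real (i choose k))"
      unfolding Dj sum.atMost_Suc_shift by (simp add: sum_subtractf[symmetric] algebra_simps)
    moreover have "\<bar>\<Sum>k\<le>d - j. c (k + j) * real (Suc i choose k)\<bar> \<le> 2 ^ j * M" using Suc by simp
    moreover have "\<bar>\<Sum>k\<le>d - j. c (k + j) * real (i choose k)\<bar> \<le> 2 ^ j * M" using Suc by simp
    ultimately show ?case by simp
  qed
  have "\<bar>c k\<bar> \<le> 2 ^ k * M"
  proof -
    have "(\<Sum>m\<le>d - k. c (m + k) * real (0 choose m)) = (\<Sum>m\<le>d - k. if m = 0 then c k else 0)"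
      by (intro sum.cong refl) (auto simp: binomial_eq_0)
    then show ?thesis using D[of k 0] k by simp
  qed
  also have "\<dots> \<le> 2 ^ d * M" using k M0 by (intro mult_right_mono power_increasing) auto
  finally show ?thesis .
qed

section \<open>The quadratic form of the convex bodies\<close>

definition v1 :: "real \<Rightarrow> nat \<Rightarrow> (nat \<Rightarrow> real) \<Rightarrow> nat \<Rightarrow> real" where
  "v1 A d c m = P_poly d c (real m) * inverse A ^ m"

definition v2 :: "real \<Rightarrow> nat \<Rightarrow> (nat \<Rightarrow> real) \<Rightarrow> nat \<Rightarrow> real" where
  "v2 B d c m = P_poly d c (- real m - 1) * inverse B ^ Suc m"

definition Qf :: "real \<Rightarrow> real \<Rightarrow> nat \<Rightarrow> (nat \<Rightarrow> real) \<Rightarrow> real" where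
  "Qf A B d c = (\<Sum>m. (v1 A d c m)\<^sup>2) + (\<Sum>m. (v2 B d c m)\<^sup>2)"

lemma of_real_gbinomial: "complex_of_real (x gchoose k) = (complex_of_real x gchoose k)"
  by (simp add: gbinomial_prod_rev)

lemma Pc_of_real:
  "Pc d (\<lambda>k. complex_of_real (c k)) (of_nat m) = of_real (P_poly d c (real m))"
  "Pc d (\<lambda>k. complex_of_real (c k)) (- of_nat m - 1) = of_real (P_poly d c (- real m - 1))"
  by (simp_all add: Pc_def P_poly_def of_real_gbinomial)

lemma P_poly_Re:
  "P_poly d (\<lambda>k. Re (c k)) (real m) = Re (Pc d c (of_nat m))"
  "P_poly d (\<lambda>k. Re (c k)) (- real m - 1) = Re (Pc d c (- of_nat m - 1))"
proof -
  have *: "Re (c k) * (x gchoose k) = Re (c k * (complex_of_real x gchoose k))" for k x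
    by (simp add: of_real_gbinomial[symmetric])
  show "P_poly d (\<lambda>k. Re (c k)) (real m) = Re (Pc d c (of_nat m))"
    unfolding P_poly_def Pc_def by (simp add: *)
  show "P_poly d (\<lambda>k. Re (c k)) (- real m - 1) = Re (Pc d c (- of_nat m - 1))"
    unfolding P_poly_def Pc_def by (simp add: *)
qed

lemma summable_mult_abs:
  fixes x y :: "nat \<Rightarrow> real"
  assumes x: "summable (\<lambda>m. \<bar>x m\<bar>)" and y: "summable (\<lambda>m. \<bar>y m\<bar>)"
  shows "summable (\<lambda>m. x m * y m)"
proof (rule summable_comparison_test'[where N=0])
  show "summable (\<lambda>m. (\<Sum>m. \<bar>x m\<bar>) * \<bar>y m\<bar>)" by (rule summable_mult[OF y])
  fix m
  have "\<bar>x m\<bar> \<le> (\<Sum>m. \<bar>x m\<bar>)" using sum_le_suminf[OF x, of "{m}"] by simp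
  then show "norm (x m * y m) \<le> (\<Sum>m. \<bar>x m\<bar>) * \<bar>y m\<bar>" by (simp add: abs_mult mult_right_mono)
qed

lemma square_sum_sums:
  fixes \<phi> :: "nat \<Rightarrow> nat \<Rightarrow> real"
  assumes "\<And>k. summable (\<lambda>m. \<bar>\<phi> k m\<bar>)"
  shows "(\<lambda>m. (\<Sum>k<n. c k * \<phi> k m)\<^sup>2) sums (\<Sum>k<n. \<Sum>l<n. c k * c l * (\<Sum>m. \<phi> k m * \<phi> l m))"
proof -
  have "(\<lambda>m. \<Sum>k<n. \<Sum>l<n. c k * c l * (\<phi> k m * \<phi> l m)) sums (\<Sum>k<n. \<Sum>l<n. c k * c l * (\<Sum>m. \<phi> k m * \<phi> l m))"
    by (intro sums_sum sums_mult summable_sums summable_mult_abs assms)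
  moreover have "(\<Sum>k<n. \<Sum>l<n. c k * c l * (\<phi> k m * \<phi> l m)) = (\<Sum>k<n. c k * \<phi> k m)\<^sup>2" for m
    by (simp add: power2_eq_square sum_product algebra_simps)
  ultimately show ?thesis by simp
qed

context
  fixes A B :: real
  assumes AB: "A > 1" "B > 1"
begin

definition ph1 :: "nat \<Rightarrow> nat \<Rightarrow> real" where "ph1 k m = (real m gchoose k) * inverse A ^ m"
definition ph2 :: "nat \<Rightarrow> nat \<Rightarrow> real" where "ph2 k m = ((- real m - 1) gchoose k) * inverse B ^ Suc m"
definition gram :: "nat \<Rightarrow> nat \<Rightarrow> real" where
  "gram k l = (\<Sum>m. ph1 k m * ph1 l m) + (\<Sum>m. ph2 k m * ph2 l m)"

lemma summable_ph1: "summable (\<lambda>m. \<bar>ph1 k m\<bar>)"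
proof -
  have "summable (\<lambda>m. norm (complex_of_nat m gchoose k) * inverse A ^ m)"
    by (rule summable_norm_power_series)
       (use AB in \<open>auto intro: sums_summable[OF gbinomial_sums] simp: inverse_less_1_iff\<close>)
  moreover have "norm (complex_of_nat m gchoose k) = \<bar>real m gchoose k\<bar>" for m
    using of_real_gbinomial[of "real m" k] by (metis norm_of_real of_real_of_nat_eq real_norm_def)
  ultimately show ?thesis using AB by (simp add: ph1_def abs_mult)
qed

lemma summable_ph2: "summable (\<lambda>m. \<bar>ph2 k m\<bar>)"
proof -
  have "summable (\<lambda>m. norm (- complex_of_nat m - 1 gchoose k) * inverse B ^ m)"
  proof (rule summable_norm_power_series)
    fix z :: complex assume z: "norm z < 1"
    have "(\<lambda>n. (- of_nat n - 1 gchoose k) * z ^ n) sums ((-1) ^ k / (1 - z) ^ Suc k)"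
      using sums_mult[OF sums_choose_add[OF z], of "(-1) ^ k" k] by (simp add: gbinomial_neg mult.assoc)
    then show "summable (\<lambda>n. (- of_nat n - 1 gchoose k) * z ^ n)" by (rule sums_summable)
  qed (use AB in \<open>auto simp: inverse_less_1_iff\<close>)
  from summable_mult[OF this, of "inverse B"]
  have "summable (\<lambda>m. inverse B * (norm (- complex_of_nat m - 1 gchoose k) * inverse B ^ m))" .
  moreover have "norm (- complex_of_nat m - 1 gchoose k) = \<bar>- real m - 1 gchoose k\<bar>" for m
  proof -
    have "complex_of_real (- real m - 1 gchoose k) = (- complex_of_nat m - 1 gchoose k)"
      unfolding of_real_gbinomial by simp
    then show ?thesis by (metis norm_of_real real_norm_def)
  qed
  ultimately show ?thesis using AB by (simp add: ph2_def abs_mult algebra_simps)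
qed

lemma v1_ph1: "v1 A d c m = (\<Sum>k<Suc d. c k * ph1 k m)"
  unfolding lessThan_Suc_atMost by (simp add: v1_def P_poly_def ph1_def sum_distrib_right mult.assoc)

lemma v2_ph2: "v2 B d c m = (\<Sum>k<Suc d. c k * ph2 k m)"
  unfolding lessThan_Suc_atMost by (simp add: v2_def P_poly_def ph2_def sum_distrib_right mult.assoc)

lemma summable_v: "summable (\<lambda>m. (v1 A d c m)\<^sup>2)" "summable (\<lambda>m. (v2 B d c m)\<^sup>2)"
  unfolding v1_ph1 v2_ph2
  by (rule sums_summable[OF square_sum_sums[OF summable_ph1]], rule sums_summable[OF square_sum_sums[OF summable_ph2]])

lemma Qf_ip: "Qf A B d c = ip gram (Suc d) c c"
proof -
  have "Qf A B d c = (\<Sum>k<Suc d. \<Sum>l<Suc d. c k * c l * (\<Sum>m. ph1 k m * ph1 l m)) + (\<Sum>k<Suc d. \<Sum>l<Suc d. c k * c l * (\<Sum>m. ph2 k m * ph2 l m))"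
    unfolding Qf_def v1_ph1 v2_ph2
    by (intro arg_cong2[where f="(+)"] sums_unique[symmetric] square_sum_sums summable_ph1 summable_ph2)
  then show ?thesis by (simp only: ip_def gram_def distrib_left sum.distrib)
qed

lemma partial_v_le: "(\<Sum>m<N. (v1 A d c m)\<^sup>2) \<le> Qf A B d c" "(\<Sum>m<N. (v2 B d c m)\<^sup>2) \<le> Qf A B d c"
proof -
  have 0: "0 \<le> (\<Sum>m. (v1 A d c m)\<^sup>2)" "0 \<le> (\<Sum>m. (v2 B d c m)\<^sup>2)"
    by (intro suminf_nonneg summable_v; simp)+
  have "(\<Sum>m<N. (v1 A d c m)\<^sup>2) \<le> (\<Sum>m. (v1 A d c m)\<^sup>2)" by (intro sum_le_suminf summable_v) auto
  then show "(\<Sum>m<N. (v1 A d c m)\<^sup>2) \<le> Qf A B d c" using 0 by (simp add: Qf_def)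
  have "(\<Sum>m<N. (v2 B d c m)\<^sup>2) \<le> (\<Sum>m. (v2 B d c m)\<^sup>2)" by (intro sum_le_suminf summable_v) auto
  then show "(\<Sum>m<N. (v2 B d c m)\<^sup>2) \<le> Qf A B d c" using 0 by (simp add: Qf_def)
qed

lemma Qf_lower:
  assumes "c k = 1"
  shows "(gam A B ^ k)\<^sup>2 / (1 + B)\<^sup>2 \<le> Qf A B k c"
proof -
  have "gam A B ^ k \<le> sqrt (Qf A B k c) * (1 + B)"
  proof (rule gam_lower_L2[OF AB, of "\<lambda>k. complex_of_real (c k)"])
    show "(\<Sum>n<N. (norm (Pc k (\<lambda>k. complex_of_real (c k)) (of_nat n)) * inverse A ^ n)\<^sup>2) \<le> Qf A B k c" for N
      using partial_v_le(1)[of k c N] by (simp add: Pc_of_real v1_def power_mult_distrib)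
    show "(\<Sum>n<N. (norm (Pc k (\<lambda>k. complex_of_real (c k)) (- of_nat n - 1)) * inverse B ^ Suc n)\<^sup>2) \<le> Qf A B k c" for N
      using partial_v_le(2)[of k c N] by (simp only: Pc_of_real v2_def power_mult_distrib norm_of_real power2_abs)
  qed (use assms in simp)
  then have "(gam A B ^ k)\<^sup>2 \<le> (sqrt (Qf A B k c) * (1 + B))\<^sup>2"
    using gam_pos[of A B] by (intro power_mono) auto
  also have "\<dots> = Qf A B k c * (1 + B)\<^sup>2" using partial_v_le(1)[of k c 0] by (simp add: power_mult_distrib)
  finally show ?thesis using AB by (simp add: divide_le_eq)
qed

text \<open>Real parts of the coefficients keep the leading \<open>1\<close> and do not increase the
  modulus of the values at integers. The factor \<open>2\<close> counts the two series.\<close>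

lemma Qf_upper:
  obtains C where "C > 0" "\<And>k. \<exists>c. c k = 1 \<and> Qf A B k c \<le> C * (gam A B ^ k)\<^sup>2"
proof -
  obtain C where C: "C > 0"
    "\<And>k. \<exists>c. c k = 1 \<and> (\<forall>N. (\<Sum>n<N. (norm (Pc k c (of_nat n)) * inverse A ^ n)\<^sup>2) \<le> C * (gam A B ^ k)\<^sup>2)
     \<and> (\<forall>N. (\<Sum>n<N. (norm (Pc k c (- of_nat n - 1)) * inverse B ^ Suc n)\<^sup>2) \<le> C * (gam A B ^ k)\<^sup>2)"
    using gam_upper_L2[OF AB] by blast
  show ?thesis
  proof (rule that[of "2 * C"])
    show "2 * C > 0" using C by simp
    fix k
    from C(2)[of k] obtain c where c: "c k = 1"
      "\<And>N. (\<Sum>n<N. (norm (Pc k c (of_nat n)) * inverse A ^ n)\<^sup>2) \<le> C * (gam A B ^ k)\<^sup>2"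
      "\<And>N. (\<Sum>n<N. (norm (Pc k c (- of_nat n - 1)) * inverse B ^ Suc n)\<^sup>2) \<le> C * (gam A B ^ k)\<^sup>2" by blast
    define c' where "c' k = Re (c k)" for k
    have "(v1 A k c' n)\<^sup>2 \<le> (norm (Pc k c (of_nat n)) * inverse A ^ n)\<^sup>2" for n
    proof -
      have "\<bar>Re (Pc k c (of_nat n))\<bar>\<^sup>2 \<le> (norm (Pc k c (of_nat n)))\<^sup>2" by (intro power_mono abs_Re_le_cmod) simp
      then show ?thesis unfolding v1_def c'_def P_poly_Re power_mult_distrib by (intro mult_right_mono) auto
    qed
    then have "(\<Sum>n<N. (v1 A k c' n)\<^sup>2) \<le> C * (gam A B ^ k)\<^sup>2" for N
      by (intro order_trans[OF sum_mono c(2)])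
    then have 1: "(\<Sum>n. (v1 A k c' n)\<^sup>2) \<le> C * (gam A B ^ k)\<^sup>2"
      by (intro suminf_le_const summable_v)
    have "(v2 B k c' n)\<^sup>2 \<le> (norm (Pc k c (- of_nat n - 1)) * inverse B ^ Suc n)\<^sup>2" for n
    proof -
      have "\<bar>Re (Pc k c (- of_nat n - 1))\<bar>\<^sup>2 \<le> (norm (Pc k c (- of_nat n - 1)))\<^sup>2" by (intro power_mono abs_Re_le_cmod) simp
      then show ?thesis unfolding v2_def c'_def P_poly_Re power_mult_distrib by (intro mult_right_mono) auto
    qed
    then have "(\<Sum>n<N. (v2 B k c' n)\<^sup>2) \<le> C * (gam A B ^ k)\<^sup>2" for N
      by (intro order_trans[OF sum_mono c(3)])
    then have "(\<Sum>n. (v2 B k c' n)\<^sup>2) \<le> C * (gam A B ^ k)\<^sup>2"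
      by (intro suminf_le_const summable_v)
    then have "Qf A B k c' \<le> 2 * C * (gam A B ^ k)\<^sup>2" using 1 by (simp add: Qf_def)
    then show "\<exists>c. c k = 1 \<and> Qf A B k c \<le> 2 * C * (gam A B ^ k)\<^sup>2"
      using c(1) by (intro exI[of _ c']) (simp add: c'_def)
  qed
qed

text \<open>\<open>h k\<close> is the least value of the form over leading coefficient
  \<open>1\<close>: attained by the Gram-Schmidt vector, which gives the lower bound, and below the
  form of every competitor, which gives the upper bound.\<close>

lemma Qf_diagonalization:
  obtains h T K where "K \<ge> 1" "\<And>k. (gam A B ^ k)\<^sup>2 / K \<le> h k" "\<And>k. h k \<le> K * (gam A B ^ k)\<^sup>2"
    "\<And>d c. Qf A B d c = ellq h T (Suc d) c"
proof -
  obtain C where C: "C > 0" "\<And>k. \<exists>c. c k = 1 \<and> Qf A B k c \<le> C * (gam A B ^ k)\<^sup>2"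
    using Qf_upper by blast
  define K where "K = max ((1 + B)\<^sup>2) C"
  have B1: "1 \<le> (1 + B)\<^sup>2" using AB by (intro one_le_power) simp
  have g0: "(gam A B ^ k)\<^sup>2 > 0" for k using gam_pos[of A B] by simp
  have low: "(gam A B ^ k)\<^sup>2 / (1 + B)\<^sup>2 \<le> gs_h gram k" for k
    using Qf_lower[of "gs gram k" k] by (simp add: gs_diag gs_h_def Qf_ip)
  have pos: "gs_h gram k > 0" for k
    by (rule less_le_trans[OF _ low]) (use g0[of k] AB in auto)
  have sym: "gram l m = gram m l" for l m by (simp add: gram_def mult.commute)
  have Q: "Qf A B d c = ellq (gs_h gram) (gs_T gram) (Suc d) c" for d c
    unfolding Qf_ip ellq_def by (rule ip_gs_decomposition[OF sym less_imp_neq[OF pos, THEN not_sym]])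
  show ?thesis
  proof (rule that[of K "gs_h gram" "gs_T gram"])
    show "K \<ge> 1" using B1 by (simp add: K_def)
    show "(gam A B ^ k)\<^sup>2 / K \<le> gs_h gram k" for k
    proof -
      have "(gam A B ^ k)\<^sup>2 / K \<le> (gam A B ^ k)\<^sup>2 / (1 + B)\<^sup>2"
        using B1 g0[of k] by (intro divide_left_mono) (auto simp: K_def intro!: mult_pos_pos)
      then show ?thesis using low[of k] by linarith
    qed
    show "gs_h gram k \<le> K * (gam A B ^ k)\<^sup>2" for k
    proof -
      obtain c where c: "c k = 1" "Qf A B k c \<le> C * (gam A B ^ k)\<^sup>2" using C(2) by blast
      \<comment> \<open>The top coordinate of a competitor is its leading coefficient, so its form
        contains the full term \<open>h k\<close>.\<close>
      have "{k<..<Suc k} = {}" by auto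
      then have "tri (gs_T gram) (Suc k) c k = 1" using c(1) by (simp add: tri_def)
      then have "gs_h gram k = gs_h gram k * (tri (gs_T gram) (Suc k) c k)\<^sup>2" by simp
      also have "\<dots> \<le> ellq (gs_h gram) (gs_T gram) (Suc k) c"
        unfolding ellq_def using pos
        by (intro member_le_sum[where f="\<lambda>j. gs_h gram j * (tri (gs_T gram) (Suc k) c j)\<^sup>2"])
           (auto intro!: mult_nonneg_nonneg less_imp_le[OF pos])
      also have "\<dots> \<le> C * (gam A B ^ k)\<^sup>2" using c(2) by (simp add: Q)
      also have "\<dots> \<le> K * (gam A B ^ k)\<^sup>2" using g0[of k] by (intro mult_right_mono) (auto simp: K_def)
      finally show ?thesis .
    qed
  qed (rule Q)
qed

section \<open>Exponential decay of the functionals\<close>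

text \<open>The \<open>d + 1\<close> values at \<open>0, ..., d\<close> bound all Newton
  coefficients, hence the growth of the polynomial in both directions. That growth can be kept below
  \<open>sqrt A ^ m\<close> and \<open>sqrt B ^ m\<close> at the price of a factor exponential in
  \<open>d\<close>, so half of each exponential weight remains as decay.\<close>

lemma v_decay:
  obtains L \<rho> where "L \<ge> 1" "0 < \<rho>" "\<rho> < 1"
    "\<And>d c t m. (\<And>i. i \<le> d \<Longrightarrow> \<bar>v1 A d c i\<bar> \<le> t) \<Longrightarrow> \<bar>v1 A d c m\<bar> \<le> t * L ^ d * \<rho> ^ m \<and> \<bar>v2 B d c m\<bar> \<le> t * L ^ d * \<rho> ^ m"
proof -
  define a b where "a = sqrt A" and "b = sqrt B"
  have ab: "a > 1" "b > 1" "a * a = A" "b * b = B" using AB by (auto simp: a_def b_def)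
  \<comment> \<open>Binomial sums with weights \<open>x ^ k\<close> are at most
    \<open>(1 + x) ^ m\<close> and \<open>(1 - x) ^ - (m + 1)\<close>; \<open>x\<close> is small
    enough for these to stay below the powers of \<open>a = sqrt A\<close> and
    \<open>b = sqrt B\<close>.\<close>
  define x where "x = min 1 (min (a - 1) (1 - inverse b)) / 2"
  have ib: "inverse b < 1" "inverse b > 0" using ab by (auto simp: inverse_less_1_iff)
  have x: "0 < x" "x < 1" "1 + x \<le> a" "inverse (1 - x) \<le> b"
  proof -
    have le: "x \<le> 1 / 2" "x \<le> (a - 1) / 2" "x \<le> (1 - inverse b) / 2" by (auto simp: x_def)
    show "0 < x" using ab ib by (simp add: x_def)
    show "x < 1" using le(1) by simp
    show "1 + x \<le> a" using le(2) ab(1) by (simp add: field_simps)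
    have gen: "v \<le> 1 - w" if "w \<le> (1 - v) / 2" "v < 1" for v w :: real using that by (simp add: field_simps)
    have "inverse b \<le> 1 - x" by (rule gen[OF le(3) ib(1)])
    then have "inverse (1 - x) \<le> inverse (inverse b)" using ib by (intro le_imp_inverse_le) auto
    then show "inverse (1 - x) \<le> b" by simp
  qed
  define \<rho> where "\<rho> = max (inverse a) (inverse b)"
  have \<rho>: "0 < \<rho>" "\<rho> < 1" "inverse a \<le> \<rho>" "inverse b \<le> \<rho>"
    using ab ib by (auto simp: \<rho>_def inverse_less_1_iff less_max_iff_disj)
  \<comment> \<open>The \<open>2\<close> comes from the finite differences, the \<open>A\<close>
    from the weights of the first \<open>d + 1\<close> values, and \<open>1 / x\<close> from
    inserting \<open>x ^ k / x ^ d \<ge> 1\<close>.\<close>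
  define L where "L = 2 * A / x"
  have L: "L \<ge> 1" using AB x by (simp add: L_def field_simps)
  show ?thesis
  proof (rule that[of L \<rho>])
    fix d :: nat and c :: "nat \<Rightarrow> real" and t :: real and m :: nat
    assume t: "\<And>i. i \<le> d \<Longrightarrow> \<bar>v1 A d c i\<bar> \<le> t"
    have t0: "t \<ge> 0" using t[of 0] by linarith
    have ck: "\<bar>c k\<bar> \<le> 2 ^ d * (t * A ^ d)" if "k \<le> d" for k
    proof (rule newton_coeff_bound[OF _ that])
      fix i assume i: "i \<le> d"
      have "\<bar>P_poly d c (real i)\<bar> = \<bar>v1 A d c i\<bar> * A ^ i" using AB by (simp add: v1_def abs_mult power_inverse)
      also have "\<dots> \<le> t * A ^ d" using t[OF i] i AB t0 by (intro mult_mono power_increasing) auto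
      finally show "\<bar>P_poly d c (real i)\<bar> \<le> t * A ^ d" .
    qed
    have gen: "(\<Sum>k\<le>d. \<bar>c k\<bar> * y k) \<le> t * L ^ d * (\<Sum>k\<le>d. y k * x ^ k)" if "\<And>k. 0 \<le> y k" for y
    proof -
      have "\<bar>c k\<bar> * y k \<le> t * L ^ d * (y k * x ^ k)" if k: "k \<le> d" for k
      proof -
        have "\<bar>c k\<bar> * y k \<le> (2 ^ d * (t * A ^ d)) * y k" using ck[OF k] \<open>0 \<le> y k\<close> by (rule mult_right_mono)
        also have "\<dots> \<le> (2 ^ d * (t * A ^ d)) * (y k * (x ^ k / x ^ d))"
        proof -
          have "1 \<le> x ^ k / x ^ d" using x k by (simp add: power_decreasing)
          then have "y k * 1 \<le> y k * (x ^ k / x ^ d)" using \<open>0 \<le> y k\<close> by (rule mult_left_mono)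
          then show ?thesis using t0 AB by (intro mult_left_mono) auto
        qed
        also have "\<dots> = t * L ^ d * (y k * x ^ k)" by (simp add: L_def power_divide power_mult_distrib)
        finally show ?thesis .
      qed
      then show ?thesis unfolding sum_distrib_left by (intro sum_mono) auto
    qed
    have tL: "0 \<le> t * L ^ d" using t0 L by simp
    have "\<bar>v1 A d c m\<bar> \<le> t * L ^ d * \<rho> ^ m"
    proof -
      have "\<bar>P_poly d c (real m)\<bar> \<le> (\<Sum>k\<le>d. \<bar>c k\<bar> * real (m choose k))"
        unfolding P_poly_def by (rule order_trans[OF sum_abs]) (simp add: abs_mult binomial_gbinomial[symmetric])
      also have "\<dots> \<le> t * L ^ d * (\<Sum>k\<le>d. real (m choose k) * x ^ k)" by (rule gen) simp
      also have "(\<Sum>k\<le>d. real (m choose k) * x ^ k) \<le> (1 + x) ^ m"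
      proof -
        have "(\<Sum>k\<le>d. real (m choose k) * x ^ k) \<le> (\<Sum>k\<le>max d m. real (m choose k) * x ^ k)"
          using x by (intro sum_mono2) auto
        also have "\<dots> = (\<Sum>k\<le>m. real (m choose k) * x ^ k)"
          by (intro sum.mono_neutral_right) auto
        also have "\<dots> = (x + 1) ^ m" by (simp add: binomial_ring)
        finally show ?thesis by (simp add: add.commute)
      qed
      also have "(1 + x) ^ m \<le> a ^ m" using x by (intro power_mono) auto
      finally have P: "\<bar>P_poly d c (real m)\<bar> \<le> t * L ^ d * a ^ m" using tL by (simp add: mult_left_mono)
      have "\<bar>v1 A d c m\<bar> = \<bar>P_poly d c (real m)\<bar> * inverse A ^ m" using AB by (simp add: v1_def abs_mult)
      also have "\<dots> \<le> (t * L ^ d * a ^ m) * inverse A ^ m" using P AB by (intro mult_right_mono) auto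
      also have "\<dots> = t * L ^ d * inverse a ^ m"
        using ab(1) by (simp add: ab(3)[symmetric] power_mult_distrib power_inverse)
      also have "\<dots> \<le> t * L ^ d * \<rho> ^ m" using \<rho> ab tL by (intro mult_left_mono power_mono) auto
      finally show ?thesis .
    qed
    moreover have "\<bar>v2 B d c m\<bar> \<le> t * L ^ d * \<rho> ^ m"
    proof -
      have "\<bar>P_poly d c (- real m - 1)\<bar> \<le> (\<Sum>k\<le>d. \<bar>c k\<bar> * real ((m + k) choose k))"
        unfolding P_poly_def by (rule order_trans[OF sum_abs]) (simp add: abs_mult gbinomial_neg power_abs)
      also have "\<dots> \<le> t * L ^ d * (\<Sum>k\<le>d. real ((m + k) choose k) * x ^ k)" by (rule gen) simp
      also have "(\<Sum>k\<le>d. real ((m + k) choose k) * x ^ k) \<le> 1 / (1 - x) ^ Suc m"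
      proof -
        have "(\<lambda>k. of_nat ((k + m) choose m) * complex_of_real x ^ k) sums (1 / (1 - complex_of_real x) ^ Suc m)"
          by (rule sums_choose_add) (use x in simp)
        then have "(\<lambda>k. complex_of_real (real ((k + m) choose m) * x ^ k)) sums complex_of_real (1 / (1 - x) ^ Suc m)"
          by simp
        then have s: "(\<lambda>k. real ((k + m) choose m) * x ^ k) sums (1 / (1 - x) ^ Suc m)" by (simp only: sums_of_real_iff)
        have "(\<Sum>k\<le>d. real ((k + m) choose m) * x ^ k) \<le> (\<Sum>k. real ((k + m) choose m) * x ^ k)"
          using x by (intro sum_le_suminf sums_summable[OF s]) auto
        also have "\<dots> = 1 / (1 - x) ^ Suc m" using s by (simp add: sums_iff)
        also have "(\<Sum>k\<le>d. real ((k + m) choose m) * x ^ k) = (\<Sum>k\<le>d. real ((m + k) choose k) * x ^ k)"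
        proof (intro sum.cong refl)
          fix k
          have "(k + m) choose m = (m + k) choose k" using binomial_symmetric[of m "k + m"] by (simp add: add.commute)
          then show "real ((k + m) choose m) * x ^ k = real ((m + k) choose k) * x ^ k" by simp
        qed
        finally show ?thesis .
      qed
      also have "1 / (1 - x) ^ Suc m \<le> b ^ Suc m"
      proof -
        have "inverse (1 - x) ^ Suc m \<le> b ^ Suc m" using x by (intro power_mono) auto
        then show ?thesis by (simp only: inverse_eq_divide power_one_over)
      qed
      finally have P: "\<bar>P_poly d c (- real m - 1)\<bar> \<le> t * L ^ d * b ^ Suc m" using tL by (simp add: mult_left_mono)
      have "\<bar>v2 B d c m\<bar> = \<bar>P_poly d c (- real m - 1)\<bar> * inverse B ^ Suc m" using AB by (simp add: v2_def abs_mult)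
      also have "\<dots> \<le> (t * L ^ d * b ^ Suc m) * inverse B ^ Suc m" using P AB by (intro mult_right_mono) auto
      also have "\<dots> = t * L ^ d * inverse b ^ Suc m"
      proof -
        have "b * inverse B = inverse b" using ab(2) by (simp add: ab(4)[symmetric])
        then show ?thesis by (simp only: mult.assoc power_mult_distrib[symmetric])
      qed
      also have "\<dots> \<le> t * L ^ d * \<rho> ^ Suc m" using \<rho> ab tL ib by (intro mult_left_mono power_mono) auto
      also have "\<dots> \<le> t * L ^ d * \<rho> ^ m" using \<rho> tL by (intro mult_left_mono power_decreasing) auto
      finally show ?thesis .
    qed
    ultimately show "\<bar>v1 A d c m\<bar> \<le> t * L ^ d * \<rho> ^ m \<and> \<bar>v2 B d c m\<bar> \<le> t * L ^ d * \<rho> ^ m" ..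
  qed (use L \<rho> in auto)
qed

text \<open>Beyond index \<open>N * d\<close> the decay has absorbed the factor
  \<open>L ^ d\<close>, and the values are at most \<open>t * \<rho> ^ i\<close>. So
  \<open>O(d)\<close> functionals decide membership in the sup-norm body, and there the form is at
  most a constant times \<open>d * t\<^sup>2\<close>.\<close>

lemma v_concentration:
  obtains N K where "N \<ge> 1" "K > 0"
    "\<And>d c t. d \<ge> 1 \<Longrightarrow> (\<And>m. m \<le> N * d \<Longrightarrow> \<bar>v1 A d c m\<bar> \<le> t \<and> \<bar>v2 B d c m\<bar> \<le> t)
      \<Longrightarrow> (\<forall>m. \<bar>v1 A d c m\<bar> \<le> t \<and> \<bar>v2 B d c m\<bar> \<le> t) \<and> Qf A B d c \<le> K * d * t\<^sup>2"
proof -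
  obtain L \<rho> where L: "L \<ge> 1" and \<rho>: "0 < \<rho>" "\<rho> < 1"
    and dec: "\<And>d c t m. (\<And>i. i \<le> d \<Longrightarrow> \<bar>v1 A d c i\<bar> \<le> t) \<Longrightarrow> \<bar>v1 A d c m\<bar> \<le> t * L ^ d * \<rho> ^ m \<and> \<bar>v2 B d c m\<bar> \<le> t * L ^ d * \<rho> ^ m"
    using v_decay by blast
  obtain N0 where N0: "\<rho> ^ N0 < 1 / L" using real_arch_pow_inv[of "1 / L" \<rho>] L \<rho> by auto
  \<comment> \<open>The successor ensures \<open>d \<le> N * d\<close>, so that the assumed range
    contains the indices required for the decay.\<close>
  define N where "N = Suc N0"
  have N: "L * \<rho> ^ N \<le> 1"
  proof -
    have "\<rho> ^ N \<le> \<rho> ^ N0" using \<rho> by (intro power_decreasing) (auto simp: N_def)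
    then have "\<rho> ^ N \<le> 1 / L" using N0 by simp
    then show ?thesis using L by (simp add: field_simps)
  qed
  define G where "G = 1 / (1 - \<rho>\<^sup>2)"
  have r2: "\<rho>\<^sup>2 < 1" using \<rho> by (simp add: power_less_one_iff)
  then have G: "G > 0" by (simp add: G_def)
  show ?thesis
  proof (rule that[of N "2 * (real N + G)"])
    show "N \<ge> 1" by (simp add: N_def)
    show "2 * (real N + G) > 0" using G by simp
    fix d :: nat and c :: "nat \<Rightarrow> real" and t :: real
    assume d: "d \<ge> 1" and small: "\<And>m. m \<le> N * d \<Longrightarrow> \<bar>v1 A d c m\<bar> \<le> t \<and> \<bar>v2 B d c m\<bar> \<le> t"
    have t0: "t \<ge> 0" using small[of 0] by linarith
    have "d \<le> N * d" by (simp add: N_def)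
    then have init: "\<bar>v1 A d c i\<bar> \<le> t" if "i \<le> d" for i using small[OF order_trans[OF that \<open>d \<le> N * d\<close>]] by simp
    have tail: "t * L ^ d * \<rho> ^ (i + N * d) \<le> t * \<rho> ^ i" for i
    proof -
      have "t * L ^ d * \<rho> ^ (i + N * d) = t * \<rho> ^ i * (L * \<rho> ^ N) ^ d"
        by (simp add: power_add power_mult power_mult_distrib)
      also have "\<dots> \<le> t * \<rho> ^ i * 1"
        using t0 \<rho> N L by (intro mult_left_mono power_le_one) auto
      finally show ?thesis by simp
    qed
    have tl: "\<bar>v1 A d c (i + N * d)\<bar> \<le> t * \<rho> ^ i" "\<bar>v2 B d c (i + N * d)\<bar> \<le> t * \<rho> ^ i" for i
      using dec[OF init, of "i + N * d"] tail[of i] by auto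
    have all: "\<bar>v1 A d c m\<bar> \<le> t \<and> \<bar>v2 B d c m\<bar> \<le> t" for m
    proof (cases "m \<le> N * d")
      case False
      then obtain i where i: "m = i + N * d" by (metis le_Suc_ex nat_le_linear add.commute)
      have "t * \<rho> ^ i \<le> t * 1" using t0 \<rho> by (intro mult_left_mono power_le_one) auto
      then show ?thesis unfolding i using tl[of i] by auto
    qed (rule small)
    have sb: "(\<Sum>m. (v m)\<^sup>2) \<le> (real N * d + G) * t\<^sup>2"
      if sv: "summable (\<lambda>m. (v m)\<^sup>2)" and v: "\<And>m. \<bar>v m\<bar> \<le> t" "\<And>i. \<bar>v (i + N * d)\<bar> \<le> t * \<rho> ^ i" for v
    proof -
      have "(\<Sum>m. (v m)\<^sup>2) = (\<Sum>i. (v (i + N * d))\<^sup>2) + (\<Sum>i<N * d. (v i)\<^sup>2)"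
        by (rule suminf_split_initial_segment[OF sv])
      also have "(\<Sum>i<N * d. (v i)\<^sup>2) \<le> (\<Sum>i<N * d. t\<^sup>2)"
      proof (rule sum_mono)
        fix i
        show "(v i)\<^sup>2 \<le> t\<^sup>2" using power_mono[OF v(1)[of i] abs_ge_zero, of 2] by simp
      qed
      also have "(\<Sum>i. (v (i + N * d))\<^sup>2) \<le> (\<Sum>i. t\<^sup>2 * (\<rho>\<^sup>2) ^ i)"
      proof (rule suminf_le)
        show "(v (i + N * d))\<^sup>2 \<le> t\<^sup>2 * (\<rho>\<^sup>2) ^ i" for i
          using power_mono[OF v(2)[of i] abs_ge_zero, of 2] by (simp add: power_mult_distrib power_mult[symmetric] mult.commute)
        show "summable (\<lambda>i. (v (i + N * d))\<^sup>2)" using sv by (rule summable_ignore_initial_segment)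
        show "summable (\<lambda>i. t\<^sup>2 * (\<rho>\<^sup>2) ^ i)" using r2 by (intro summable_mult summable_geometric) simp
      qed
      also have "(\<Sum>i. t\<^sup>2 * (\<rho>\<^sup>2) ^ i) = t\<^sup>2 * G"
        using r2 by (subst suminf_mult) (auto intro!: summable_geometric simp: suminf_geometric G_def)
      finally show ?thesis by (simp add: algebra_simps)
    qed
    have "Qf A B d c \<le> (real N * d + G) * t\<^sup>2 + (real N * d + G) * t\<^sup>2"
      unfolding Qf_def by (intro add_mono sb summable_v tl) (use all in auto)
    also have "\<dots> = 2 * ((real N * d + G) * t\<^sup>2)" by simp
    also have "\<dots> \<le> 2 * ((real N * d + G * d) * t\<^sup>2)"
      using d G by (intro mult_left_mono mult_right_mono add_mono) auto
    also have "\<dots> = 2 * (real N + G) * d * t\<^sup>2" by (simp add: algebra_simps)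
    finally show "(\<forall>m. \<bar>v1 A d c m\<bar> \<le> t \<and> \<bar>v2 B d c m\<bar> \<le> t) \<and> Qf A B d c \<le> 2 * (real N + G) * d * t\<^sup>2"
      using all by blast
  qed
qed

end

section \<open>Volumes and lattice points\<close>

lemma C_two_eq:
  assumes AB: "A > 1" "B > 1"
  shows "C_two A B d t = {c \<in> space (lebn (Suc d)). (\<Sum>m. (v1 A d c m)\<^sup>2) \<le> t\<^sup>2 \<and> (\<Sum>m. (v2 B d c m)\<^sup>2) \<le> t\<^sup>2}"
proof -
  have pw: "X powi (- 2 * int n) = (inverse X ^ n)\<^sup>2" for X :: real and n
  proof -
    have "X powi (- 2 * int n) = X powi (- int (2 * n))" by simp
    also have "\<dots> = inverse (X ^ (2 * n))" by (simp only: power_int_minus power_int_of_nat)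
    also have "\<dots> = (inverse X ^ n)\<^sup>2" by (simp add: power_inverse power_mult[symmetric] mult.commute)
    finally show ?thesis .
  qed
  have 1: "(\<Sum>n. ennreal (\<bar>P_poly d c (real n)\<bar>\<^sup>2 * A powi (- 2 * int n))) = ennreal (\<Sum>m. (v1 A d c m)\<^sup>2)" for c
    unfolding pw by (subst suminf_ennreal2[OF _ summable_v(1)[OF AB], symmetric]) (simp_all add: v1_def power_mult_distrib)
  have arg: "- real (Suc n) = - real n - 1" for n by simp
  have 2: "(\<Sum>n. ennreal (\<bar>P_poly d c (- real (Suc n))\<bar>\<^sup>2 * B powi (- 2 * int (Suc n)))) = ennreal (\<Sum>m. (v2 B d c m)\<^sup>2)" for c
    unfolding pw arg
    by (subst suminf_ennreal2[OF _ summable_v(2)[OF AB], symmetric], simp)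
       (simp only: v2_def power_mult_distrib power2_abs)
  show ?thesis
    unfolding C_two_def 1 2 by (simp add: space_PiM lessThan_Suc_atMost ennreal_le_iff)
qed

lemma C_sup_eq:
  assumes "t > 0" and AB: "A > 1" "B > 1"
  shows "C_sup A B d t = {c \<in> space (lebn (Suc d)). \<forall>m. \<bar>v1 A d c m\<bar> \<le> t \<and> \<bar>v2 B d c m\<bar> \<le> t}"
proof -
  have pw: "X powi (- int n) = inverse X ^ n" for X :: real and n
    by (simp only: power_int_minus power_int_of_nat power_inverse)
  have 1: "(SUP n::nat. ennreal \<bar>P_poly d c (real n) * A powi (- int n)\<bar>) \<le> ennreal t \<longleftrightarrow> (\<forall>m. \<bar>v1 A d c m\<bar> \<le> t)" for c
    unfolding pw using assms by (auto simp: SUP_le_iff v1_def)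
  have im: "{1::nat..} = range Suc" by (auto simp: image_iff) (metis Suc_le_D)
  have arg: "- real (Suc n) = - real n - 1" for n by simp
  have 2: "(SUP n\<in>{1::nat..}. ennreal \<bar>P_poly d c (- real n) * B powi (- int n)\<bar>) \<le> ennreal t \<longleftrightarrow> (\<forall>m. \<bar>v2 B d c m\<bar> \<le> t)" for c
    unfolding im image_image SUP_le_iff ball_UNIV pw arg v2_def
    by (rule all_cong1, subst ennreal_le_iff) (use assms in auto)
  show ?thesis
    unfolding C_sup_def 1 2 by (auto simp: space_PiM lessThan_Suc_atMost)
qed

lemma measurable_v[measurable]:
  "(\<lambda>c. v1 A d c m) \<in> borel_measurable (lebn (Suc d))" "(\<lambda>c. v2 B d c m) \<in> borel_measurable (lebn (Suc d))"
  unfolding v1_def v2_def P_poly_def by measurable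

lemma sets_C_two: "A > 1 \<Longrightarrow> B > 1 \<Longrightarrow> C_two A B d t \<in> sets (lebn (Suc d))"
  by (simp add: C_two_eq) measurable

lemma sets_C_sup: "t > 0 \<Longrightarrow> A > 1 \<Longrightarrow> B > 1 \<Longrightarrow> C_sup A B d t \<in> sets (lebn (Suc d))"
  by (simp add: C_sup_eq) measurable

lemma Vol_eq: "Vol d S = measure (lebn (Suc d)) S"
  by (simp only: Vol_def lessThan_Suc_atMost)

lemma ln_prod_sqrt:
  assumes "\<And>j. j < n \<Longrightarrow> (h j :: real) > 0" "s > 0" "c > 0" "n > 0"
  shows "ln (\<Prod>j<n. sqrt (c * s / (real n * h j))) = n / 2 * ln c + (n / 2 * ln (s / n) - (\<Sum>j<n. ln (h j)) / 2)"
proof -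
  have "ln (\<Prod>j<n. sqrt (c * s / (real n * h j))) = (\<Sum>j<n. ln (sqrt (c * s / (real n * h j))))"
  proof (rule ln_prod)
    fix j assume "j \<in> {..<n}"
    then have "c * s / (real n * h j) > 0" using assms by simp
    then show "sqrt (c * s / (real n * h j)) \<noteq> 0"
      by (rule less_imp_neq[OF real_sqrt_gt_zero, THEN not_sym])
  qed simp
  also have "\<dots> = (\<Sum>j<n. (ln c + ln (s / n) - ln (h j)) / 2)"
  proof (intro sum.cong refl)
    fix j assume "j \<in> {..<n}"
    then have h: "h j > 0" using assms by simp
    have e: "c * s / (real n * h j) = c * (s / n) / h j" by simp
    have "s / n > 0" using assms by simp
    then have "ln (c * (s / n) / h j) = ln c + ln (s / n) - ln (h j)"
      using h assms(3) by (simp only: ln_divide_pos mult_pos_pos ln_mult_pos)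
    moreover have "0 < c * (s / n) / h j" using h assms by simp
    ultimately show "ln (sqrt (c * s / (real n * h j))) = (ln c + ln (s / n) - ln (h j)) / 2"
      unfolding e by (simp only: ln_sqrt)
  qed
  also have "\<dots> = n / 2 * ln c + (n / 2 * ln (s / n) - (\<Sum>j<n. ln (h j)) / 2)"
    unfolding sum_divide_distrib[symmetric] by (simp add: sum.distrib sum_subtractf field_simps)
  finally show ?thesis .
qed

text \<open>The errors \<open>ln K\<close> in the single \<open>ln (h j)\<close> add up to
  \<open>O(d)\<close>, and \<open>\<Sum>j. 2 * j * ln \<gamma>\<close> supplies the quadratic term.
  The level \<open>s\<close> stays free, as it is applied both to constants and to multiples of
  \<open>d\<close>.\<close>

lemma ln_volume_ell:
  assumes K: "K \<ge> 1" and g: "\<gamma> > 0"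
    and h: "\<And>k. (\<gamma> ^ k)\<^sup>2 / K \<le> h k" "\<And>k. h k \<le> K * (\<gamma> ^ k)\<^sup>2"
  obtains C :: real where "C \<ge> 0" "\<And>d s. d \<ge> 1 \<Longrightarrow> s > 0 \<Longrightarrow>
    emeasure (lebn (Suc d)) (ell h T (Suc d) s) = ennreal (measure (lebn (Suc d)) (ell h T (Suc d) s)) \<and>
    0 < measure (lebn (Suc d)) (ell h T (Suc d) s) \<and>
    \<bar>ln (measure (lebn (Suc d)) (ell h T (Suc d) s)) - (real (Suc d) / 2 * ln (s / Suc d) - (real d)\<^sup>2 * ln \<gamma> / 2)\<bar> \<le> C * real d"
proof -
  have hp: "h k > 0" for k by (rule less_le_trans[OF _ h(1)]) (use K g in auto)
  have lh: "\<bar>ln (h k) - 2 * real k * ln \<gamma>\<bar> \<le> ln K" for k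
  proof -
    have g2: "ln ((\<gamma> ^ k)\<^sup>2) = 2 * real k * ln \<gamma>" by (simp add: ln_realpow)
    have p: "(\<gamma> ^ k)\<^sup>2 > 0" using g by simp
    have "ln ((\<gamma> ^ k)\<^sup>2 / K) \<le> ln (h k)" using h(1)[of k] K p hp[of k] by simp
    then have 1: "2 * real k * ln \<gamma> - ln K \<le> ln (h k)" using K p g2 by (simp only: ln_divide_pos; simp?)
    have "ln (h k) \<le> ln (K * (\<gamma> ^ k)\<^sup>2)" using h(2)[of k] K p hp[of k] by simp
    also have "\<dots> = ln K + 2 * real k * ln \<gamma>" using K p g2 by (simp only: ln_mult_pos; simp?)
    finally show ?thesis using 1 by simp
  qed
  define C where "C = ln (2 * pi * exp 1) + ln K + \<bar>ln \<gamma>\<bar> / 2"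
  have pe: "1 \<le> 2 * pi * exp 1"
  proof -
    have "1 * 1 \<le> (2 * pi) * exp (1 :: real)" using pi_ge_two by (intro mult_mono) auto
    then show ?thesis by simp
  qed
  have C0: "C \<ge> 0" using pe K by (simp add: C_def)
  show ?thesis
  proof (rule that[OF C0])
    fix d :: nat and s :: real
    assume d: "d \<ge> 1" and s: "s > 0"
    define n where "n = Suc d"
    have n: "n > 0" "real n = real d + 1" "real n \<le> 2 * d" using d by (auto simp: n_def)
    define E where "E = ell h T n s"
    define up where "up = (\<Prod>j<n. sqrt ((2 * pi * exp 1) * s / (n * h j)))"
    define low where "low = (\<Prod>j<n. sqrt (4 * s / (n * h j)))"
    have "2 * sqrt (s / (n * h j)) = sqrt (4 * s / (n * h j))" for j
      using real_sqrt_mult[of 4 "s / (n * h j)"] by simp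
    then have lo: "ennreal low \<le> emeasure (lebn n) E"
      using emeasure_ell_bounds(1)[where T = T and h = h, OF n(1) s hp] by (simp add: E_def low_def)
    have upb: "emeasure (lebn n) E \<le> ennreal up"
      using emeasure_ell_bounds(2)[where T = T and h = h, OF n(1) s hp] by (simp add: E_def up_def)
    define V where "V = measure (lebn n) E"
    have "emeasure (lebn n) E \<noteq> \<infinity>" using upb ennreal_less_top[of up] by (auto simp: top_unique)
    then have EV: "emeasure (lebn n) E = ennreal V" unfolding V_def by (simp add: emeasure_eq_ennreal_measure)
    have low0: "low > 0" unfolding low_def using hp s n by (intro prod_pos) auto
    have up0: "up \<ge> 0" unfolding up_def using s hp by (intro prod_nonneg) (auto intro!: divide_nonneg_nonneg less_imp_le)
    have lV: "low \<le> V" using lo unfolding EV by (subst (asm) ennreal_le_iff) (auto simp: V_def)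
    have Vu: "V \<le> up" using upb up0 unfolding EV by (subst (asm) ennreal_le_iff) auto
    have V0: "V > 0" using low0 lV by linarith
    define base where "base = n / 2 * ln (s / n) - (\<Sum>j<n. ln (h j)) / 2"
    have "ln low \<le> ln V" using low0 lV V0 by simp
    moreover have "ln low = n / 2 * ln 4 + base"
      unfolding low_def base_def by (rule ln_prod_sqrt) (use hp s n in auto)
    moreover have "0 \<le> n / 2 * ln (4::real)" by simp
    ultimately have b1: "base \<le> ln V" by linarith
    have "ln V \<le> ln up" using V0 Vu by simp
    moreover have "ln up = n / 2 * ln (2 * pi * exp 1) + base"
      unfolding up_def base_def by (rule ln_prod_sqrt) (use hp s n in auto)
    moreover have "n / 2 * ln (2 * pi * exp 1) \<le> d * ln (2 * pi * exp 1)"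
      using n pe by (intro mult_right_mono) auto
    ultimately have b2: "ln V \<le> base + d * ln (2 * pi * exp 1)" by linarith
    have "(\<Sum>j<n. 2 * real j * ln \<gamma>) = real n * (real n - 1) * ln \<gamma>"
      using sum_real_lessThan[of n] by (simp add: sum_distrib_left[symmetric] sum_distrib_right[symmetric])
    then have sj: "(\<Sum>j<n. 2 * real j * ln \<gamma>) = (real d)\<^sup>2 * ln \<gamma> + d * ln \<gamma>"
      using n by (simp add: power2_eq_square algebra_simps)
    have "\<bar>(\<Sum>j<n. ln (h j)) - (\<Sum>j<n. 2 * real j * ln \<gamma>)\<bar> \<le> (\<Sum>j<n. \<bar>ln (h j) - 2 * real j * ln \<gamma>\<bar>)"
      unfolding sum_subtractf[symmetric] by (rule sum_abs)
    also have "\<dots> \<le> (\<Sum>j<n. ln K)" by (rule sum_mono) (rule lh)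
    also have "\<dots> = n * ln K" by simp
    also have "\<dots> \<le> (2 * d) * ln K" using n K by (intro mult_right_mono) auto
    finally have sh: "\<bar>(\<Sum>j<n. ln (h j)) - ((real d)\<^sup>2 * ln \<gamma> + d * ln \<gamma>)\<bar> \<le> 2 * (d * ln K)"
      unfolding sj by simp
    have dg: "\<bar>d * ln \<gamma>\<bar> = d * \<bar>ln \<gamma>\<bar>" by (simp add: abs_mult)
    have "\<bar>ln V - (n / 2 * ln (s / n) - (real d)\<^sup>2 * ln \<gamma> / 2)\<bar> \<le> d * ln (2 * pi * exp 1) + d * ln K + d * \<bar>ln \<gamma>\<bar> / 2"
      using b1 b2 sh dg unfolding base_def by linarith
    also have "\<dots> = C * d" by (simp add: C_def algebra_simps)
    finally show "emeasure (lebn (Suc d)) (ell h T (Suc d) s) = ennreal (measure (lebn (Suc d)) (ell h T (Suc d) s)) \<and>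
      0 < measure (lebn (Suc d)) (ell h T (Suc d) s) \<and>
      \<bar>ln (measure (lebn (Suc d)) (ell h T (Suc d) s)) - (real (Suc d) / 2 * ln (s / Suc d) - (real d)\<^sup>2 * ln \<gamma> / 2)\<bar> \<le> C * real d"
      using EV V0 unfolding V_def E_def n_def by simp
  qed
qed

lemma ln_Suc_bound:
  assumes "d \<ge> (1::nat)"
  shows "0 \<le> real (Suc d) * ln (real (Suc d)) - real d * ln (real d)" "real (Suc d) * ln (real (Suc d)) - real d * ln (real d) \<le> 3 * real d"
proof -
  have d: "real d \<ge> 1" using assms by simp
  have l0: "ln (real d) \<ge> 0" "ln (real d) \<le> ln (real (Suc d))" using d by auto
  show "0 \<le> real (Suc d) * ln (real (Suc d)) - real d * ln (real d)"
    using mult_mono[of "real d" "real (Suc d)" "ln (real d)" "ln (real (Suc d))"] l0 d by simp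
  have e: "real (Suc d) = real d * (1 + 1 / real d)" using d by (simp add: field_simps)
  have "ln (real (Suc d)) = ln (real d) + ln (1 + 1 / real d)"
    unfolding e by (rule ln_mult_pos) (use d in \<open>auto intro: add_pos_nonneg\<close>)
  also have "\<dots> \<le> ln (real d) + 1 / real d" using d by (intro add_left_mono ln_add_one_self_le_self) simp
  finally have "ln (real (Suc d)) \<le> ln (real d) + 1 / real d" .
  then have "real (Suc d) * ln (real (Suc d)) \<le> real (Suc d) * (ln (real d) + 1 / real d)" by (intro mult_left_mono) auto
  also have "\<dots> = real d * ln (real d) + (ln (real d) + 1 + 1 / real d)" using d by (simp add: field_simps)
  finally have "real (Suc d) * ln (real (Suc d)) - real d * ln (real d) \<le> ln (real d) + 1 + 1 / real d" by simp
  moreover have "ln (real d) \<le> real d - 1" using d by (intro ln_le_minus_one) simp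
  moreover have "1 / real d \<le> 1" using d by simp
  ultimately show "real (Suc d) * ln (real (Suc d)) - real d * ln (real d) \<le> 3 * real d" using d by linarith
qed

lemma bigo_linear:
  assumes "\<And>d. d \<ge> 1 \<Longrightarrow> \<bar>f d\<bar> \<le> C * real d" and "t > 1"
  shows "f \<in> O(\<lambda>d. real d * ln t)"
proof (rule bigoI[where c="C / ln t"])
  have "ln t > 0" using assms(2) by simp
  show "eventually (\<lambda>d. norm (f d) \<le> C / ln t * norm (real d * ln t)) sequentially"
  proof (rule eventually_sequentiallyI[of 1])
    fix d :: nat assume "d \<ge> 1"
    then show "norm (f d) \<le> C / ln t * norm (real d * ln t)"
      using assms(1)[of d] \<open>ln t > 0\<close> by (simp add: abs_mult)
  qed
qed

context
  fixes A B t :: real and h :: "nat \<Rightarrow> real" and T :: "nat \<Rightarrow> nat \<Rightarrow> real" and K C :: real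
  assumes AB: "A > 1" "B > 1" and t: "t > 1" and K: "K \<ge> 1" and C: "C \<ge> 0"
    and h1: "\<And>k. (gam A B ^ k)\<^sup>2 / K \<le> h k" and h2: "\<And>k. h k \<le> K * (gam A B ^ k)\<^sup>2"
    and Q: "\<And>d c. Qf A B d c = ellq h T (Suc d) c"
    and vol: "\<And>d s. d \<ge> 1 \<Longrightarrow> s > 0 \<Longrightarrow>
      emeasure (lebn (Suc d)) (ell h T (Suc d) s) = ennreal (measure (lebn (Suc d)) (ell h T (Suc d) s)) \<and>
      0 < measure (lebn (Suc d)) (ell h T (Suc d) s) \<and>
      \<bar>ln (measure (lebn (Suc d)) (ell h T (Suc d) s)) - (real (Suc d) / 2 * ln (s / Suc d) - (real d)\<^sup>2 * ln (gam A B) / 2)\<bar> \<le> C * d"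
begin

abbreviation volE :: "nat \<Rightarrow> real \<Rightarrow> real" where
  "volE d s \<equiv> measure (lebn (Suc d)) (ell h T (Suc d) s)"

lemma h_pos: "h k > 0"
  by (rule less_le_trans[OF _ h1]) (use K gam_pos[of A B] in auto)

lemma half_Suc: "d \<ge> 1 \<Longrightarrow> \<bar>real (Suc d) / 2 * x\<bar> \<le> d * \<bar>x\<bar>"
  unfolding abs_mult by (intro mult_right_mono) auto

lemma fm_ell: "d \<ge> 1 \<Longrightarrow> s > 0 \<Longrightarrow> ell h T (Suc d) s \<in> fmeasurable (lebn (Suc d))"
  using vol[of d s] by (intro fmeasurableI sets_ell) (metis ennreal_less_top infinity_ennreal_def)

text \<open>For a level independent of \<open>d\<close>, the term
  \<open>(d + 1) / 2 * ln (c / (d + 1))\<close> is the source of \<open>- 1/2 * d * ln d\<close>;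
  \<open>ln_Suc_bound\<close> absorbs the shift from \<open>d + 1\<close> to
  \<open>d\<close>.\<close>

lemma volE_fixed:
  assumes d: "d \<ge> 1" and c: "c > 0"
  shows "\<bar>ln (volE d c) - (- (1 / 2) * ln (gam A B) * (real d)\<^sup>2 - (1 / 2) * real d * ln (real d))\<bar> \<le> (C + \<bar>ln c\<bar> + 2) * d"
proof -
  have "ln (c / Suc d) = ln c - ln (Suc d)" using c by (subst ln_divide_pos) auto
  then have e: "real (Suc d) / 2 * ln (c / Suc d) = real (Suc d) / 2 * ln c - (real (Suc d) * ln (Suc d)) / 2"
    by (simp only: right_diff_distrib times_divide_eq_left)
  have "\<bar>ln (volE d c) - (real (Suc d) / 2 * ln (c / Suc d) - (real d)\<^sup>2 * ln (gam A B) / 2)\<bar> \<le> C * d"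
    using vol[OF d c] by blast
  moreover have "\<bar>real (Suc d) / 2 * ln c\<bar> \<le> d * \<bar>ln c\<bar>" by (rule half_Suc[OF d])
  moreover have "- (1 / 2) * ln (gam A B) * (real d)\<^sup>2 = - ((real d)\<^sup>2 * ln (gam A B) / 2)" by simp
  moreover have "(C + \<bar>ln c\<bar> + 2) * d = C * d + d * \<bar>ln c\<bar> + 2 * d" by (simp add: algebra_simps)
  ultimately show ?thesis using ln_Suc_bound[OF d] e by linarith
qed

lemma C_two_bounds: "ell h T (Suc d) (t\<^sup>2) \<subseteq> C_two A B d t" "C_two A B d t \<subseteq> ell h T (Suc d) (2 * t\<^sup>2)"
proof -
  have nn: "0 \<le> (\<Sum>m. (v1 A d c m)\<^sup>2)" "0 \<le> (\<Sum>m. (v2 B d c m)\<^sup>2)" for c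
    by (intro suminf_nonneg summable_v[OF AB]; simp)+
  show "ell h T (Suc d) (t\<^sup>2) \<subseteq> C_two A B d t"
  proof
    fix c assume "c \<in> ell h T (Suc d) (t\<^sup>2)"
    then have "c \<in> space (lebn (Suc d))" "Qf A B d c \<le> t\<^sup>2" by (auto simp: ell_def Q)
    then show "c \<in> C_two A B d t" using nn[of c] by (simp add: C_two_eq[OF AB] Qf_def)
  qed
  show "C_two A B d t \<subseteq> ell h T (Suc d) (2 * t\<^sup>2)"
  proof
    fix c assume "c \<in> C_two A B d t"
    then show "c \<in> ell h T (Suc d) (2 * t\<^sup>2)" by (simp add: C_two_eq[OF AB] ell_def Q[symmetric] Qf_def)
  qed
qed

lemma ln_Vol_C_two:
  assumes d: "d \<ge> 1"
  shows "ln (volE d (t\<^sup>2)) \<le> ln (Vol d (C_two A B d t))" "ln (Vol d (C_two A B d t)) \<le> ln (volE d (2 * t\<^sup>2))"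
proof -
  have t2: "t\<^sup>2 > 0" "2 * t\<^sup>2 > 0" using t by auto
  have fmC: "C_two A B d t \<in> fmeasurable (lebn (Suc d))"
    by (rule fmeasurableI2[OF fm_ell[OF d t2(2)] C_two_bounds(2) sets_C_two[OF AB]])
  have 1: "volE d (t\<^sup>2) \<le> Vol d (C_two A B d t)"
    unfolding Vol_eq by (rule measure_mono_fmeasurable[OF C_two_bounds(1) sets_ell fmC])
  have 2: "Vol d (C_two A B d t) \<le> volE d (2 * t\<^sup>2)"
    unfolding Vol_eq by (rule measure_mono_fmeasurable[OF C_two_bounds(2) sets_C_two[OF AB] fm_ell[OF d t2(2)]])
  have "volE d (t\<^sup>2) > 0" using vol[OF d t2(1)] by blast
  then show "ln (volE d (t\<^sup>2)) \<le> ln (Vol d (C_two A B d t))" "ln (Vol d (C_two A B d t)) \<le> ln (volE d (2 * t\<^sup>2))"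
    using 1 2 by auto
qed

lemma C_two_asymptotics:
  assumes d: "d \<ge> 1"
  shows "\<bar>ln (Vol d (C_two A B d t)) - (- (1 / 2) * ln (gam A B) * (real d)\<^sup>2 - (1 / 2) * real d * ln (real d))\<bar>
    \<le> (C + \<bar>ln (t\<^sup>2)\<bar> + \<bar>ln (2 * t\<^sup>2)\<bar> + 2) * d"
proof -
  have t2: "t\<^sup>2 > 0" "2 * t\<^sup>2 > 0" using t by auto
  have "(C + \<bar>ln (t\<^sup>2)\<bar> + 2) * d \<le> (C + \<bar>ln (t\<^sup>2)\<bar> + \<bar>ln (2 * t\<^sup>2)\<bar> + 2) * d"
    "(C + \<bar>ln (2 * t\<^sup>2)\<bar> + 2) * d \<le> (C + \<bar>ln (t\<^sup>2)\<bar> + \<bar>ln (2 * t\<^sup>2)\<bar> + 2) * d"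
    by (intro mult_right_mono; simp)+
  then show ?thesis using ln_Vol_C_two[OF d] volE_fixed[OF d t2(1)] volE_fixed[OF d t2(2)] by linarith
qed

lemma v_linear:
  "v1 A d (\<lambda>i\<in>{..<Suc d}. x i + - y i) m = v1 A d x m - v1 A d y m"
  "v2 B d (\<lambda>i\<in>{..<Suc d}. x i + - y i) m = v2 B d x m - v2 B d y m"
proof -
  have "P_poly d (\<lambda>i\<in>{..<Suc d}. x i + - y i) z = (\<Sum>k\<le>d. (x k + - y k) * (z gchoose k))" for z
    unfolding P_poly_def by (intro sum.cong) auto
  then have P: "P_poly d (\<lambda>i\<in>{..<Suc d}. x i + - y i) z = P_poly d x z - P_poly d y z" for z
    by (simp add: P_poly_def sum_subtractf[symmetric] left_diff_distrib)
  show "v1 A d (\<lambda>i\<in>{..<Suc d}. x i + - y i) m = v1 A d x m - v1 A d y m"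
    "v2 B d (\<lambda>i\<in>{..<Suc d}. x i + - y i) m = v2 B d x m - v2 B d y m"
    unfolding v1_def v2_def P by (simp_all add: left_diff_distrib)
qed

text \<open>Both comparison ellipsoids have levels proportional to \<open>d\<close> or
  \<open>d + 1\<close>, so \<open>ln (s / Suc d)\<close> contributes only \<open>O(d)\<close> and no
  \<open>d * ln d\<close> appears.\<close>

lemma C_sup_asymptotics:
  obtains C' :: real where "\<And>d. d \<ge> 1 \<Longrightarrow> \<bar>ln (Vol d (C_sup A B d t)) - (- (1 / 2) * ln (gam A B) * (real d)\<^sup>2)\<bar> \<le> C' * d"
proof -
  obtain N K' where N: "N \<ge> 1" and K': "K' > 0" and conc:
    "\<And>d c t. d \<ge> 1 \<Longrightarrow> (\<And>m. m \<le> N * d \<Longrightarrow> \<bar>v1 A d c m\<bar> \<le> t \<and> \<bar>v2 B d c m\<bar> \<le> t)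
      \<Longrightarrow> (\<forall>m. \<bar>v1 A d c m\<bar> \<le> t \<and> \<bar>v2 B d c m\<bar> \<le> t) \<and> Qf A B d c \<le> K' * d * t\<^sup>2"
    using v_concentration[OF AB] by blast
  define C1 where "C1 = C + \<bar>ln (K' * t\<^sup>2)\<bar>"
  define C2 where "C2 = C + \<bar>ln (t\<^sup>2)\<bar> + (2 + 8 * real N) * ln 2 + 4 * real N * ln 3"
  have t0: "t > 0" "t\<^sup>2 > 0" using t by auto
  show ?thesis
  proof (rule that[of "C1 + C2"])
    fix d :: nat assume d: "d \<ge> 1"
    let ?X = "C_sup A B d t" and ?m = "- (1 / 2) * ln (gam A B) * (real d)\<^sup>2"
    have mm: "?m = - ((real d)\<^sup>2 * ln (gam A B) / 2)" by simp
    define s1 where "s1 = K' * d * t\<^sup>2"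
    have s1: "s1 > 0" using K' d t0 by (simp add: s1_def)
    have up: "?X \<subseteq> ell h T (Suc d) s1"
    proof
      fix c assume "c \<in> ?X"
      then have c: "c \<in> space (lebn (Suc d))" "\<And>m. \<bar>v1 A d c m\<bar> \<le> t \<and> \<bar>v2 B d c m\<bar> \<le> t"
        by (auto simp: C_sup_eq[OF t0(1) AB])
      then show "c \<in> ell h T (Suc d) s1" using conc[OF d c(2)] by (simp add: ell_def Q[symmetric] s1_def)
    qed
    have X_sets: "?X \<in> sets (lebn (Suc d))" by (rule sets_C_sup[OF t0(1) AB])
    have fmX: "?X \<in> fmeasurable (lebn (Suc d))"
      by (rule fmeasurableI2[OF fm_ell[OF d s1] up X_sets])
    have EX: "emeasure (lebn (Suc d)) ?X = ennreal (Vol d ?X)"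
      unfolding Vol_eq using fmX by (simp add: emeasure_eq_measure2)
    have upV: "Vol d ?X \<le> volE d s1"
      unfolding Vol_eq by (rule measure_mono_fmeasurable[OF up X_sets fm_ell[OF d s1]])
    define s2 where "s2 = t\<^sup>2 * Suc d"
    have s2: "s2 > 0" using t0 by (simp add: s2_def)
    define J where "J = {..N * d} \<times> (UNIV :: bool set)"
    \<comment> \<open>Division by \<open>t\<close> makes cells of side one correspond to the bound
      \<open>t\<close>. The Boolean selects the direction, and the indices
      \<open>m \<le> N * d\<close> suffice by concentration.\<close>
    define f where "f = (\<lambda>(m, b) c. (if b then v1 A d c m else v2 B d c m) / t)"
    \<comment> \<open>From \<open>|floor y| \<le> |y| + 1 \<le> y\<^sup>2 + 2\<close>: the squares
      add up to at most \<open>Suc d\<close>, and every functional adds \<open>2\<close>. Both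
      \<open>R\<close> and \<open>card J\<close> are \<open>O(d)\<close>, so the number of cells is
      \<open>exp(O(d))\<close>.\<close>
    define R where "R = Suc d + 2 * card J"
    have J: "finite J" "card J = 2 * (N * d + 1)" by (auto simp: J_def card_cartesian_product)
    have cells: "emeasure (lebn (Suc d)) (ell h T (Suc d) s2) \<le> ennreal (2 ^ R * 3 ^ card J) *
       emeasure (lebn (Suc d)) {c \<in> space (lebn (Suc d)). \<forall>j\<in>J. \<bar>f j c\<bar> \<le> 1}"
    proof (rule emeasure_le_cells[OF J(1) sets_ell])
      fix j assume "j \<in> J"
      show "f j \<in> borel_measurable (lebn (Suc d))" by (cases j) (auto simp: f_def)
      show "f j (\<lambda>i\<in>{..<Suc d}. x i + - y i) = f j x - f j y" for x y
      proof -
        obtain m b where j: "j = (m, b)" by (cases j)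
        show ?thesis
          unfolding j f_def prod.case by (cases b) (simp_all only: v_linear diff_divide_distrib if_True if_False)
      qed
    next
      fix c assume c: "c \<in> ell h T (Suc d) s2"
      have "(\<Sum>j\<in>J. (f j c)\<^sup>2) = (\<Sum>m\<le>N * d. (v1 A d c m / t)\<^sup>2 + (v2 B d c m / t)\<^sup>2)"
        unfolding J_def sum.cartesian_product' f_def UNIV_bool by (simp add: add.commute)
      also have "\<dots> = ((\<Sum>m<Suc (N * d). (v1 A d c m)\<^sup>2) + (\<Sum>m<Suc (N * d). (v2 B d c m)\<^sup>2)) / t\<^sup>2"
        unfolding lessThan_Suc_atMost by (simp add: sum.distrib power_divide sum_divide_distrib[symmetric] add_divide_distrib)
      also have "\<dots> \<le> Qf A B d c / t\<^sup>2"
        unfolding Qf_def by (intro divide_right_mono add_mono sum_le_suminf summable_v[OF AB]) auto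
      also have "\<dots> \<le> Suc d" using c t0 by (simp add: ell_def Q s2_def divide_le_eq mult.commute)
      finally have fs: "(\<Sum>j\<in>J. (f j c)\<^sup>2) \<le> Suc d" .
      have "real_of_int (\<Sum>j\<in>J. \<bar>\<lfloor>f j c\<rfloor>\<bar>) = (\<Sum>j\<in>J. real_of_int \<bar>\<lfloor>f j c\<rfloor>\<bar>)" by simp
      also have "\<dots> \<le> (\<Sum>j\<in>J. (f j c)\<^sup>2 + 2)"
      proof (rule sum_mono)
        fix j
        have "real_of_int \<bar>\<lfloor>f j c\<rfloor>\<bar> \<le> \<bar>f j c\<bar> + 1" by linarith
        moreover have "\<bar>f j c\<bar> \<le> (f j c)\<^sup>2 + 1"
        proof -
          have "0 \<le> (\<bar>f j c\<bar> - 1)\<^sup>2" by simp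
          then have "2 * \<bar>f j c\<bar> \<le> (f j c)\<^sup>2 + 1" by (simp add: power2_diff)
          then show ?thesis using abs_ge_zero[of "f j c"] by linarith
        qed
        ultimately show "real_of_int \<bar>\<lfloor>f j c\<rfloor>\<bar> \<le> (f j c)\<^sup>2 + 2" by linarith
      qed
      also have "\<dots> = (\<Sum>j\<in>J. (f j c)\<^sup>2) + 2 * card J" by (simp add: sum.distrib)
      also have "\<dots> \<le> real R" using fs by (simp add: R_def)
      finally show "(\<Sum>j\<in>J. \<bar>\<lfloor>f j c\<rfloor>\<bar>) \<le> int R" by linarith
    qed
    have "{c \<in> space (lebn (Suc d)). \<forall>j\<in>J. \<bar>f j c\<bar> \<le> 1} \<subseteq> ?X"
    proof
      fix c assume c: "c \<in> {c \<in> space (lebn (Suc d)). \<forall>j\<in>J. \<bar>f j c\<bar> \<le> 1}"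
      have "\<bar>v1 A d c m\<bar> \<le> t \<and> \<bar>v2 B d c m\<bar> \<le> t" if "m \<le> N * d" for m
      proof -
        have "\<bar>f (m, True) c\<bar> \<le> 1" "\<bar>f (m, False) c\<bar> \<le> 1" using c that by (auto simp: J_def)
        then show ?thesis using t0 by (simp add: f_def abs_divide divide_le_eq)
      qed
      from conc[OF d this] show "c \<in> ?X" using c by (simp add: C_sup_eq[OF t0(1) AB])
    qed
    then have "emeasure (lebn (Suc d)) {c \<in> space (lebn (Suc d)). \<forall>j\<in>J. \<bar>f j c\<bar> \<le> 1} \<le> emeasure (lebn (Suc d)) ?X"
      by (rule emeasure_mono[OF _ X_sets])
    then have "emeasure (lebn (Suc d)) (ell h T (Suc d) s2) \<le> ennreal (2 ^ R * 3 ^ card J) * emeasure (lebn (Suc d)) ?X"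
      using cells by (meson mult_left_mono order_trans zero_le)
    then have "ennreal (volE d s2) \<le> ennreal (2 ^ R * 3 ^ card J) * ennreal (Vol d ?X)"
      using vol[OF d s2] EX by simp
    also have "\<dots> = ennreal (2 ^ R * 3 ^ card J * Vol d ?X)"
      by (rule ennreal_mult[symmetric]) (auto simp: Vol_eq)
    finally have lowV: "volE d s2 \<le> 2 ^ R * 3 ^ card J * Vol d ?X"
      by (subst (asm) ennreal_le_iff) (auto simp: Vol_eq)
    have vs: "volE d s1 > 0" "volE d s2 > 0" using vol[OF d s1] vol[OF d s2] by blast+
    have V0: "Vol d ?X > 0"
    proof (rule ccontr)
      assume "\<not> ?thesis"
      then have "Vol d ?X = 0" by (simp add: Vol_eq zero_less_measure_iff)
      then show False using lowV vs by simp
    qed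
    have "ln (volE d s2) \<le> ln (2 ^ R * 3 ^ card J * Vol d ?X)" using lowV vs V0 by simp
    also have "\<dots> = R * ln 2 + card J * ln 3 + ln (Vol d ?X)"
      using V0 by (simp add: ln_mult_pos ln_realpow)
    finally have l1: "ln (volE d s2) - (R * ln 2 + card J * ln 3) \<le> ln (Vol d ?X)" by simp
    have cJ: "real (card J) \<le> 4 * real N * d"
    proof -
      have "1 \<le> N * d" using N d by simp
      then have "card J \<le> 4 * (N * d)" unfolding J(2) by simp
      then have "real (card J) \<le> real (4 * (N * d))" by (simp only: of_nat_le_iff)
      then show ?thesis by simp
    qed
    have "real R \<le> 2 * real d + 2 * (4 * real N * d)" unfolding R_def using cJ d by simp
    then have cR: "real R \<le> (2 + 8 * real N) * d" by (simp add: algebra_simps)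
    have r1: "R * ln 2 \<le> (2 + 8 * real N) * ln 2 * d"
      using mult_right_mono[OF cR, of "ln 2"] by (simp add: mult.assoc mult.commute mult.left_commute)
    have r2: "card J * ln 3 \<le> 4 * real N * ln 3 * d"
      using mult_right_mono[OF cJ, of "ln 3"] by (simp add: mult.assoc mult.commute mult.left_commute)
    have "\<bar>ln (volE d s2) - (real (Suc d) / 2 * ln (s2 / Suc d) - (real d)\<^sup>2 * ln (gam A B) / 2)\<bar> \<le> C * d"
      using vol[OF d s2] by blast
    moreover have "s2 / Suc d = t\<^sup>2" by (simp add: s2_def)
    moreover have "\<bar>real (Suc d) / 2 * ln (t\<^sup>2)\<bar> \<le> d * \<bar>ln (t\<^sup>2)\<bar>" by (rule half_Suc[OF d])
    ultimately have lo2: "?m - C * d - d * \<bar>ln (t\<^sup>2)\<bar> \<le> ln (volE d s2)" unfolding mm by (simp only:)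
    have C2d: "C2 * d = C * d + d * \<bar>ln (t\<^sup>2)\<bar> + (2 + 8 * real N) * ln 2 * d + 4 * real N * ln 3 * d"
      by (simp add: C2_def algebra_simps)
    have lower: "?m - C2 * d \<le> ln (Vol d ?X)" using l1 lo2 r1 r2 C2d by linarith
    have "ln (Vol d ?X) \<le> ln (volE d s1)" using upV V0 vs by simp
    moreover have "\<bar>ln (volE d s1) - (real (Suc d) / 2 * ln (s1 / Suc d) - (real d)\<^sup>2 * ln (gam A B) / 2)\<bar> \<le> C * d"
      using vol[OF d s1] by blast
    moreover have "real (Suc d) / 2 * ln (s1 / Suc d) \<le> d * \<bar>ln (K' * t\<^sup>2)\<bar>"
    proof -
      have "s1 / Suc d \<le> K' * t\<^sup>2" using K' t0 by (simp add: s1_def field_simps)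
      then have "ln (s1 / Suc d) \<le> ln (K' * t\<^sup>2)" using s1 K' t0 by (subst ln_le_cancel_iff) auto
      then have "real (Suc d) / 2 * ln (s1 / Suc d) \<le> real (Suc d) / 2 * ln (K' * t\<^sup>2)" by (intro mult_left_mono) auto
      also have "\<dots> \<le> d * \<bar>ln (K' * t\<^sup>2)\<bar>" using half_Suc[OF d, of "ln (K' * t\<^sup>2)"] by linarith
      finally show ?thesis .
    qed
    moreover have C1d: "C1 * d = C * d + d * \<bar>ln (K' * t\<^sup>2)\<bar>" by (simp add: C1_def algebra_simps)
    ultimately have upper: "ln (Vol d ?X) \<le> ?m + C1 * d" unfolding mm by linarith
    have "0 \<le> C1 * d" "0 \<le> C2 * d" using C by (auto simp: C1_def C2_def)
    moreover have "(C1 + C2) * d = C1 * d + C2 * d" by (simp add: algebra_simps)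
    ultimately show "\<bar>ln (Vol d ?X) - ?m\<bar> \<le> (C1 + C2) * d" using lower upper by linarith
  qed
qed

text \<open>The count lies between the volumes of ellipsoids of the levels
  \<open>t\<^sup>2 / 4\<close> and \<open>s3\<close>, both independent of \<open>d\<close>, whose
  logarithms agree up to \<open>O(d)\<close>.\<close>

lemma lattice_asymptotics:
  assumes g: "gam A B < 1"
  obtains C' :: real where "\<And>d. d \<ge> 1 \<Longrightarrow>
    \<bar>ln (real (card (C_two A B d t \<inter> integer_points d))) - ln (Vol d (C_two A B d t))\<bar> \<le> C' * d"
proof -
  define \<gamma> where "\<gamma> = gam A B"
  have \<gamma>: "0 < \<gamma>" "\<gamma> < 1" using g gam_pos by (auto simp: \<gamma>_def)
  have g2: "\<gamma>\<^sup>2 < 1" using \<gamma> by (simp add: power_less_one_iff)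
  \<comment> \<open>The geometric series bounding all partial sums of \<open>h\<close>; here
    \<open>gam A B < 1\<close> is essential, since \<open>H\<close> must not depend on
    \<open>d\<close>.\<close>
  define H where "H = K / (1 - \<gamma>\<^sup>2)"
  have H0: "H > 0" using K g2 by (simp add: H_def)
  have sumh: "(\<Sum>j<n. h j) \<le> H" for n
  proof -
    have "(\<Sum>j<n. h j) \<le> (\<Sum>j<n. K * (\<gamma>\<^sup>2) ^ j)"
      using h2 by (intro sum_mono) (simp add: \<gamma>_def power_mult[symmetric] mult.commute)
    also have "\<dots> \<le> (\<Sum>j. K * (\<gamma>\<^sup>2) ^ j)"
      using K g2 by (intro sum_le_suminf summable_mult summable_geometric) auto
    also have "\<dots> = H" using g2 by (subst suminf_mult) (auto intro!: summable_geometric simp: suminf_geometric H_def)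
    finally show ?thesis .
  qed
  have t2: "t\<^sup>2 > 0" "2 * t\<^sup>2 > 0" "t\<^sup>2 / 4 > 0" using t by auto
  define s3 where "s3 = (sqrt (2 * t\<^sup>2) + sqrt H)\<^sup>2"
  have s3: "s3 > 0"
  proof -
    have "sqrt (2 * t\<^sup>2) + sqrt H > 0" using H0 by (intro add_nonneg_pos) auto
    then show ?thesis unfolding s3_def by simp
  qed
  define C1 where "C1 = (C + \<bar>ln (t\<^sup>2 / 4)\<bar> + 2) + (C + \<bar>ln s3\<bar> + 2)"
  define C2 where "C2 = C + \<bar>ln (t\<^sup>2)\<bar> + \<bar>ln (2 * t\<^sup>2)\<bar> + 2"
  show ?thesis
  proof (rule that[of "C1 + C2"])
    fix d :: nat assume d: "d \<ge> 1"
    let ?n = "Suc d"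
    define L where "L s = {v \<in> PiE {..<?n} (\<lambda>_. \<int>). ellq h T ?n v \<le> s}" for s
    have ip_eq: "integer_points d = PiE {..<?n} (\<lambda>_. \<int>)" by (simp only: integer_points_def lessThan_Suc_atMost)
    have cardL: "card V \<le> nat \<lfloor>volE d s3\<rfloor>" if V: "V \<subseteq> L (2 * t\<^sup>2)" "finite V" for V
    proof -
      have "of_nat (card V) \<le> emeasure (lebn ?n) (ell h T ?n ((sqrt (2 * t\<^sup>2) + sqrt H)\<^sup>2))"
      proof (rule card_lattice_le_emeasure_ell[OF V(2) _ _ _ _ sumh])
        show "V \<subseteq> PiE {..<?n} (\<lambda>_. \<int>)" using V(1) unfolding L_def by blast
        show "ellq h T ?n v \<le> 2 * t\<^sup>2" if "v \<in> V" for v using V(1) that unfolding L_def by blast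
        show "0 \<le> 2 * t\<^sup>2" by simp
        show "0 \<le> h j" for j by (rule less_imp_le[OF h_pos])
      qed
      also have "\<dots> = ennreal (volE d s3)" unfolding s3_def[symmetric] using vol[OF d s3] by blast
      finally have "ennreal (real (card V)) \<le> ennreal (volE d s3)" by (simp add: ennreal_of_nat_eq_real_of_nat)
      then have "real (card V) \<le> volE d s3" by (subst (asm) ennreal_le_iff) auto
      then show ?thesis by linarith
    qed
    \<comment> \<open>The packing estimate treats finite sets only, so finiteness is deduced from
      the uniform bound on the size of finite subsets.\<close>
    have finL: "finite (L (2 * t\<^sup>2)) \<and> card (L (2 * t\<^sup>2)) \<le> nat \<lfloor>volE d s3\<rfloor>"
      by (rule finite_if_finite_subsets_card_bdd) (use cardL in auto)
    have sub1: "L (t\<^sup>2) \<subseteq> C_two A B d t \<inter> integer_points d"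
    proof
      fix v assume v: "v \<in> L (t\<^sup>2)"
      then have "v \<in> ell h T ?n (t\<^sup>2)" by (auto simp: L_def ell_def space_PiM PiE_def)
      then show "v \<in> C_two A B d t \<inter> integer_points d" using C_two_bounds(1) v by (auto simp: ip_eq L_def)
    qed
    have sub2: "C_two A B d t \<inter> integer_points d \<subseteq> L (2 * t\<^sup>2)"
      using C_two_bounds(2) by (auto simp: ip_eq L_def ell_def)
    define c where "c = card (C_two A B d t \<inter> integer_points d)"
    have finC: "finite (C_two A B d t \<inter> integer_points d)" using sub2 finL finite_subset by blast
    have up: "real c \<le> volE d s3"
    proof -
      have "c \<le> card (L (2 * t\<^sup>2))" unfolding c_def using sub2 finL by (intro card_mono) auto
      then have "c \<le> nat \<lfloor>volE d s3\<rfloor>" using finL by simp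
      moreover have "0 \<le> volE d s3" by simp
      ultimately show ?thesis by linarith
    qed
    have low: "volE d (t\<^sup>2 / 4) \<le> real c"
    proof -
      have finL1: "finite (L (t\<^sup>2))" using sub1 finC finite_subset by blast
      have "emeasure (lebn ?n) (ell h T ?n (t\<^sup>2 / 4)) \<le> of_nat (card (L (t\<^sup>2)))"
        unfolding L_def by (rule emeasure_ell_le_card_lattice) (use finL1 h_pos in \<open>auto simp: L_def less_imp_le\<close>)
      also have "\<dots> \<le> of_nat c" unfolding c_def using sub1 finC by (intro of_nat_mono card_mono) auto
      finally have "ennreal (volE d (t\<^sup>2 / 4)) \<le> ennreal (real c)"
        using vol[OF d t2(3)] by (simp add: ennreal_of_nat_eq_real_of_nat)
      then show ?thesis by (subst (asm) ennreal_le_iff) auto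
    qed
    have v0: "volE d (t\<^sup>2 / 4) > 0" using vol[OF d t2(3)] by blast
    then have c0: "real c > 0" using low by linarith
    have "ln (volE d (t\<^sup>2 / 4)) \<le> ln (real c)" using low v0 c0 by (subst ln_le_cancel_iff) auto
    moreover have "ln (real c) \<le> ln (volE d s3)" using up c0 by (subst ln_le_cancel_iff) auto
    moreover have "(C1 + C2) * d = (C + \<bar>ln (t\<^sup>2 / 4)\<bar> + 2) * d + (C + \<bar>ln s3\<bar> + 2) * d + C2 * d"
      by (simp add: C1_def algebra_simps)
    moreover have "0 \<le> (C + \<bar>ln (t\<^sup>2 / 4)\<bar> + 2) * d" "0 \<le> (C + \<bar>ln s3\<bar> + 2) * d" using C by auto
    ultimately show "\<bar>ln (real (card (C_two A B d t \<inter> integer_points d))) - ln (Vol d (C_two A B d t))\<bar> \<le> (C1 + C2) * d"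
      using volE_fixed[OF d t2(3)] volE_fixed[OF d s3] C_two_asymptotics[OF d]
      unfolding c_def[symmetric] C2_def[symmetric] by linarith
  qed
qed

end

theorem theorem2p1:
  fixes A B t :: real
  assumes "A > 1" and "B > 1" and "t > 1"
  shows "(\<lambda>d::nat. ln (Vol d (C_two A B d t))
            - (- (1 / 2) * ln (gamma_cap A B) * (real d)\<^sup>2 - (1 / 2) * real d * ln (real d)))
         \<in> O(\<lambda>d. real d * ln t)
      \<and> (\<lambda>d::nat. ln (Vol d (C_sup A B d t))
            - (- (1 / 2) * ln (gamma_cap A B) * (real d)\<^sup>2))
         \<in> O(\<lambda>d. real d * ln t)
      \<and> (gamma_cap A B \<in> {0<..<1} \<longrightarrow>
         (\<lambda>d::nat. ln (real (card (C_two A B d t \<inter> integer_points d)))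
            - ln (Vol d (C_two A B d t)))
         \<in> O(\<lambda>d. real d * ln t))"
proof (rule Qf_diagonalization[OF assms(1,2)])
  note AB = assms(1,2)
  have g: "gamma_cap A B = gam A B" by (rule gamma_cap_eq_gam[OF AB])
  fix h T and K :: real
  assume K: "K \<ge> 1" and h: "\<And>k. (gam A B ^ k)\<^sup>2 / K \<le> h k" "\<And>k. h k \<le> K * (gam A B ^ k)\<^sup>2"
    and Q: "\<And>d c. Qf A B d c = ellq h T (Suc d) c"
  obtain C :: real where C: "C \<ge> 0" and vol: "\<And>d s. d \<ge> 1 \<Longrightarrow> s > 0 \<Longrightarrow>
      emeasure (lebn (Suc d)) (ell h T (Suc d) s) = ennreal (measure (lebn (Suc d)) (ell h T (Suc d) s)) \<and>
      0 < measure (lebn (Suc d)) (ell h T (Suc d) s) \<and>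
      \<bar>ln (measure (lebn (Suc d)) (ell h T (Suc d) s)) - (real (Suc d) / 2 * ln (s / Suc d) - (real d)\<^sup>2 * ln (gam A B) / 2)\<bar> \<le> C * d"
  proof (rule ln_volume_ell[where \<gamma> = "gam A B" and T = T and h = h and K = K])
    show "K \<ge> 1" by (rule K)
    show "gam A B > 0" by (rule gam_pos)
    show "(gam A B ^ k)\<^sup>2 / K \<le> h k" "h k \<le> K * (gam A B ^ k)\<^sup>2" for k by (rule h)+
  qed (rule that)
  note ctx = AB assms(3) K C h Q vol
  show ?thesis unfolding g
  proof (intro conjI impI)
    show "(\<lambda>d::nat. ln (Vol d (C_two A B d t))
            - (- (1 / 2) * ln (gam A B) * (real d)\<^sup>2 - (1 / 2) * real d * ln (real d))) \<in> O(\<lambda>d. real d * ln t)"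
      by (rule bigo_linear[OF C_two_asymptotics[where A = A and B = B and t = t and K = K and C = C and h = h and T = T, OF ctx] assms(3)])
    obtain C' :: real where "\<And>d. d \<ge> 1 \<Longrightarrow> \<bar>ln (Vol d (C_sup A B d t)) - (- (1 / 2) * ln (gam A B) * (real d)\<^sup>2)\<bar> \<le> C' * d"
      using C_sup_asymptotics[where A = A and B = B and t = t and K = K and C = C and h = h and T = T, OF ctx] by blast
    then show "(\<lambda>d::nat. ln (Vol d (C_sup A B d t)) - (- (1 / 2) * ln (gam A B) * (real d)\<^sup>2)) \<in> O(\<lambda>d. real d * ln t)"
      by (rule bigo_linear[OF _ assms(3)])
    assume "gam A B \<in> {0<..<1}"
    then have "gam A B < 1" by simp
    then obtain C'' :: real where "\<And>d. d \<ge> 1 \<Longrightarrow>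
        \<bar>ln (real (card (C_two A B d t \<inter> integer_points d))) - ln (Vol d (C_two A B d t))\<bar> \<le> C'' * d"
      using lattice_asymptotics[where A = A and B = B and t = t and K = K and C = C and h = h and T = T, OF ctx] by blast
    then show "(\<lambda>d::nat. ln (real (card (C_two A B d t \<inter> integer_points d))) - ln (Vol d (C_two A B d t))) \<in> O(\<lambda>d. real d * ln t)"
      by (rule bigo_linear[OF _ assms(3)])
  qed
qed

end
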